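(* Let $H$ be a Hopf algebra over a commutative ring $k$ that is finitely generated projective as a $k$-module. Then there are isomorphisms of $k$-modules $$\int_{H^*}^l\cong\int_{H^*}^r\cong\Big(\int_H^l\Big)^*\cong\Big(\int_H^r\Big)^*.$$
   Context: $(\cdot)^*=\mathrm{Hom}_k(\cdot,k)$, and $H^*$ carries the convolution product $\langle h^**k^*,h\rangle=\langle h^*,h_{(1)}\rangle\langle k^*,h_{(2)}\rangle$. The integral spaces are $$\int_H^l=\{t\in H\mid ht=\varepsilon(h)t\ \forall h\in H\},\quad\int_H^r=\{t\in H\mid th=\varepsilon(h)t\ \forall h\in H\},$$ $$\int_{H^*}^l=\{\varphi\in H^*\mid h^**\varphi=\langle h^*,1\rangle\varphi\ \forall h^*\in H^*\},\quad\int_{H^*}^r=\{\varphi\in H^*\mid\varphi*h^*=\langle h^*,1\rangle\varphi\ \forall h^*\in H^*\},$$ where $\varepsilon$ is the counit of $H$. *)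

theory Defs
  imports "HOL-Algebra.Module"
begin

section \<open>Linear maps, duals and finitely generated projective modules\<close>

definition mod_hom ::
    "('a, 'r) ring_scheme \<Rightarrow> ('a, 'm, 's) module_scheme \<Rightarrow> ('a, 'n, 't) module_scheme \<Rightarrow> ('m \<Rightarrow> 'n) set"
  where "mod_hom R M N =
    {f \<in> carrier M \<rightarrow> carrier N.
      (\<forall>x\<in>carrier M. \<forall>y\<in>carrier M. f (x \<oplus>\<^bsub>M\<^esub> y) = f x \<oplus>\<^bsub>N\<^esub> f y) \<and>
      (\<forall>r\<in>carrier R. \<forall>x\<in>carrier M. f (r \<odot>\<^bsub>M\<^esub> x) = r \<odot>\<^bsub>N\<^esub> f x)}"

definition mod_isomorphic ::
    "('a, 'r) ring_scheme \<Rightarrow> ('a, 'm, 's) module_scheme \<Rightarrow> ('a, 'n, 't) module_scheme \<Rightarrow> bool"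
  where "mod_isomorphic R M N \<longleftrightarrow> (\<exists>f\<in>mod_hom R M N. bij_betw f (carrier M) (carrier N))"

definition regular_module :: "('a, 'r) ring_scheme \<Rightarrow> ('a, 'a) module"
  where "regular_module R =
    \<lparr>carrier = carrier R, mult = mult R, one = one R, zero = zero R, add = add R, smult = mult R\<rparr>"

text \<open>
  The elements of the dual module are taken to be extensional functions, so that equality in the
  dual is equality on the carrier. Only the module structure is meaningful here: the fields
  \<^const>\<open>mult\<close> and \<^const>\<open>one\<close> of the record are irrelevant. The convolution
  product is introduced separately below.
\<close>

definition dual :: "('a, 'r) ring_scheme \<Rightarrow> ('a, 'm, 's) module_scheme \<Rightarrow> ('a, 'm \<Rightarrow> 'a) module"
  where "dual R M =
    \<lparr>carrier = mod_hom R M (regular_module R) \<inter> extensional (carrier M),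
     mult = undefined, one = undefined,
     zero = (\<lambda>x\<in>carrier M. \<zero>\<^bsub>R\<^esub>),
     add = (\<lambda>f g. \<lambda>x\<in>carrier M. f x \<oplus>\<^bsub>R\<^esub> g x),
     smult = (\<lambda>r f. \<lambda>x\<in>carrier M. r \<otimes>\<^bsub>R\<^esub> f x)\<rparr>"

definition free_module :: "('a, 'r) ring_scheme \<Rightarrow> 'i set \<Rightarrow> ('a, 'i \<Rightarrow> 'a) module"
  where "free_module R I =
    \<lparr>carrier = {c \<in> I \<rightarrow>\<^sub>E carrier R. finite {i \<in> I. c i \<noteq> \<zero>\<^bsub>R\<^esub>}},
     mult = undefined, one = undefined,
     zero = (\<lambda>i\<in>I. \<zero>\<^bsub>R\<^esub>),
     add = (\<lambda>c d. \<lambda>i\<in>I. c i \<oplus>\<^bsub>R\<^esub> d i),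
     smult = (\<lambda>r c. \<lambda>i\<in>I. r \<otimes>\<^bsub>R\<^esub> c i)\<rparr>"

definition finitely_generated_module ::
    "('a, 'r) ring_scheme \<Rightarrow> ('a, 'm, 's) module_scheme \<Rightarrow> bool"
  where "finitely_generated_module R M \<longleftrightarrow>
    (\<exists>A\<subseteq>carrier M. finite A \<and>
      (\<forall>x\<in>carrier M. \<exists>c\<in>A \<rightarrow> carrier R. x = (\<Oplus>\<^bsub>M\<^esub>a\<in>A. c a \<odot>\<^bsub>M\<^esub> a)))"

text \<open>
  A module is projective if it is a direct summand of a free module, i.e. if it is the image of a
  split epimorphism from a free module. Bases indexed by subsets of the type of \<open>M\<close> suffice:
  a projective \<open>M\<close> is a direct summand of the free module on its own carrier.
\<close>

definition projective_module ::
    "('a, 'r) ring_scheme \<Rightarrow> ('a, 'm, 's) module_scheme \<Rightarrow> bool"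
  where "projective_module R M \<longleftrightarrow>
    (\<exists>I :: 'm set. \<exists>p\<in>mod_hom R (free_module R I) M. \<exists>s\<in>mod_hom R M (free_module R I).
      \<forall>x\<in>carrier M. p (s x) = x)"


section \<open>Tensor products\<close>

text \<open>
  The list \<open>[(m\<^sub>1, n\<^sub>1), \<dots>, (m\<^sub>j, n\<^sub>j)]\<close> stands for the formal sum
  \<open>m\<^sub>1 \<otimes> n\<^sub>1 + \<dots> + m\<^sub>j \<otimes> n\<^sub>j\<close>. The tensor product is the quotient of
  the monoid of these lists by the least congruence that makes concatenation commutative and
  \<open>\<otimes>\<close> additive in both arguments and balanced over \<open>R\<close>. Negatives then exist
  automatically, because \<open>(- m) \<otimes> n\<close> is inverse to \<open>m \<otimes> n\<close>.
\<close>

definition formal_sums :: "('a, 'm, 's) module_scheme \<Rightarrow> ('a, 'n, 't) module_scheme \<Rightarrow> ('m \<times> 'n) list set"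
  where "formal_sums M N = lists (carrier M \<times> carrier N)"

inductive tensor_eq ::
    "('a, 'r) ring_scheme \<Rightarrow> ('a, 'm, 's) module_scheme \<Rightarrow> ('a, 'n, 't) module_scheme \<Rightarrow>
     ('m \<times> 'n) list \<Rightarrow> ('m \<times> 'n) list \<Rightarrow> bool"
  for R M N where
  refl: "xs \<in> formal_sums M N \<Longrightarrow> tensor_eq R M N xs xs"
| sym: "tensor_eq R M N xs ys \<Longrightarrow> tensor_eq R M N ys xs"
| trans: "\<lbrakk>tensor_eq R M N xs ys; tensor_eq R M N ys zs\<rbrakk> \<Longrightarrow> tensor_eq R M N xs zs"
| append: "\<lbrakk>tensor_eq R M N xs xs'; tensor_eq R M N ys ys'\<rbrakk> \<Longrightarrow> tensor_eq R M N (xs @ ys) (xs' @ ys')"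
| comm: "\<lbrakk>xs \<in> formal_sums M N; ys \<in> formal_sums M N\<rbrakk>
    \<Longrightarrow> tensor_eq R M N (xs @ ys) (ys @ xs)"
| zero: "n \<in> carrier N \<Longrightarrow> tensor_eq R M N [(\<zero>\<^bsub>M\<^esub>, n)] []"
| add_left: "\<lbrakk>m \<in> carrier M; m' \<in> carrier M; n \<in> carrier N\<rbrakk>
    \<Longrightarrow> tensor_eq R M N [(m \<oplus>\<^bsub>M\<^esub> m', n)] [(m, n), (m', n)]"
| add_right: "\<lbrakk>m \<in> carrier M; n \<in> carrier N; n' \<in> carrier N\<rbrakk>
    \<Longrightarrow> tensor_eq R M N [(m, n \<oplus>\<^bsub>N\<^esub> n')] [(m, n), (m, n')]"
| balanced: "\<lbrakk>r \<in> carrier R; m \<in> carrier M; n \<in> carrier N\<rbrakk>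
    \<Longrightarrow> tensor_eq R M N [(r \<odot>\<^bsub>M\<^esub> m, n)] [(m, r \<odot>\<^bsub>N\<^esub> n)]"

definition tensor_class ::
    "('a, 'r) ring_scheme \<Rightarrow> ('a, 'm, 's) module_scheme \<Rightarrow> ('a, 'n, 't) module_scheme \<Rightarrow>
     ('m \<times> 'n) list \<Rightarrow> ('m \<times> 'n) list set"
  where "tensor_class R M N xs = {ys. tensor_eq R M N xs ys}"

definition tensor_rep :: "('m \<times> 'n) list set \<Rightarrow> ('m \<times> 'n) list"
  where "tensor_rep X = (SOME xs. xs \<in> X)"

text \<open>
  If \<open>M\<close> and \<open>N\<close> are algebras, then the fields \<^const>\<open>mult\<close> and
  \<^const>\<open>one\<close> below give the tensor product algebra, with
  \<open>(a \<otimes> b) (c \<otimes> d) = a c \<otimes> b d\<close>; for mere modules they are irrelevant.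
\<close>

definition tensor ::
    "('a, 'r) ring_scheme \<Rightarrow> ('a, 'm, 's) module_scheme \<Rightarrow> ('a, 'n, 't) module_scheme \<Rightarrow>
     ('a, ('m \<times> 'n) list set) module"
  where "tensor R M N =
    \<lparr>carrier = tensor_class R M N ` formal_sums M N,
     mult = (\<lambda>X Y. tensor_class R M N
        [(a \<otimes>\<^bsub>M\<^esub> c, b \<otimes>\<^bsub>N\<^esub> d). (a, b) \<leftarrow> tensor_rep X, (c, d) \<leftarrow> tensor_rep Y]),
     one = tensor_class R M N [(\<one>\<^bsub>M\<^esub>, \<one>\<^bsub>N\<^esub>)],
     zero = tensor_class R M N [],
     add = (\<lambda>X Y. tensor_class R M N (tensor_rep X @ tensor_rep Y)),
     smult = (\<lambda>r X. tensor_class R M N (map (\<lambda>(m, n). (r \<odot>\<^bsub>M\<^esub> m, n)) (tensor_rep X)))\<rparr>"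

definition pure_tensor ::
    "('a, 'r) ring_scheme \<Rightarrow> ('a, 'm, 's) module_scheme \<Rightarrow> ('a, 'n, 't) module_scheme \<Rightarrow>
     'm \<Rightarrow> 'n \<Rightarrow> ('m \<times> 'n) list set"
  where "pure_tensor R M N m n = tensor_class R M N [(m, n)]"

definition sum_pairs ::
    "('p, 'u) ring_scheme \<Rightarrow> ('m \<Rightarrow> 'n \<Rightarrow> 'p) \<Rightarrow> ('m \<times> 'n) list \<Rightarrow> 'p"
  where "sum_pairs P \<beta> xs = foldr (\<lambda>(m, n) s. \<beta> m n \<oplus>\<^bsub>P\<^esub> s) xs \<zero>\<^bsub>P\<^esub>"

text \<open>
  For bilinear \<open>\<beta>\<close>, the linear map with \<open>m \<otimes> n \<mapsto> \<beta> m n\<close>. In Sweedler notation,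
  if \<open>D\<close> is the comultiplication then \<open>tensor_lift P \<beta> (D h)\<close> is the sum of the
  \<open>\<beta> h\<^sub>(\<^sub>1\<^sub>) h\<^sub>(\<^sub>2\<^sub>)\<close>.
\<close>

definition tensor_lift ::
    "('p, 'u) ring_scheme \<Rightarrow> ('m \<Rightarrow> 'n \<Rightarrow> 'p) \<Rightarrow> ('m \<times> 'n) list set \<Rightarrow> 'p"
  where "tensor_lift P \<beta> X = sum_pairs P \<beta> (tensor_rep X)"

definition tensor_map ::
    "('a, 'r) ring_scheme \<Rightarrow> ('a, 'p, 's) module_scheme \<Rightarrow> ('a, 'q, 't) module_scheme \<Rightarrow>
     ('m \<Rightarrow> 'p) \<Rightarrow> ('n \<Rightarrow> 'q) \<Rightarrow> ('m \<times> 'n) list set \<Rightarrow> ('p \<times> 'q) list set"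
  where "tensor_map R P Q f g =
    tensor_lift (tensor R P Q) (\<lambda>m n. pure_tensor R P Q (f m) (g n))"

definition tensor_assoc ::
    "('a, 'r) ring_scheme \<Rightarrow> ('a, 'm, 's) module_scheme \<Rightarrow> ('a, 'n, 't) module_scheme \<Rightarrow>
     ('a, 'p, 'u) module_scheme \<Rightarrow>
     (('m \<times> 'n) list set \<times> 'p) list set \<Rightarrow> ('m \<times> ('n \<times> 'p) list set) list set"
  where "tensor_assoc R M N P =
    tensor_lift (tensor R M (tensor R N P))
      (\<lambda>X p. tensor_lift (tensor R M (tensor R N P))
        (\<lambda>m n. pure_tensor R M (tensor R N P) m (pure_tensor R N P n p)) X)"


subsection \<open>Universal property\<close>

definition bilinear ::
    "('a, 'r) ring_scheme \<Rightarrow> ('a, 'm, 's) module_scheme \<Rightarrow> ('a, 'n, 't) module_scheme \<Rightarrow>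
     ('a, 'p, 'u) module_scheme \<Rightarrow> ('m \<Rightarrow> 'n \<Rightarrow> 'p) \<Rightarrow> bool"
  where "bilinear R M N P \<beta> \<longleftrightarrow>
    (\<forall>m\<in>carrier M. \<beta> m \<in> mod_hom R N P) \<and> (\<forall>n\<in>carrier N. (\<lambda>m. \<beta> m n) \<in> mod_hom R M P)"

locale module_pair = M: module R M + N: module R N
  for R :: "('a, 'r) ring_scheme" and M :: "('a, 'm, 's) module_scheme"
    and N :: "('a, 'n, 't) module_scheme"
begin

abbreviation "words \<equiv> formal_sums M N"

lemma words_simps [simp]:
  "[] \<in> words"
  "x # xs \<in> words \<longleftrightarrow> fst x \<in> carrier M \<and> snd x \<in> carrier N \<and> xs \<in> words"
  "xs @ ys \<in> words \<longleftrightarrow> xs \<in> words \<and> ys \<in> words"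
  by (auto simp: formal_sums_def mem_Times_iff)

lemma words_smult [simp]:
  "\<lbrakk>xs \<in> words; r \<in> carrier R\<rbrakk> \<Longrightarrow> map (\<lambda>(m, n). (r \<odot>\<^bsub>M\<^esub> m, n)) xs \<in> words"
  by (induction xs) auto

lemma words_map_cong:
  assumes "xs \<in> words" "\<And>m n. \<lbrakk>m \<in> carrier M; n \<in> carrier N\<rbrakk> \<Longrightarrow> f (m, n) = g (m, n)"
  shows "map f xs = map g xs"
  using assms(1) by (induction xs) (auto simp: assms(2))

lemma tensor_eq_words: "tensor_eq R M N xs ys \<Longrightarrow> xs \<in> words \<and> ys \<in> words"
  by (induction rule: tensor_eq.induct) auto

lemma tensor_class_eq_iff:
  "\<lbrakk>xs \<in> words; ys \<in> words\<rbrakk> \<Longrightarrow> tensor_class R M N xs = tensor_class R M N ys \<longleftrightarrow> tensor_eq R M N xs ys"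
  unfolding tensor_class_def by (blast intro: tensor_eq.refl tensor_eq.sym tensor_eq.trans)

lemma tensor_eq_rep: "xs \<in> words \<Longrightarrow> tensor_eq R M N xs (tensor_rep (tensor_class R M N xs))"
  unfolding tensor_rep_def tensor_class_def
  using someI[of "\<lambda>ys. ys \<in> {ys. tensor_eq R M N xs ys}" xs] by (simp add: tensor_eq.refl)

lemma tensor_carrier: "X \<in> carrier (tensor R M N) \<longleftrightarrow> (\<exists>xs\<in>words. X = tensor_class R M N xs)"
  by (auto simp: tensor_def)

lemma tensor_class_closed [simp]: "xs \<in> words \<Longrightarrow> tensor_class R M N xs \<in> carrier (tensor R M N)"
  by (auto simp: tensor_def)

lemma tensor_zero: "\<zero>\<^bsub>tensor R M N\<^esub> = tensor_class R M N []"
  by (simp add: tensor_def)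

lemma tensor_add:
  assumes "xs \<in> words" "ys \<in> words"
  shows "tensor_class R M N xs \<oplus>\<^bsub>tensor R M N\<^esub> tensor_class R M N ys = tensor_class R M N (xs @ ys)"
  using tensor_eq.append[OF tensor_eq_rep[OF assms(1)] tensor_eq_rep[OF assms(2)]]
  by (metis (no_types, lifting) module.simps(1) ring_record_simps(12) tensor_class_eq_iff tensor_def tensor_eq_words)

lemma tensor_eq_map_smult:
  assumes "tensor_eq R M N xs ys" "r \<in> carrier R"
  shows "tensor_eq R M N (map (\<lambda>(m, n). (r \<odot>\<^bsub>M\<^esub> m, n)) xs) (map (\<lambda>(m, n). (r \<odot>\<^bsub>M\<^esub> m, n)) ys)"
  using assms(1)
proof (induction rule: tensor_eq.induct)
  case (refl xs)
  then show ?case using assms(2) by (simp add: tensor_eq.refl)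
next
  case (comm xs ys)
  then show ?case using assms(2) by (simp add: tensor_eq.comm)
next
  case (balanced q m n)
  have "r \<odot>\<^bsub>M\<^esub> (q \<odot>\<^bsub>M\<^esub> m) = q \<odot>\<^bsub>M\<^esub> (r \<odot>\<^bsub>M\<^esub> m)"
    using balanced assms(2) by (metis M.R.m_comm M.smult_assoc1)
  then show ?case using balanced assms(2) by (simp add: tensor_eq.balanced)
qed (auto simp: assms(2) M.smult_r_distr intro: tensor_eq.intros)

lemma tensor_smult:
  assumes "xs \<in> words" "r \<in> carrier R"
  shows "r \<odot>\<^bsub>tensor R M N\<^esub> tensor_class R M N xs
    = tensor_class R M N (map (\<lambda>(m, n). (r \<odot>\<^bsub>M\<^esub> m, n)) xs)"
proof -
  have "tensor_eq R M N (map (\<lambda>(m, n). (r \<odot>\<^bsub>M\<^esub> m, n)) xs)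
      (map (\<lambda>(m, n). (r \<odot>\<^bsub>M\<^esub> m, n)) (tensor_rep (tensor_class R M N xs)))"
    using tensor_eq_map_smult[OF tensor_eq_rep[OF assms(1)] assms(2)] .
  then show ?thesis
    using tensor_class_eq_iff tensor_eq_words by (fastforce simp: tensor_def)
qed

lemma tensor_eq_smult_add:
  assumes "xs \<in> words" "r \<in> carrier R" "q \<in> carrier R"
  shows "tensor_eq R M N (map (\<lambda>(m, n). ((r \<oplus>\<^bsub>R\<^esub> q) \<odot>\<^bsub>M\<^esub> m, n)) xs)
     (map (\<lambda>(m, n). (r \<odot>\<^bsub>M\<^esub> m, n)) xs @ map (\<lambda>(m, n). (q \<odot>\<^bsub>M\<^esub> m, n)) xs)"
  using assms(1)
proof (induction xs)
  case Nil
  then show ?case by (simp add: tensor_eq.refl)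
next
  case (Cons x xs)
  obtain m n where x: "x = (m, n)" by fastforce
  have mn: "m \<in> carrier M" "n \<in> carrier N" and xs: "xs \<in> words" using Cons x by auto
  let ?f = "\<lambda>r. map (\<lambda>(m, n). (r \<odot>\<^bsub>M\<^esub> m, n)) xs"
  have w: "?f r \<in> words" "?f q \<in> words"
    using xs assms(2,3) by simp_all
  have 1: "tensor_eq R M N [((r \<oplus>\<^bsub>R\<^esub> q) \<odot>\<^bsub>M\<^esub> m, n)] ([(r \<odot>\<^bsub>M\<^esub> m, n)] @ [(q \<odot>\<^bsub>M\<^esub> m, n)])"
    using mn assms(2,3) by (simp add: M.smult_l_distr tensor_eq.add_left)
  have 2: "tensor_eq R M N ([((r \<oplus>\<^bsub>R\<^esub> q) \<odot>\<^bsub>M\<^esub> m, n)] @ ?f (r \<oplus>\<^bsub>R\<^esub> q))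
      (([(r \<odot>\<^bsub>M\<^esub> m, n)] @ [(q \<odot>\<^bsub>M\<^esub> m, n)]) @ (?f r @ ?f q))"
    by (rule tensor_eq.append[OF 1 Cons.IH[OF xs]])
  have 3: "tensor_eq R M N ([(q \<odot>\<^bsub>M\<^esub> m, n)] @ ?f r) (?f r @ [(q \<odot>\<^bsub>M\<^esub> m, n)])"
    using w mn assms(3) by (intro tensor_eq.comm) auto
  have "tensor_eq R M N ([(r \<odot>\<^bsub>M\<^esub> m, n)] @ (([(q \<odot>\<^bsub>M\<^esub> m, n)] @ ?f r) @ ?f q))
      ([(r \<odot>\<^bsub>M\<^esub> m, n)] @ ((?f r @ [(q \<odot>\<^bsub>M\<^esub> m, n)]) @ ?f q))"
    using w mn assms(2) by (intro tensor_eq.append[OF _ tensor_eq.append[OF 3]] tensor_eq.refl) auto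
  from tensor_eq.trans[OF 2[unfolded append_assoc] this[unfolded append_assoc]]
  show ?case by (simp add: x)
qed

lemma tensor_eq_smult_zero:
  "xs \<in> words \<Longrightarrow> tensor_eq R M N (map (\<lambda>(m, n). (\<zero>\<^bsub>R\<^esub> \<odot>\<^bsub>M\<^esub> m, n)) xs) []"
proof (induction xs)
  case Nil
  then show ?case by (simp add: tensor_eq.refl)
next
  case (Cons x xs)
  then have "tensor_eq R M N [(\<zero>\<^bsub>M\<^esub>, snd x)] []" by (auto intro: tensor_eq.zero)
  from tensor_eq.append[OF this] Cons show ?case by (auto split: prod.splits)
qed

lemma tensor_module: "module R (tensor R M N)"
proof -
  let ?T = "tensor R M N"
  have neg: "\<exists>Y\<in>carrier ?T. Y \<oplus>\<^bsub>?T\<^esub> X = \<zero>\<^bsub>?T\<^esub>" if X: "X \<in> carrier ?T" for X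
  proof -
    obtain xs where xs: "xs \<in> words" "X = tensor_class R M N xs"
      using X unfolding tensor_carrier by blast
    let ?g = "\<lambda>r. map (\<lambda>(m, n). (r \<odot>\<^bsub>M\<^esub> m, n)) xs"
    have id: "?g \<one>\<^bsub>R\<^esub> = xs" using words_map_cong[OF xs(1), of _ "\<lambda>x. x"] by simp
    have "tensor_eq R M N (?g (\<ominus>\<^bsub>R\<^esub> \<one>\<^bsub>R\<^esub> \<oplus>\<^bsub>R\<^esub> \<one>\<^bsub>R\<^esub>)) (?g (\<ominus>\<^bsub>R\<^esub> \<one>\<^bsub>R\<^esub>) @ ?g \<one>\<^bsub>R\<^esub>)"
      using xs by (intro tensor_eq_smult_add) auto
    then have "tensor_eq R M N (?g (\<ominus>\<^bsub>R\<^esub> \<one>\<^bsub>R\<^esub>) @ xs) []"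
      using tensor_eq_smult_zero[OF xs(1)] id M.R.l_neg[OF M.R.one_closed]
      by (metis tensor_eq.sym tensor_eq.trans)
    then have "tensor_class R M N (?g (\<ominus>\<^bsub>R\<^esub> \<one>\<^bsub>R\<^esub>)) \<oplus>\<^bsub>?T\<^esub> X = \<zero>\<^bsub>?T\<^esub>"
      using xs by (simp add: tensor_add tensor_zero tensor_class_eq_iff)
    then show ?thesis
      by (rule bexI) (simp add: xs(1))
  qed
  have ag: "abelian_group ?T"
  proof (rule abelian_groupI)
    show "X \<oplus>\<^bsub>?T\<^esub> Y = Y \<oplus>\<^bsub>?T\<^esub> X" if XY: "X \<in> carrier ?T" "Y \<in> carrier ?T" for X Y
    proof -
      obtain xs ys where w: "xs \<in> words" "X = tensor_class R M N xs"
        "ys \<in> words" "Y = tensor_class R M N ys" using XY unfolding tensor_carrier by blast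
      then have "tensor_eq R M N (xs @ ys) (ys @ xs)" by (simp add: tensor_eq.comm)
      then show ?thesis using w by (simp add: tensor_add tensor_class_eq_iff)
    qed
  next
    show "\<exists>Y\<in>carrier ?T. Y \<oplus>\<^bsub>?T\<^esub> X = \<zero>\<^bsub>?T\<^esub>" if "X \<in> carrier ?T" for X
      using that by (rule neg)
  qed (auto simp: tensor_carrier tensor_add tensor_zero)
  show ?thesis
  proof (rule moduleI[OF M.R.is_cring ag])
    fix a X assume "a \<in> carrier R" "X \<in> carrier ?T"
    then show "a \<odot>\<^bsub>?T\<^esub> X \<in> carrier ?T"
      by (auto simp: tensor_carrier tensor_smult)
  next
    fix a b X assume ab: "a \<in> carrier R" "b \<in> carrier R" and "X \<in> carrier ?T"
    then obtain xs where xs: "xs \<in> words" "X = tensor_class R M N xs" unfolding tensor_carrier by blast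
    show "(a \<oplus>\<^bsub>R\<^esub> b) \<odot>\<^bsub>?T\<^esub> X = a \<odot>\<^bsub>?T\<^esub> X \<oplus>\<^bsub>?T\<^esub> b \<odot>\<^bsub>?T\<^esub> X"
      using tensor_eq_smult_add[OF xs(1) ab] xs ab
      by (simp add: tensor_smult tensor_add tensor_class_eq_iff)
    have "map (\<lambda>(m, n). ((a \<otimes>\<^bsub>R\<^esub> b) \<odot>\<^bsub>M\<^esub> m, n)) xs
        = map (\<lambda>(m, n). (a \<odot>\<^bsub>M\<^esub> m, n)) (map (\<lambda>(m, n). (b \<odot>\<^bsub>M\<^esub> m, n)) xs)"
      unfolding map_map by (rule words_map_cong[OF xs(1)]) (simp add: ab M.smult_assoc1)
    then show "(a \<otimes>\<^bsub>R\<^esub> b) \<odot>\<^bsub>?T\<^esub> X = a \<odot>\<^bsub>?T\<^esub> (b \<odot>\<^bsub>?T\<^esub> X)"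
      using xs ab by (simp add: tensor_smult del: map_map map_eq_conv)
  next
    fix a X Y assume a: "a \<in> carrier R" and "X \<in> carrier ?T" "Y \<in> carrier ?T"
    then obtain xs ys where w: "xs \<in> words" "X = tensor_class R M N xs"
        "ys \<in> words" "Y = tensor_class R M N ys" unfolding tensor_carrier by blast
    show "a \<odot>\<^bsub>?T\<^esub> (X \<oplus>\<^bsub>?T\<^esub> Y) = a \<odot>\<^bsub>?T\<^esub> X \<oplus>\<^bsub>?T\<^esub> a \<odot>\<^bsub>?T\<^esub> Y"
      using w a by (simp add: tensor_add tensor_smult)
  next
    fix X assume "X \<in> carrier ?T"
    then obtain xs where xs: "xs \<in> words" "X = tensor_class R M N xs" unfolding tensor_carrier by blast
    have "map (\<lambda>(m, n). (\<one>\<^bsub>R\<^esub> \<odot>\<^bsub>M\<^esub> m, n)) xs = xs"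
      using words_map_cong[OF xs(1), of _ "\<lambda>x. x"] by simp
    then show "\<one>\<^bsub>R\<^esub> \<odot>\<^bsub>?T\<^esub> X = X" using xs by (simp add: tensor_smult)
  qed
qed

lemma pure_tensor_bilinear: "bilinear R M N (tensor R M N) (pure_tensor R M N)"
proof -
  have "tensor_eq R M N [(m, r \<odot>\<^bsub>N\<^esub> n)] [(r \<odot>\<^bsub>M\<^esub> m, n)]"
    if "r \<in> carrier R" "m \<in> carrier M" "n \<in> carrier N" for r m n
    using that by (simp add: tensor_eq.balanced tensor_eq.sym)
  then show ?thesis
    by (auto simp: bilinear_def mod_hom_def pure_tensor_def tensor_add tensor_smult
        tensor_class_eq_iff tensor_eq.add_left tensor_eq.add_right)
qed

end

locale module_bilinear = module_pair R M N + P: module R P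
  for R :: "('a, 'r) ring_scheme" and M :: "('a, 'm, 's) module_scheme"
    and N :: "('a, 'n, 't) module_scheme" and P :: "('a, 'p, 'u) module_scheme" +
  fixes \<beta>
  assumes bilinear: "bilinear R M N P \<beta>"
begin

lemma bilinear_simps [simp]:
  "\<lbrakk>m \<in> carrier M; n \<in> carrier N\<rbrakk> \<Longrightarrow> \<beta> m n \<in> carrier P"
  "\<lbrakk>m \<in> carrier M; m' \<in> carrier M; n \<in> carrier N\<rbrakk> \<Longrightarrow> \<beta> (m \<oplus>\<^bsub>M\<^esub> m') n = \<beta> m n \<oplus>\<^bsub>P\<^esub> \<beta> m' n"
  "\<lbrakk>m \<in> carrier M; n \<in> carrier N; n' \<in> carrier N\<rbrakk> \<Longrightarrow> \<beta> m (n \<oplus>\<^bsub>N\<^esub> n') = \<beta> m n \<oplus>\<^bsub>P\<^esub> \<beta> m n'"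
  "\<lbrakk>r \<in> carrier R; m \<in> carrier M; n \<in> carrier N\<rbrakk> \<Longrightarrow> \<beta> (r \<odot>\<^bsub>M\<^esub> m) n = r \<odot>\<^bsub>P\<^esub> \<beta> m n"
  "\<lbrakk>r \<in> carrier R; m \<in> carrier M; n \<in> carrier N\<rbrakk> \<Longrightarrow> \<beta> m (r \<odot>\<^bsub>N\<^esub> n) = r \<odot>\<^bsub>P\<^esub> \<beta> m n"
  using bilinear by (auto simp: bilinear_def mod_hom_def)

lemma bilinear_zero [simp]: "n \<in> carrier N \<Longrightarrow> \<beta> \<zero>\<^bsub>M\<^esub> n = \<zero>\<^bsub>P\<^esub>"
  using bilinear_simps(4)[of "\<zero>\<^bsub>R\<^esub>" "\<zero>\<^bsub>M\<^esub>" n] by simp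

lemma sum_pairs_closed [simp]: "xs \<in> words \<Longrightarrow> sum_pairs P \<beta> xs \<in> carrier P"
  by (induction xs) (auto simp: sum_pairs_def)

lemma sum_pairs_append:
  "\<lbrakk>xs \<in> words; ys \<in> words\<rbrakk> \<Longrightarrow> sum_pairs P \<beta> (xs @ ys) = sum_pairs P \<beta> xs \<oplus>\<^bsub>P\<^esub> sum_pairs P \<beta> ys"
proof (induction xs)
  case Nil
  then show ?case using sum_pairs_closed[of ys] by (simp add: sum_pairs_def)
next
  case (Cons x xs)
  then show ?case using sum_pairs_closed[of xs] sum_pairs_closed[of ys]
    by (auto simp: sum_pairs_def P.M.a_assoc case_prod_beta)
qed

lemma sum_pairs_cong: "tensor_eq R M N xs ys \<Longrightarrow> sum_pairs P \<beta> xs = sum_pairs P \<beta> ys"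
proof (induction rule: tensor_eq.induct)
  case (append xs xs' ys ys')
  then show ?case using tensor_eq_words by (metis sum_pairs_append)
next
  case (comm xs ys)
  then show ?case by (simp add: sum_pairs_append P.M.a_comm)
qed (auto simp: sum_pairs_def P.M.a_assoc)

lemma tensor_lift_class:
  "xs \<in> words \<Longrightarrow> tensor_lift P \<beta> (tensor_class R M N xs) = sum_pairs P \<beta> xs"
  unfolding tensor_lift_def by (metis sum_pairs_cong tensor_eq_rep)

lemma tensor_lift_pure:
  "\<lbrakk>m \<in> carrier M; n \<in> carrier N\<rbrakk> \<Longrightarrow> tensor_lift P \<beta> (pure_tensor R M N m n) = \<beta> m n"
  unfolding pure_tensor_def by (simp add: tensor_lift_class) (simp add: sum_pairs_def)

lemma sum_pairs_smult:
  "\<lbrakk>xs \<in> words; r \<in> carrier R\<rbrakk>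
    \<Longrightarrow> sum_pairs P \<beta> (map (\<lambda>(m, n). (r \<odot>\<^bsub>M\<^esub> m, n)) xs) = r \<odot>\<^bsub>P\<^esub> sum_pairs P \<beta> xs"
proof (induction xs)
  case Nil
  then show ?case by (simp add: sum_pairs_def)
next
  case (Cons x xs)
  then show ?case using sum_pairs_closed[of xs] by (auto simp: sum_pairs_def P.smult_r_distr case_prod_beta)
qed

lemma tensor_lift_mod_hom: "tensor_lift P \<beta> \<in> mod_hom R (tensor R M N) P"
proof -
  show ?thesis
    by (auto simp: mod_hom_def tensor_carrier tensor_add tensor_smult tensor_lift_class
        sum_pairs_append sum_pairs_smult)
qed

lemma tensor_lift_unique:
  assumes f: "f \<in> mod_hom R (tensor R M N) P"
    and pure: "\<And>m n. \<lbrakk>m \<in> carrier M; n \<in> carrier N\<rbrakk> \<Longrightarrow> f (pure_tensor R M N m n) = \<beta> m n"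
    and X: "X \<in> carrier (tensor R M N)"
  shows "f X = tensor_lift P \<beta> X"
proof -
  interpret T: module R "tensor R M N" by (rule tensor_module)
  have f_add: "f (X \<oplus>\<^bsub>tensor R M N\<^esub> Y) = f X \<oplus>\<^bsub>P\<^esub> f Y"
    if "X \<in> carrier (tensor R M N)" "Y \<in> carrier (tensor R M N)" for X Y
    using f that by (auto simp: mod_hom_def)
  have f_zero: "f \<zero>\<^bsub>tensor R M N\<^esub> = \<zero>\<^bsub>P\<^esub>"
  proof -
    have "f (\<zero>\<^bsub>R\<^esub> \<odot>\<^bsub>tensor R M N\<^esub> \<zero>\<^bsub>tensor R M N\<^esub>) = \<zero>\<^bsub>R\<^esub> \<odot>\<^bsub>P\<^esub> f \<zero>\<^bsub>tensor R M N\<^esub>"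
      and "f \<zero>\<^bsub>tensor R M N\<^esub> \<in> carrier P"
      using f T.M.zero_closed M.R.zero_closed unfolding mod_hom_def by blast+
    then show ?thesis by simp
  qed
  have "f (tensor_class R M N xs) = sum_pairs P \<beta> xs" if "xs \<in> words" for xs
    using that
  proof (induction xs)
    case Nil
    then show ?case using f_zero by (simp add: tensor_zero sum_pairs_def)
  next
    case (Cons x xs)
    obtain m n where x: "x = (m, n)" by fastforce
    have mn: "m \<in> carrier M" "n \<in> carrier N" and xs: "xs \<in> words" using Cons x by auto
    have "tensor_class R M N (x # xs) =
        pure_tensor R M N m n \<oplus>\<^bsub>tensor R M N\<^esub> tensor_class R M N xs"
      using mn xs by (simp add: pure_tensor_def tensor_add x)
    then have "f (tensor_class R M N (x # xs)) = \<beta> m n \<oplus>\<^bsub>P\<^esub> f (tensor_class R M N xs)"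
      using mn xs pure[OF mn] f_add[of "pure_tensor R M N m n" "tensor_class R M N xs"]
      by (simp add: pure_tensor_def)
    then show ?case using Cons.IH[OF xs] by (simp add: x sum_pairs_def)
  qed
  then show ?thesis using X tensor_carrier tensor_lift_class by auto
qed

end


section \<open>Hopf algebras\<close>

record ('a, 'h) hopf = "('a, 'h) module" +
  comult :: "'h \<Rightarrow> ('h \<times> 'h) list set"
  counit :: "'h \<Rightarrow> 'a"
  antipode :: "'h \<Rightarrow> 'h"

locale hopf_algebra = module R H + H: ring H for R (structure) and H (structure) +
  assumes smult_mult_left:
      "\<lbrakk>r \<in> carrier R; x \<in> carrier H; y \<in> carrier H\<rbrakk> \<Longrightarrow> (r \<odot>\<^bsub>H\<^esub> x) \<otimes>\<^bsub>H\<^esub> y = r \<odot>\<^bsub>H\<^esub> (x \<otimes>\<^bsub>H\<^esub> y)"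
    and smult_mult_right:
      "\<lbrakk>r \<in> carrier R; x \<in> carrier H; y \<in> carrier H\<rbrakk> \<Longrightarrow> x \<otimes>\<^bsub>H\<^esub> (r \<odot>\<^bsub>H\<^esub> y) = r \<odot>\<^bsub>H\<^esub> (x \<otimes>\<^bsub>H\<^esub> y)"
    and comult_linear: "comult H \<in> mod_hom R H (tensor R H H)"
    and counit_linear: "counit H \<in> mod_hom R H (regular_module R)"
    and coassoc: "h \<in> carrier H \<Longrightarrow>
      tensor_assoc R H H H (tensor_map R (tensor R H H) H (comult H) id (comult H h))
      = tensor_map R H (tensor R H H) id (comult H) (comult H h)"
    and counit_left: "h \<in> carrier H \<Longrightarrow> tensor_lift H (\<lambda>a b. counit H a \<odot>\<^bsub>H\<^esub> b) (comult H h) = h"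
    and counit_right: "h \<in> carrier H \<Longrightarrow> tensor_lift H (\<lambda>a b. counit H b \<odot>\<^bsub>H\<^esub> a) (comult H h) = h"
    and comult_ring_hom: "comult H \<in> ring_hom H (tensor R H H)"
    and counit_ring_hom: "counit H \<in> ring_hom H R"
    and antipode_linear: "antipode H \<in> mod_hom R H H"
    and antipode_left: "h \<in> carrier H \<Longrightarrow>
      tensor_lift H (\<lambda>a b. antipode H a \<otimes>\<^bsub>H\<^esub> b) (comult H h) = counit H h \<odot>\<^bsub>H\<^esub> \<one>\<^bsub>H\<^esub>"
    and antipode_right: "h \<in> carrier H \<Longrightarrow>
      tensor_lift H (\<lambda>a b. a \<otimes>\<^bsub>H\<^esub> antipode H b) (comult H h) = counit H h \<odot>\<^bsub>H\<^esub> \<one>\<^bsub>H\<^esub>"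

definition convolution ::
    "('a, 'r) ring_scheme \<Rightarrow> ('a, 'h, 's) hopf_scheme \<Rightarrow> ('h \<Rightarrow> 'a) \<Rightarrow> ('h \<Rightarrow> 'a) \<Rightarrow> 'h \<Rightarrow> 'a"
  where "convolution R H f g =
    (\<lambda>h\<in>carrier H. tensor_lift R (\<lambda>a b. f a \<otimes>\<^bsub>R\<^esub> g b) (comult H h))"


section \<open>Integrals\<close>

text \<open>
  The spaces of integrals are given as modules, with the structure restricted from \<open>H\<close> and
  from its dual, respectively.
\<close>

definition left_integrals :: "('a, 'h, 's) hopf_scheme \<Rightarrow> ('a, 'h, 's) hopf_scheme"
  where "left_integrals H =
    H\<lparr>carrier := {t \<in> carrier H. \<forall>h\<in>carrier H. h \<otimes>\<^bsub>H\<^esub> t = counit H h \<odot>\<^bsub>H\<^esub> t}\<rparr>"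

definition right_integrals :: "('a, 'h, 's) hopf_scheme \<Rightarrow> ('a, 'h, 's) hopf_scheme"
  where "right_integrals H =
    H\<lparr>carrier := {t \<in> carrier H. \<forall>h\<in>carrier H. t \<otimes>\<^bsub>H\<^esub> h = counit H h \<odot>\<^bsub>H\<^esub> t}\<rparr>"

definition left_dual_integrals ::
    "('a, 'r) ring_scheme \<Rightarrow> ('a, 'h, 's) hopf_scheme \<Rightarrow> ('a, 'h \<Rightarrow> 'a) module"
  where "left_dual_integrals R H = (dual R H)\<lparr>carrier :=
    {\<phi> \<in> carrier (dual R H). \<forall>f\<in>carrier (dual R H).
      convolution R H f \<phi> = f \<one>\<^bsub>H\<^esub> \<odot>\<^bsub>dual R H\<^esub> \<phi>}\<rparr>"

definition right_dual_integrals ::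
    "('a, 'r) ring_scheme \<Rightarrow> ('a, 'h, 's) hopf_scheme \<Rightarrow> ('a, 'h \<Rightarrow> 'a) module"
  where "right_dual_integrals R H = (dual R H)\<lparr>carrier :=
    {\<phi> \<in> carrier (dual R H). \<forall>f\<in>carrier (dual R H).
      convolution R H \<phi> f = f \<one>\<^bsub>H\<^esub> \<odot>\<^bsub>dual R H\<^esub> \<phi>}\<rparr>"

end

theory Submission
  imports Defs
begin

text \<open>
  Choose a finite dual basis $e_i$, $e^i$ of $H$ and put
  $T(x) = \sum_i e^i(S(a_1))\, a_2$ with $a = x S(e_i)$. Cyclicity of the trace shows that the values
  of $T$ are right integrals in $H$; dually, $x_1 \otimes T(x_2) = 1 \otimes T(x)$, so $f \circ T$ is a
  left integral in $H^*$ for every $f \in H^*$. Moreover $T$ fixes right integrals and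
  $\varphi \circ T = \varphi$ for left integrals $\varphi$ in $H^*$. Hence restriction
  $\int_{H^*}^l \to (\int_H^r)^*$ is bijective with inverse $g \mapsto g \circ T$.

  To switch sides it remains to see that $S$ is bijective. For a left integral $\varphi$ in $H^*$ and
  a right integral $t$ in $H$ one has $\varphi(t_2 S(h))\, t_1 = \varphi(t)\, h$ and
  $\varphi(t_2 y)\, S(t_1) = \varphi(t)\, y$. The values $\varphi(t)$ generate the unit ideal, because
  the trace of $T \circ S$ is $1$; so the first identity gives injectivity and the second surjectivity.
\<close>

section \<open>Linear algebra over a commutative ring\<close>

text \<open>\<open>T\<close> is the transpose of the Larson-Sweedler projection. The dual H^* is a
  Hopf module with action (\<phi>.h)(x) = \<phi>(x S(h)) and coaction dual to left convolution; its
  coinvariants are the left integrals, and \<phi> \<mapsto> \<phi>_0.S(\<phi>_1) projects onto them.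
  Written in a dual basis, with one antipode moved by cyclicity, the value of this projection at x
  is \<phi>(T(x)). Working with \<open>T\<close> on H itself gives access to integrals of H and of
  H^* at once.

  The obstacle is that k is only a ring: modules of integrals need not be free, dimensions cannot be
  counted, and a single pair with \<phi>(t) = 1 need not exist. A trace supplies instead a finite
  family with \<Sum> \<phi>_i(t_i) = 1, and each argument about one pair is summed over that family.
  Bijectivity of S has to be proved along the way, since \<open>T\<close> matches left integrals of
  H^* only with right integrals of H.\<close>

named_theorems lin

lemma mod_homI:
  assumes "\<And>x. x \<in> carrier M \<Longrightarrow> f x \<in> carrier N"
    and "\<And>x y. \<lbrakk>x \<in> carrier M; y \<in> carrier M\<rbrakk> \<Longrightarrow> f (x \<oplus>\<^bsub>M\<^esub> y) = f x \<oplus>\<^bsub>N\<^esub> f y"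
    and "\<And>r x. \<lbrakk>r \<in> carrier R; x \<in> carrier M\<rbrakk> \<Longrightarrow> f (r \<odot>\<^bsub>M\<^esub> x) = r \<odot>\<^bsub>N\<^esub> f x"
  shows "f \<in> mod_hom R M N"
  using assms by (auto simp: mod_hom_def)

lemma mod_homD:
  assumes "f \<in> mod_hom R M N"
  shows "x \<in> carrier M \<Longrightarrow> f x \<in> carrier N"
    and "\<lbrakk>x \<in> carrier M; y \<in> carrier M\<rbrakk> \<Longrightarrow> f (x \<oplus>\<^bsub>M\<^esub> y) = f x \<oplus>\<^bsub>N\<^esub> f y"
    and "\<lbrakk>r \<in> carrier R; x \<in> carrier M\<rbrakk> \<Longrightarrow> f (r \<odot>\<^bsub>M\<^esub> x) = r \<odot>\<^bsub>N\<^esub> f x"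
  using assms by (auto simp: mod_hom_def)

lemma mod_hom_id [lin]: "(\<lambda>x. x) \<in> mod_hom R M M"
  by (auto simp: mod_hom_def)

lemma mod_hom_compose:
  "\<lbrakk>g \<in> mod_hom R N P; f \<in> mod_hom R M N\<rbrakk> \<Longrightarrow> (\<lambda>x. g (f x)) \<in> mod_hom R M P"
  by (auto simp: mod_hom_def Pi_iff)

lemma mod_hom_zero:
  assumes "module R M" "module R N" and f: "f \<in> mod_hom R M N"
  shows "f \<zero>\<^bsub>M\<^esub> = \<zero>\<^bsub>N\<^esub>"
proof -
  interpret M: module R M by fact
  interpret N: module R N by fact
  show ?thesis
    using mod_homD(1)[OF f M.M.zero_closed] mod_homD(3)[OF f M.R.zero_closed M.M.zero_closed] by simp
qed

lemma mod_hom_finsum: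
  assumes "module R M" "module R N" and f: "f \<in> mod_hom R M N"
    and "finite I" "g \<in> I \<rightarrow> carrier M"
  shows "f (\<Oplus>\<^bsub>M\<^esub>i\<in>I. g i) = (\<Oplus>\<^bsub>N\<^esub>i\<in>I. f (g i))"
proof -
  interpret M: module R M by fact
  interpret N: module R N by fact
  show ?thesis
    using assms(4,5)
  proof (induction I rule: finite_induct)
    case empty
    show ?case by (simp add: mod_hom_zero[OF assms(1,2) f])
  next
    case (insert i I)
    then have "g i \<in> carrier M" "g \<in> I \<rightarrow> carrier M" "(\<Oplus>\<^bsub>M\<^esub>i\<in>I. g i) \<in> carrier M"
      by (auto intro: M.M.finsum_closed)
    then show ?case
      using insert mod_homD[OF f]
      by (subst M.M.finsum_insert, simp_all, subst N.M.finsum_insert, auto simp: Pi_def)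
  qed
qed

section \<open>Regular and dual modules\<close>

lemma regular_module_simps [simp]:
  "carrier (regular_module R) = carrier R"
  "add (regular_module R) = add R"
  "zero (regular_module R) = zero R"
  "smult (regular_module R) = mult R"
  by (simp_all add: regular_module_def)

lemma module_regular_module:
  assumes "cring R"
  shows "module R (regular_module R)"
proof -
  interpret cring R by fact
  have "abelian_group (regular_module R)"
    by (rule abelian_groupI) (auto simp: a_ac intro: l_neg)
  then show ?thesis
    by (intro moduleI assms) (auto simp: l_distr r_distr m_assoc)
qed

context module
begin

lemma module_axiom [simp]: "module R M" ..

lemma module_regular [simp]: "module R (regular_module R)"
  by (rule module_regular_module) (rule R.is_cring)

lemma dual_simps:
  "\<zero>\<^bsub>dual R M\<^esub> = (\<lambda>x\<in>carrier M. \<zero>)"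
  "f \<oplus>\<^bsub>dual R M\<^esub> g = (\<lambda>x\<in>carrier M. f x \<oplus> g x)"
  "r \<odot>\<^bsub>dual R M\<^esub> f = (\<lambda>x\<in>carrier M. r \<otimes> f x)"
  by (simp_all add: dual_def)

lemma dual_carrier:
  "f \<in> carrier (dual R M) \<longleftrightarrow> f \<in> mod_hom R M (regular_module R) \<and> f \<in> extensional (carrier M)"
  by (simp add: dual_def)

lemma dual_restrict:
  "f \<in> mod_hom R M (regular_module R) \<Longrightarrow> (\<lambda>x\<in>carrier M. f x) \<in> carrier (dual R M)"
  by (auto simp: dual_carrier mod_hom_def)

lemma dual_eqI:
  "\<lbrakk>f \<in> carrier (dual R M); g \<in> carrier (dual R M); \<And>x. x \<in> carrier M \<Longrightarrow> f x = g x\<rbrakk> \<Longrightarrow> f = g"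
  by (auto simp: dual_carrier intro: extensionalityI)

lemma dual_mod_hom: "f \<in> carrier (dual R M) \<Longrightarrow> f \<in> mod_hom R M (regular_module R)"
  by (simp add: dual_carrier)

lemma dual_closed [simp]: "\<lbrakk>f \<in> carrier (dual R M); x \<in> carrier M\<rbrakk> \<Longrightarrow> f x \<in> carrier R"
  using mod_homD(1)[OF dual_mod_hom] by simp

lemma mod_hom_add:
  assumes "f \<in> mod_hom R N M" "g \<in> mod_hom R N M"
  shows "(\<lambda>x. f x \<oplus>\<^bsub>M\<^esub> g x) \<in> mod_hom R N M"
  using mod_homD[OF assms(1)] mod_homD[OF assms(2)]
  by (intro mod_homI) (simp_all add: M.a_ac smult_r_distr)

lemma mod_hom_smult [lin]:
  assumes "r \<in> carrier R" "f \<in> mod_hom R N M"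
  shows "(\<lambda>x. r \<odot>\<^bsub>M\<^esub> f x) \<in> mod_hom R N M"
proof (rule mod_homI)
  fix s x assume *: "s \<in> carrier R" "x \<in> carrier N"
  have "r \<odot>\<^bsub>M\<^esub> (s \<odot>\<^bsub>M\<^esub> f x) = s \<odot>\<^bsub>M\<^esub> (r \<odot>\<^bsub>M\<^esub> f x)"
    using * assms(1) mod_homD(1)[OF assms(2)] by (metis R.m_comm smult_assoc1)
  then show "r \<odot>\<^bsub>M\<^esub> f (s \<odot>\<^bsub>N\<^esub> x) = s \<odot>\<^bsub>M\<^esub> (r \<odot>\<^bsub>M\<^esub> f x)"
    using * mod_homD(3)[OF assms(2)] by simp
qed (use assms mod_homD[OF assms(2)] in \<open>auto simp: smult_r_distr\<close>)

lemma mod_hom_smult_left [lin]: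
  assumes "f \<in> mod_hom R N (regular_module R)" "p \<in> carrier M"
  shows "(\<lambda>x. f x \<odot>\<^bsub>M\<^esub> p) \<in> mod_hom R N M"
  using mod_homD[OF assms(1)] assms(2) by (intro mod_homI) (simp_all add: smult_l_distr smult_assoc1)

lemma module_dual [simp]: "module R (dual R M)"
proof -
  have z: "(\<lambda>x\<in>carrier M. \<zero>) \<in> carrier (dual R M)"
    by (rule dual_restrict) (auto simp: mod_hom_def)
  have a: "(\<lambda>x\<in>carrier M. f x \<oplus> g x) \<in> carrier (dual R M)"
    if "f \<in> carrier (dual R M)" "g \<in> carrier (dual R M)" for f g
    using module.mod_hom_add[OF module_regular dual_mod_hom[OF that(1)] dual_mod_hom[OF that(2)]]
    by (intro dual_restrict) simp
  have s: "(\<lambda>x\<in>carrier M. r \<otimes> f x) \<in> carrier (dual R M)"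
    if "r \<in> carrier R" "f \<in> carrier (dual R M)" for r f
    using module.mod_hom_smult[OF module_regular that(1) dual_mod_hom[OF that(2)]]
    by (intro dual_restrict) simp
  have ext: "restrict h (carrier M) = f" if "f \<in> carrier (dual R M)" "\<And>x. x \<in> carrier M \<Longrightarrow> h x = f x" for f h
    using that by (auto simp: dual_carrier restrict_def extensional_def)
  have "abelian_group (dual R M)"
  proof (rule abelian_groupI)
    fix f assume f: "f \<in> carrier (dual R M)"
    show "\<exists>g\<in>carrier (dual R M). g \<oplus>\<^bsub>dual R M\<^esub> f = \<zero>\<^bsub>dual R M\<^esub>"
    proof (rule bexI)
      \<comment> \<open>The negative is taken as scaling by -1, so that closure is an instance of
        \<open>s\<close>.\<close>
      show "(\<lambda>x\<in>carrier M. \<ominus> \<one> \<otimes> f x) \<in> carrier (dual R M)" using f by (intro s) auto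
      show "(\<lambda>x\<in>carrier M. \<ominus> \<one> \<otimes> f x) \<oplus>\<^bsub>dual R M\<^esub> f = \<zero>\<^bsub>dual R M\<^esub>"
        using f by (auto simp: dual_simps R.l_minus R.l_neg intro!: restrict_ext)
    qed
  qed (auto simp: dual_simps z a R.a_ac intro!: restrict_ext ext)
  then show ?thesis
    by (intro moduleI R.is_cring)
      (auto simp: dual_simps s R.l_distr R.r_distr R.m_assoc intro!: restrict_ext ext)
qed

lemma mod_hom_eval [lin]: "x \<in> carrier M \<Longrightarrow> (\<lambda>f. f x) \<in> mod_hom R (dual R M) (regular_module R)"
  by (intro mod_homI) (auto simp: dual_simps)

end

lemma bilinearI [lin]:
  assumes "\<And>m. m \<in> carrier M \<Longrightarrow> \<beta> m \<in> mod_hom R N P"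
    and "\<And>n. n \<in> carrier N \<Longrightarrow> (\<lambda>m. \<beta> m n) \<in> mod_hom R M P"
  shows "bilinear R M N P \<beta>"
  using assms by (simp add: bilinear_def)

lemma bilinearD:
  assumes "bilinear R M N P \<beta>"
  shows "m \<in> carrier M \<Longrightarrow> \<beta> m \<in> mod_hom R N P"
    and "n \<in> carrier N \<Longrightarrow> (\<lambda>m. \<beta> m n) \<in> mod_hom R M P"
    and "\<lbrakk>m \<in> carrier M; n \<in> carrier N\<rbrakk> \<Longrightarrow> \<beta> m n \<in> carrier P"
  using assms by (auto simp: bilinear_def mod_hom_def)

lemma bilinear_compose:
  assumes "bilinear R M N P \<beta>"
  shows "\<lbrakk>f \<in> mod_hom R L M; n \<in> carrier N\<rbrakk> \<Longrightarrow> (\<lambda>x. \<beta> (f x) n) \<in> mod_hom R L P"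
    and "\<lbrakk>m \<in> carrier M; g \<in> mod_hom R L N\<rbrakk> \<Longrightarrow> (\<lambda>x. \<beta> m (g x)) \<in> mod_hom R L P"
  using bilinearD[OF assms] mod_hom_compose[of "\<lambda>m. \<beta> m n" R M P f L] mod_hom_compose[of "\<beta> m" R N P g L]
  by auto

lemma sum_pairs_simps [simp]:
  "sum_pairs P \<beta> [] = \<zero>\<^bsub>P\<^esub>"
  "sum_pairs P \<beta> ((a, b) # xs) = \<beta> a b \<oplus>\<^bsub>P\<^esub> sum_pairs P \<beta> xs"
  by (simp_all add: sum_pairs_def)

context module
begin

lemma sum_pairs_closed:
  assumes "xs \<in> lists (A \<times> B)" "\<And>a b. \<lbrakk>a \<in> A; b \<in> B\<rbrakk> \<Longrightarrow> \<beta> a b \<in> carrier M"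
  shows "sum_pairs M \<beta> xs \<in> carrier M"
  using assms by (induction xs) auto

lemma sum_pairs_add:
  assumes "xs \<in> lists (A \<times> B)"
    and "\<And>a b. \<lbrakk>a \<in> A; b \<in> B\<rbrakk> \<Longrightarrow> \<beta> a b \<in> carrier M"
    and "\<And>a b. \<lbrakk>a \<in> A; b \<in> B\<rbrakk> \<Longrightarrow> \<gamma> a b \<in> carrier M"
  shows "sum_pairs M (\<lambda>a b. \<beta> a b \<oplus>\<^bsub>M\<^esub> \<gamma> a b) xs = sum_pairs M \<beta> xs \<oplus>\<^bsub>M\<^esub> sum_pairs M \<gamma> xs"
  using assms(1)
proof (induction xs rule: list.induct)
  case (Cons x xs)
  obtain a b where x: "x = (a, b)" by fastforce
  have "a \<in> A" "b \<in> B" and xs: "xs \<in> lists (A \<times> B)" using Cons x by auto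
  then show ?case
    using Cons.IH[OF xs] assms(2,3) sum_pairs_closed[OF xs assms(2)] sum_pairs_closed[OF xs assms(3)]
    by (simp add: x M.a_ac)
qed simp

lemma sum_pairs_append:
  assumes "xs \<in> lists (A \<times> B)" "ys \<in> lists (A \<times> B)"
    "\<And>a b. \<lbrakk>a \<in> A; b \<in> B\<rbrakk> \<Longrightarrow> \<beta> a b \<in> carrier M"
  shows "sum_pairs M \<beta> (xs @ ys) = sum_pairs M \<beta> xs \<oplus>\<^bsub>M\<^esub> sum_pairs M \<beta> ys"
  using assms(1)
proof (induction xs rule: list.induct)
  case Nil
  then show ?case using sum_pairs_closed[OF assms(2,3)] by simp
next
  case (Cons x xs)
  obtain a b where x: "x = (a, b)" by fastforce
  have "a \<in> A" "b \<in> B" and xs: "xs \<in> lists (A \<times> B)" using Cons x by auto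
  then show ?case
    using Cons.IH[OF xs] sum_pairs_closed[OF xs assms(3)] sum_pairs_closed[OF assms(2,3)] assms(3)
    by (simp add: x M.a_assoc)
qed

lemma sum_pairs_hom:
  assumes "module R N" and g: "g \<in> mod_hom R M N"
    and "xs \<in> lists (A \<times> B)" "\<And>a b. \<lbrakk>a \<in> A; b \<in> B\<rbrakk> \<Longrightarrow> \<beta> a b \<in> carrier M"
  shows "g (sum_pairs M \<beta> xs) = sum_pairs N (\<lambda>a b. g (\<beta> a b)) xs"
  using assms(3)
proof (induction xs rule: list.induct)
  case Nil
  then show ?case using mod_hom_zero[OF module_axiom assms(1) g] by simp
next
  case (Cons x xs)
  obtain a b where x: "x = (a, b)" by fastforce
  have "a \<in> A" "b \<in> B" and xs: "xs \<in> lists (A \<times> B)" using Cons x by auto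
  then show ?case
    using Cons.IH[OF xs] sum_pairs_closed[OF xs assms(4)] assms(4) mod_homD(2)[OF g]
    by (simp add: x)
qed

lemma sum_pairs_commute:
  assumes "xs \<in> lists (A \<times> B)" "ys \<in> lists (C \<times> D)"
    and \<delta>: "\<And>a b c d. \<lbrakk>a \<in> A; b \<in> B; c \<in> C; d \<in> D\<rbrakk> \<Longrightarrow> \<delta> a b c d \<in> carrier M"
  shows "sum_pairs M (\<lambda>a b. sum_pairs M (\<delta> a b) ys) xs
    = sum_pairs M (\<lambda>c d. sum_pairs M (\<lambda>a b. \<delta> a b c d) xs) ys"
  using assms(1)
proof (induction xs rule: list.induct)
  case Nil
  have "sum_pairs M (\<lambda>c d. \<zero>\<^bsub>M\<^esub>) ys = \<zero>\<^bsub>M\<^esub>" using assms(2) by (induction ys) auto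
  then show ?case by simp
next
  case (Cons x xs)
  obtain a b where x: "x = (a, b)" by fastforce
  have ab: "a \<in> A" "b \<in> B" and xs: "xs \<in> lists (A \<times> B)" using Cons x by auto
  have "sum_pairs M (\<lambda>c d. \<delta> a b c d \<oplus>\<^bsub>M\<^esub> sum_pairs M (\<lambda>a b. \<delta> a b c d) xs) ys
      = sum_pairs M (\<delta> a b) ys \<oplus>\<^bsub>M\<^esub> sum_pairs M (\<lambda>c d. sum_pairs M (\<lambda>a b. \<delta> a b c d) xs) ys"
    by (rule sum_pairs_add[OF assms(2)]) (auto intro: \<delta> ab sum_pairs_closed[OF xs])
  then show ?case using Cons.IH[OF xs] by (simp add: x)
qed

lemma mod_hom_zero_map: "(\<lambda>x. \<zero>\<^bsub>M\<^esub>) \<in> mod_hom R N M"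
  by (intro mod_homI) auto

lemma sum_pairs_mod_hom:
  assumes "xs \<in> lists (A \<times> B)"
    and "\<And>a b. \<lbrakk>a \<in> A; b \<in> B\<rbrakk> \<Longrightarrow> (\<lambda>x. \<beta> x a b) \<in> mod_hom R N M"
  shows "(\<lambda>x. sum_pairs M (\<beta> x) xs) \<in> mod_hom R N M"
  using assms(1)
proof (induction xs rule: list.induct)
  case Nil
  show ?case by (simp add: mod_hom_zero_map)
next
  case (Cons x xs)
  obtain a b where x: "x = (a, b)" by fastforce
  show ?case using Cons assms(2) by (auto simp: x intro!: mod_hom_add)
qed

end

lemma sum_pairs_cong:
  assumes "xs \<in> lists (A \<times> B)" "\<And>a b. \<lbrakk>a \<in> A; b \<in> B\<rbrakk> \<Longrightarrow> \<beta> a b = \<gamma> a b"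
  shows "sum_pairs P \<beta> xs = sum_pairs P \<gamma> xs"
  using assms by (induction xs) auto

lemma module_bilinearI:
  "\<lbrakk>module R M; module R N; module R P; bilinear R M N P \<beta>\<rbrakk> \<Longrightarrow> module_bilinear R M N P \<beta>"
  by (simp add: module_bilinear_def module_bilinear_axioms_def module_pair_def)

context module_pair
begin

lemma tensor_rep_words: "X \<in> carrier (tensor R M N) \<Longrightarrow> tensor_rep X \<in> lists (carrier M \<times> carrier N)"
  using tensor_eq_words[OF tensor_eq_rep] by (auto simp: tensor_carrier formal_sums_def)

lemma pure_tensor_closed:
  "\<lbrakk>m \<in> carrier M; n \<in> carrier N\<rbrakk> \<Longrightarrow> pure_tensor R M N m n \<in> carrier (tensor R M N)"
  using bilinearD(3)[OF pure_tensor_bilinear] .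

lemma tensor_lift_cong:
  assumes "X \<in> carrier (tensor R M N)"
    "\<And>m n. \<lbrakk>m \<in> carrier M; n \<in> carrier N\<rbrakk> \<Longrightarrow> \<beta> m n = \<gamma> m n"
  shows "tensor_lift P \<beta> X = tensor_lift P \<gamma> X"
  unfolding tensor_lift_def by (rule sum_pairs_cong[OF tensor_rep_words]) (use assms in auto)

lemma tensor_lift_hom:
  assumes "module R P" "module R Q" "g \<in> mod_hom R P Q" "X \<in> carrier (tensor R M N)"
    "\<And>m n. \<lbrakk>m \<in> carrier M; n \<in> carrier N\<rbrakk> \<Longrightarrow> \<beta> m n \<in> carrier P"
  shows "g (tensor_lift P \<beta> X) = tensor_lift Q (\<lambda>m n. g (\<beta> m n)) X"
  unfolding tensor_lift_def by (rule module.sum_pairs_hom[OF _ _ _ tensor_rep_words]) (use assms in auto)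

lemma tensor_lift_body_mod_hom:
  assumes "module R P" "X \<in> carrier (tensor R M N)"
    "\<And>m n. \<lbrakk>m \<in> carrier M; n \<in> carrier N\<rbrakk> \<Longrightarrow> (\<lambda>x. \<beta> x m n) \<in> mod_hom R L P"
  shows "(\<lambda>x. tensor_lift P (\<beta> x) X) \<in> mod_hom R L P"
  unfolding tensor_lift_def by (rule module.sum_pairs_mod_hom[OF _ tensor_rep_words]) (use assms in auto)

end

section \<open>Finite sums, dual bases and contraction\<close>

context module
begin

lemma finsum_eqI:
  assumes "\<And>i. i \<in> I \<Longrightarrow> g i \<in> carrier M" "\<And>i. i \<in> I \<Longrightarrow> f i = g i"
  shows "finsum M f I = finsum M g I"
  using assms by (intro M.finsum_cong') auto

lemma finsum_in_carrier: "(\<And>i. i \<in> I \<Longrightarrow> g i \<in> carrier M) \<Longrightarrow> finsum M g I \<in> carrier M"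
  by (rule M.finsum_closed) auto

lemma finsum_swap:
  assumes "finite I" "finite J" "\<And>i j. \<lbrakk>i \<in> I; j \<in> J\<rbrakk> \<Longrightarrow> F i j \<in> carrier M"
  shows "(\<Oplus>\<^bsub>M\<^esub>i\<in>I. \<Oplus>\<^bsub>M\<^esub>j\<in>J. F i j) = (\<Oplus>\<^bsub>M\<^esub>j\<in>J. \<Oplus>\<^bsub>M\<^esub>i\<in>I. F i j)"
  using assms(1,3)
proof (induction I rule: finite_induct)
  case empty
  show ?case by (simp add: M.finsum_zero)
next
  case (insert k I)
  have "(\<Oplus>\<^bsub>M\<^esub>i\<in>insert k I. \<Oplus>\<^bsub>M\<^esub>j\<in>J. F i j)
      = (\<Oplus>\<^bsub>M\<^esub>j\<in>J. F k j) \<oplus>\<^bsub>M\<^esub> (\<Oplus>\<^bsub>M\<^esub>j\<in>J. \<Oplus>\<^bsub>M\<^esub>i\<in>I. F i j)"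
    using insert by (subst M.finsum_insert) (auto intro!: finsum_in_carrier)
  also have "\<dots> = (\<Oplus>\<^bsub>M\<^esub>j\<in>J. F k j \<oplus>\<^bsub>M\<^esub> (\<Oplus>\<^bsub>M\<^esub>i\<in>I. F i j))"
    using insert by (subst M.finsum_addf) (auto intro!: finsum_in_carrier)
  also have "\<dots> = (\<Oplus>\<^bsub>M\<^esub>j\<in>J. \<Oplus>\<^bsub>M\<^esub>i\<in>insert k I. F i j)"
  proof (rule finsum_eqI[symmetric])
    fix j assume j: "j \<in> J"
    show "(\<Oplus>\<^bsub>M\<^esub>i\<in>insert k I. F i j) = F k j \<oplus>\<^bsub>M\<^esub> (\<Oplus>\<^bsub>M\<^esub>i\<in>I. F i j)"
      using insert j by (subst M.finsum_insert) auto
  qed (use insert in \<open>auto intro!: finsum_in_carrier\<close>)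
  finally show ?case .
qed

end

text \<open>The form in which finite generation and projectivity are used throughout. The element
  \<Sum> e_i \<otimes> E_i stands for the identity of \<open>M\<close>, so sums over
  \<open>I\<close> that are linear in both slots behave like traces.\<close>

locale dual_basis = module R M for R (structure) and M (structure) +
  fixes I :: "'i set" and e :: "'i \<Rightarrow> 'c" and E :: "'i \<Rightarrow> 'c \<Rightarrow> 'a"
  assumes finite_I: "finite I"
    and e_closed [simp]: "i \<in> I \<Longrightarrow> e i \<in> carrier M"
    and E_dual [simp]: "i \<in> I \<Longrightarrow> E i \<in> carrier (dual R M)"
    and expansion: "x \<in> carrier M \<Longrightarrow> x = (\<Oplus>\<^bsub>M\<^esub>i\<in>I. E i x \<odot>\<^bsub>M\<^esub> e i)"
begin

lemma E_mod_hom [lin]: "\<lbrakk>i \<in> I; g \<in> mod_hom R L M\<rbrakk> \<Longrightarrow> (\<lambda>x. E i (g x)) \<in> mod_hom R L (regular_module R)"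
  by (rule mod_hom_compose[OF dual_mod_hom[OF E_dual]])

lemma hom_expansion:
  assumes "module R P" and f: "f \<in> mod_hom R M P" and x: "x \<in> carrier M"
  shows "(\<Oplus>\<^bsub>P\<^esub>i\<in>I. E i x \<odot>\<^bsub>P\<^esub> f (e i)) = f x"
proof -
  interpret P: module R P by fact
  have "f x = f (\<Oplus>\<^bsub>M\<^esub>i\<in>I. E i x \<odot>\<^bsub>M\<^esub> e i)" using expansion[OF x] by simp
  also have "\<dots> = (\<Oplus>\<^bsub>P\<^esub>i\<in>I. f (E i x \<odot>\<^bsub>M\<^esub> e i))"
    using x by (intro mod_hom_finsum[OF _ _ f] finite_I) auto
  also have "\<dots> = (\<Oplus>\<^bsub>P\<^esub>i\<in>I. E i x \<odot>\<^bsub>P\<^esub> f (e i))"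
    using x mod_homD[OF f] by (intro P.finsum_eqI) auto
  finally show ?thesis ..
qed

text \<open>Evaluation at x is linear, and at x the sum is \<open>f\<close> applied to the expansion
  of x. This makes vectors and functionals symmetric: the \<open>E i\<close> generate the dual, with
  the values at \<open>e i\<close> as coordinates.\<close>

lemma dual_expansion:
  assumes f: "f \<in> carrier (dual R M)"
  shows "(\<Oplus>\<^bsub>dual R M\<^esub>i\<in>I. f (e i) \<odot>\<^bsub>dual R M\<^esub> E i) = f"
proof -
  interpret D: module R "dual R M" by simp
  have c: "f (e i) \<odot>\<^bsub>dual R M\<^esub> E i \<in> carrier (dual R M)" if "i \<in> I" for i
    using that f by simp
  show ?thesis
  proof (rule dual_eqI[OF _ f])
    fix x assume x: "x \<in> carrier M"
    have "(\<Oplus>\<^bsub>dual R M\<^esub>i\<in>I. f (e i) \<odot>\<^bsub>dual R M\<^esub> E i) x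
        = (\<Oplus>\<^bsub>regular_module R\<^esub>i\<in>I. (f (e i) \<odot>\<^bsub>dual R M\<^esub> E i) x)"
      using c by (intro mod_hom_finsum[OF _ _ mod_hom_eval[OF x]] finite_I) auto
    also have "\<dots> = (\<Oplus>\<^bsub>regular_module R\<^esub>i\<in>I. E i x \<odot>\<^bsub>regular_module R\<^esub> f (e i))"
      using x f by (intro module.finsum_eqI[of R]) (auto simp: dual_simps R.m_comm)
    also have "\<dots> = f x"
      by (rule hom_expansion[OF _ dual_mod_hom[OF f] x]) simp
    finally show "(\<Oplus>\<^bsub>dual R M\<^esub>i\<in>I. f (e i) \<odot>\<^bsub>dual R M\<^esub> E i) x = f x" .
  qed (use c in \<open>auto intro!: D.finsum_in_carrier\<close>)
qed

lemma dual_hom_expansion: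
  assumes "module R P" and F: "F \<in> mod_hom R (dual R M) P" and f: "f \<in> carrier (dual R M)"
  shows "(\<Oplus>\<^bsub>P\<^esub>i\<in>I. f (e i) \<odot>\<^bsub>P\<^esub> F (E i)) = F f"
proof -
  interpret P: module R P by fact
  interpret D: module R "dual R M" by simp
  have "F f = F (\<Oplus>\<^bsub>dual R M\<^esub>i\<in>I. f (e i) \<odot>\<^bsub>dual R M\<^esub> E i)" using dual_expansion[OF f] by simp
  also have "\<dots> = (\<Oplus>\<^bsub>P\<^esub>i\<in>I. F (f (e i) \<odot>\<^bsub>dual R M\<^esub> E i))"
    using f by (intro mod_hom_finsum[OF _ _ F] finite_I) auto
  also have "\<dots> = (\<Oplus>\<^bsub>P\<^esub>i\<in>I. f (e i) \<odot>\<^bsub>P\<^esub> F (E i))"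
    using f mod_homD[OF F] by (intro P.finsum_eqI) auto
  finally show ?thesis ..
qed

lemma dual_compose_closed:
  "\<lbrakk>f \<in> carrier (dual R M); L \<in> mod_hom R M M\<rbrakk> \<Longrightarrow> (\<lambda>x\<in>carrier M. f (L x)) \<in> carrier (dual R M)"
  by (intro dual_restrict mod_hom_compose[OF dual_mod_hom])

text \<open>Cyclicity of the trace: expand \<open>L (e i)\<close> in the \<open>e j\<close>,
  exchange the two sums and collect the \<open>E i\<close>, whose coefficients E_j(L(e_i)) are the
  coordinates of E_j \<circ> L. An operator thus moves from the vector slot to the functional
  slot.\<close>

lemma contraction_cyclic:
  assumes "module R P" and L: "L \<in> mod_hom R M M"
    and \<Phi>1: "\<And>i. i \<in> I \<Longrightarrow> (\<lambda>x. \<Phi> x (E i)) \<in> mod_hom R M P"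
    and \<Phi>2: "\<And>x. x \<in> carrier M \<Longrightarrow> \<Phi> x \<in> mod_hom R (dual R M) P"
  shows "(\<Oplus>\<^bsub>P\<^esub>i\<in>I. \<Phi> (L (e i)) (E i)) = (\<Oplus>\<^bsub>P\<^esub>i\<in>I. \<Phi> (e i) (\<lambda>x\<in>carrier M. E i (L x)))"
proof -
  interpret P: module R P by fact
  note [simp] = mod_homD(1)[OF L] mod_homD(1)[OF \<Phi>2]
  have "(\<Oplus>\<^bsub>P\<^esub>i\<in>I. \<Phi> (L (e i)) (E i)) = (\<Oplus>\<^bsub>P\<^esub>i\<in>I. \<Oplus>\<^bsub>P\<^esub>j\<in>I. E j (L (e i)) \<odot>\<^bsub>P\<^esub> \<Phi> (e j) (E i))"
    using hom_expansion[OF P.module_axiom \<Phi>1] by (intro P.finsum_eqI) (auto intro!: P.finsum_in_carrier)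
  also have "\<dots> = (\<Oplus>\<^bsub>P\<^esub>j\<in>I. \<Oplus>\<^bsub>P\<^esub>i\<in>I. E j (L (e i)) \<odot>\<^bsub>P\<^esub> \<Phi> (e j) (E i))"
    by (rule P.finsum_swap[OF finite_I finite_I]) simp
  also have "\<dots> = (\<Oplus>\<^bsub>P\<^esub>j\<in>I. \<Phi> (e j) (\<lambda>x\<in>carrier M. E j (L x)))"
  proof (rule P.finsum_eqI)
    fix j assume j: "j \<in> I"
    then have "(\<Oplus>\<^bsub>P\<^esub>i\<in>I. (\<lambda>x\<in>carrier M. E j (L x)) (e i) \<odot>\<^bsub>P\<^esub> \<Phi> (e j) (E i))
        = \<Phi> (e j) (\<lambda>x\<in>carrier M. E j (L x))"
      by (intro dual_hom_expansion \<Phi>2 dual_compose_closed L) auto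
    moreover have "(\<Oplus>\<^bsub>P\<^esub>i\<in>I. (\<lambda>x\<in>carrier M. E j (L x)) (e i) \<odot>\<^bsub>P\<^esub> \<Phi> (e j) (E i))
        = (\<Oplus>\<^bsub>P\<^esub>i\<in>I. E j (L (e i)) \<odot>\<^bsub>P\<^esub> \<Phi> (e j) (E i))"
      using j by (intro P.finsum_eqI) auto
    ultimately show "(\<Oplus>\<^bsub>P\<^esub>i\<in>I. E j (L (e i)) \<odot>\<^bsub>P\<^esub> \<Phi> (e j) (E i)) = \<Phi> (e j) (\<lambda>x\<in>carrier M. E j (L x))"
      by simp
  qed (simp add: dual_compose_closed[OF E_dual L])
  finally show ?thesis .
qed

end

lemma (in module) mod_hom_finsum_body:
  assumes "finite I" "\<And>i. i \<in> I \<Longrightarrow> (\<lambda>x. F x i) \<in> mod_hom R N M"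
  shows "(\<lambda>x. \<Oplus>\<^bsub>M\<^esub>i\<in>I. F x i) \<in> mod_hom R N M"
proof (rule mod_homI)
  note D = mod_homD[OF assms(2)]
  fix x y assume xy: "x \<in> carrier N" "y \<in> carrier N"
  have "(\<Oplus>\<^bsub>M\<^esub>i\<in>I. F (x \<oplus>\<^bsub>N\<^esub> y) i) = (\<Oplus>\<^bsub>M\<^esub>i\<in>I. F x i \<oplus>\<^bsub>M\<^esub> F y i)"
    using D xy by (intro finsum_eqI) auto
  also have "\<dots> = (\<Oplus>\<^bsub>M\<^esub>i\<in>I. F x i) \<oplus>\<^bsub>M\<^esub> (\<Oplus>\<^bsub>M\<^esub>i\<in>I. F y i)"
    using D xy by (intro M.finsum_addf) auto
  finally show "(\<Oplus>\<^bsub>M\<^esub>i\<in>I. F (x \<oplus>\<^bsub>N\<^esub> y) i) = (\<Oplus>\<^bsub>M\<^esub>i\<in>I. F x i) \<oplus>\<^bsub>M\<^esub> (\<Oplus>\<^bsub>M\<^esub>i\<in>I. F y i)" .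
next
  note D = mod_homD[OF assms(2)]
  fix r x assume rx: "r \<in> carrier R" "x \<in> carrier N"
  have "(\<Oplus>\<^bsub>M\<^esub>i\<in>I. F (r \<odot>\<^bsub>N\<^esub> x) i) = (\<Oplus>\<^bsub>M\<^esub>i\<in>I. r \<odot>\<^bsub>M\<^esub> F x i)"
    using D rx by (intro finsum_eqI) auto
  also have "\<dots> = r \<odot>\<^bsub>M\<^esub> (\<Oplus>\<^bsub>M\<^esub>i\<in>I. F x i)"
    using D rx assms(1) by (intro finsum_smult_ldistr[symmetric]) auto
  finally show "(\<Oplus>\<^bsub>M\<^esub>i\<in>I. F (r \<odot>\<^bsub>N\<^esub> x) i) = r \<odot>\<^bsub>M\<^esub> (\<Oplus>\<^bsub>M\<^esub>i\<in>I. F x i)" .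
qed (use mod_homD(1)[OF assms(2)] in \<open>auto intro!: finsum_in_carrier\<close>)

section \<open>Isomorphisms of modules and of their duals\<close>

lemma mod_isomorphic_trans:
  assumes "mod_isomorphic R L M" "mod_isomorphic R M N"
  shows "mod_isomorphic R L N"
proof -
  obtain f g where "f \<in> mod_hom R L M" "bij_betw f (carrier L) (carrier M)"
    "g \<in> mod_hom R M N" "bij_betw g (carrier M) (carrier N)"
    using assms unfolding mod_isomorphic_def by blast
  then have "g \<circ> f \<in> mod_hom R L N" "bij_betw (g \<circ> f) (carrier L) (carrier N)"
    using mod_hom_compose[of g R M N f L] by (auto simp: comp_def intro: bij_betw_trans[unfolded comp_def])
  then show ?thesis unfolding mod_isomorphic_def by blast
qed

lemma mod_hom_inv:
  assumes "module R M" and f: "f \<in> mod_hom R M N" and bij: "bij_betw f (carrier M) (carrier N)"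
  shows "inv_into (carrier M) f \<in> mod_hom R N M"
proof -
  interpret M: module R M by fact
  let ?g = "inv_into (carrier M) f"
  have g: "?g y \<in> carrier M" "f (?g y) = y" if "y \<in> carrier N" for y
    using that bij by (auto simp: bij_betw_def inv_into_into f_inv_into_f)
  have gf: "?g y = x" if "x \<in> carrier M" "f x = y" for x y
    using that bij by (auto simp: bij_betw_def)
  show ?thesis
    by (rule mod_homI) (use g mod_homD[OF f] in \<open>auto intro!: gf\<close>)
qed

lemma mod_isomorphic_sym:
  assumes "module R M" "mod_isomorphic R M N"
  shows "mod_isomorphic R N M"
  using assms mod_hom_inv bij_betw_inv_into unfolding mod_isomorphic_def by blast

lemma dual_record_simps:
  "f \<in> carrier (dual R M) \<longleftrightarrow> f \<in> mod_hom R M (regular_module R) \<and> f \<in> extensional (carrier M)"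
  "f \<oplus>\<^bsub>dual R M\<^esub> g = (\<lambda>x\<in>carrier M. f x \<oplus>\<^bsub>R\<^esub> g x)"
  "r \<odot>\<^bsub>dual R M\<^esub> f = (\<lambda>x\<in>carrier M. r \<otimes>\<^bsub>R\<^esub> f x)"
  by (simp_all add: dual_def)

lemma mod_isomorphic_dual:
  assumes M: "module R M" and N: "module R N" and "mod_isomorphic R M N"
  shows "mod_isomorphic R (dual R N) (dual R M)"
proof -
  interpret M: module R M by fact
  interpret N: module R N by fact
  obtain f where f: "f \<in> mod_hom R M N" and bij: "bij_betw f (carrier M) (carrier N)"
    using assms(3) unfolding mod_isomorphic_def by blast
  let ?f' = "inv_into (carrier M) f"
  have f': "?f' \<in> mod_hom R N M" by (rule mod_hom_inv[OF M f bij])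
  have pull: "(\<lambda>x\<in>carrier L. g (h x)) \<in> carrier (dual R L)"
    if "module R L" "g \<in> carrier (dual R K)" "h \<in> mod_hom R L K" for g h
      and L :: "('a, 'x, 'y) module_scheme" and K :: "('a, 'z, 'w) module_scheme"
    using that by (intro module.dual_restrict mod_hom_compose[OF _ that(3)]) (simp_all add: dual_record_simps)
  let ?F = "\<lambda>g. \<lambda>x\<in>carrier M. g (f x)" and ?G = "\<lambda>g. \<lambda>y\<in>carrier N. g (?f' y)"
  have "?F \<in> mod_hom R (dual R N) (dual R M)"
    by (rule mod_homI) (use pull[OF M _ f] mod_homD(1)[OF f] in \<open>auto simp: dual_record_simps\<close>)
  moreover have "bij_betw ?F (carrier (dual R N)) (carrier (dual R M))"
  proof (rule bij_betw_byWitness[where f'="?G"])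
    show "\<forall>g\<in>carrier (dual R N). ?G (?F g) = g"
      using bij pull[OF N pull[OF M _ f] f'] mod_homD(1)[OF f']
      by (auto intro!: N.dual_eqI simp: bij_betw_inv_into_right)
    show "\<forall>g\<in>carrier (dual R M). ?F (?G g) = g"
      using bij pull[OF M pull[OF N _ f'] f] mod_homD(1)[OF f]
      by (auto intro!: M.dual_eqI simp: bij_betw_inv_into_left)
  qed (use pull[OF M _ f] pull[OF N _ f'] in auto)
  ultimately show ?thesis unfolding mod_isomorphic_def by blast
qed

section \<open>Submodules cut out by linear equations, and existence of dual bases\<close>

context module
begin

text \<open>Spaces of integrals are solution sets of families of linear equations; this is the
  source of their module structure.\<close>

lemma module_equalizer:
  assumes "module R N"
    and F: "\<And>i. i \<in> K \<Longrightarrow> F i \<in> mod_hom R M N" and G: "\<And>i. i \<in> K \<Longrightarrow> G i \<in> mod_hom R M N"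
  shows "module R (M\<lparr>carrier := {x \<in> carrier M. \<forall>i\<in>K. F i x = G i x}\<rparr>)"
proof -
  let ?J = "{x \<in> carrier M. \<forall>i\<in>K. F i x = G i x}"
  have "submodule ?J R M"
  proof (rule submoduleI)
    show s: "r \<odot>\<^bsub>M\<^esub> x \<in> ?J" if "r \<in> carrier R" "x \<in> ?J" for r x
      using that mod_homD(3)[OF F] mod_homD(3)[OF G] by simp
    show "\<ominus>\<^bsub>M\<^esub> x \<in> ?J" if "x \<in> ?J" for x
      using s[of "\<ominus> \<one>" x] that by (simp add: smult_l_minus)
    show "x \<oplus>\<^bsub>M\<^esub> y \<in> ?J" if "x \<in> ?J" "y \<in> ?J" for x y
      using that mod_homD(2)[OF F] mod_homD(2)[OF G] by simp
    show "\<zero>\<^bsub>M\<^esub> \<in> ?J"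
      using mod_hom_zero[OF module_axiom assms(1) F] mod_hom_zero[OF module_axiom assms(1) G] by simp
  qed auto
  then show ?thesis by (rule submodule.submodule_is_module) simp
qed

text \<open>The splitting \<open>s\<close> gives coordinates on \<open>M\<close>, but the index set
  of the free module may be infinite. Finitely many generators involve only finitely many
  coordinates, and all the others vanish on the whole of \<open>M\<close>.\<close>

lemma dual_basis_exists:
  assumes fg: "finitely_generated_module R M" and proj: "projective_module R M"
  shows "\<exists>(I :: 'c set) e E. dual_basis R M I e E"
proof -
  obtain A where A: "A \<subseteq> carrier M" "finite A"
    and gen: "\<And>x. x \<in> carrier M \<Longrightarrow> \<exists>c\<in>A \<rightarrow> carrier R. x = (\<Oplus>\<^bsub>M\<^esub>a\<in>A. c a \<odot>\<^bsub>M\<^esub> a)"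
    using fg unfolding finitely_generated_module_def by blast
  obtain I :: "'c set" and p s where p: "p \<in> mod_hom R (free_module R I) M"
    and s: "s \<in> mod_hom R M (free_module R I)" and ps: "\<And>x. x \<in> carrier M \<Longrightarrow> p (s x) = x"
    using proj unfolding projective_module_def by blast
  let ?F = "free_module R I" and ?k = "regular_module R"
  interpret k: module R ?k by simp
  have sx: "s x \<in> I \<rightarrow>\<^sub>E carrier R" "finite {i \<in> I. s x i \<noteq> \<zero>}" if "x \<in> carrier M" for x
    using mod_homD(1)[OF s that] by (auto simp: free_module_def)
  have coord: "(\<lambda>x. s x i) \<in> mod_hom R M ?k" if "i \<in> I" for i
    using sx(1) mod_homD(2,3)[OF s] that
    by (intro mod_homI) (auto simp: free_module_def PiE_iff)
  define J where "J = (\<Union>a\<in>A. {i \<in> I. s a i \<noteq> \<zero>})"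
  have J: "finite J" "J \<subseteq> I" using A sx(2) by (auto simp: J_def)
  have outside: "s x i = \<zero>" if x: "x \<in> carrier M" and i: "i \<in> I - J" for x i
  proof -
    obtain c where c: "c \<in> A \<rightarrow> carrier R" "x = (\<Oplus>\<^bsub>M\<^esub>a\<in>A. c a \<odot>\<^bsub>M\<^esub> a)" using gen[OF x] by blast
    have ca: "c a \<in> carrier R" "a \<in> carrier M" if "a \<in> A" for a using that c A by auto
    have "s x i = (\<Oplus>\<^bsub>?k\<^esub>a\<in>A. s (c a \<odot>\<^bsub>M\<^esub> a) i)"
      unfolding c(2) using i ca by (intro mod_hom_finsum[OF _ _ coord] A(2)) auto
    also have "\<dots> = (\<Oplus>\<^bsub>?k\<^esub>a\<in>A. \<zero>\<^bsub>?k\<^esub>)"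
    proof (rule k.finsum_eqI)
      fix a assume a: "a \<in> A"
      then have "s a i = \<zero>" using i by (auto simp: J_def)
      then show "s (c a \<odot>\<^bsub>M\<^esub> a) i = \<zero>\<^bsub>?k\<^esub>"
        using mod_homD(3)[OF coord, of i "c a" a] i ca[OF a] by simp
    qed simp
    also have "\<dots> = \<zero>" using k.M.finsum_zero by simp
    finally show ?thesis .
  qed
  define \<delta> where "\<delta> j = (\<lambda>i\<in>I. if i = j then \<one> else \<zero>)" for j
  \<comment> \<open>Truncation to a finite \<open>K\<close> lets \<open>p\<close> be computed by
    induction on \<open>K\<close>. At \<open>K = J\<close> it leaves \<open>s x\<close>
    unchanged.\<close>
  define tr where "tr K d = (\<lambda>i\<in>I. if i \<in> K then d i else \<zero>)" for K d
  have \<delta>_closed: "\<delta> j \<in> carrier ?F" for j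
    by (auto simp: free_module_def \<delta>_def intro: finite_subset[of _ "{j}"])
  have p\<delta> [simp]: "p (\<delta> j) \<in> carrier M" for j by (rule mod_homD(1)[OF p \<delta>_closed])
  have p_tr: "p (tr K d) = (\<Oplus>\<^bsub>M\<^esub>j\<in>K. d j \<odot>\<^bsub>M\<^esub> p (\<delta> j))"
    if "finite K" "K \<subseteq> I" and d: "d \<in> I \<rightarrow>\<^sub>E carrier R" for K d
    using that(1,2)
  proof (induction K rule: finite_induct)
    case empty
    have z: "tr {} d \<in> carrier ?F" by (auto simp: free_module_def tr_def)
    \<comment> \<open>Writing the zero function as 0 times itself yields p(0) = 0 from compatibility
      with scalars alone.\<close>
    have "tr {} d = \<zero> \<odot>\<^bsub>?F\<^esub> tr {} d" by (auto simp: free_module_def tr_def)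
    then have "p (tr {} d) = \<zero> \<odot>\<^bsub>M\<^esub> p (tr {} d)"
      using mod_homD(3)[OF p R.zero_closed z] by simp
    also have "\<dots> = \<zero>\<^bsub>M\<^esub>" by (rule smult_l_null[OF mod_homD(1)[OF p z]])
    finally show ?case by simp
  next
    case (insert k K)
    have dc: "d i \<in> carrier R" if "i \<in> I" for i using d that by auto
    have trc: "tr K d \<in> carrier ?F"
      using insert dc by (auto simp: free_module_def tr_def intro: finite_subset[of _ K])
    have d\<delta>: "d k \<odot>\<^bsub>?F\<^esub> \<delta> k \<in> carrier ?F"
      using insert dc by (auto simp: free_module_def \<delta>_def intro: finite_subset[of _ "{k}"])
    have "tr (insert k K) d = d k \<odot>\<^bsub>?F\<^esub> \<delta> k \<oplus>\<^bsub>?F\<^esub> tr K d"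
      using insert dc by (auto simp: free_module_def \<delta>_def tr_def)
    then have "p (tr (insert k K) d) = d k \<odot>\<^bsub>M\<^esub> p (\<delta> k) \<oplus>\<^bsub>M\<^esub> p (tr K d)"
      using mod_homD(2)[OF p d\<delta> trc] mod_homD(3)[OF p _ \<delta>_closed[of k], of "d k"] insert dc by simp
    also have "\<dots> = (\<Oplus>\<^bsub>M\<^esub>j\<in>insert k K. d j \<odot>\<^bsub>M\<^esub> p (\<delta> j))"
      using insert dc by (subst M.finsum_insert) auto
    finally show ?case .
  qed
  have "dual_basis R M J (\<lambda>j. p (\<delta> j)) (\<lambda>j. \<lambda>x\<in>carrier M. s x j)"
  proof (unfold_locales)
    show "(\<lambda>x\<in>carrier M. s x j) \<in> carrier (dual R M)" if "j \<in> J" for j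
      using that J by (intro dual_restrict coord) auto
    fix x assume x: "x \<in> carrier M"
    have trJ: "tr J (s x) = s x"
    proof (rule ext)
      fix i
      show "tr J (s x) i = s x i"
        using outside[OF x, of i] PiE_arb[OF sx(1)[OF x], of i] by (simp add: tr_def)
    qed
    have "x = p (s x)" using ps[OF x] ..
    also have "\<dots> = (\<Oplus>\<^bsub>M\<^esub>j\<in>J. s x j \<odot>\<^bsub>M\<^esub> p (\<delta> j))"
      using p_tr[OF J sx(1)[OF x]] by (simp only: trJ)
    also have "\<dots> = (\<Oplus>\<^bsub>M\<^esub>j\<in>J. (\<lambda>x\<in>carrier M. s x j) x \<odot>\<^bsub>M\<^esub> p (\<delta> j))"
      using x PiE_mem[OF sx(1)[OF x]] J(2) by (intro finsum_eqI) auto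
    finally show "x = (\<Oplus>\<^bsub>M\<^esub>j\<in>J. (\<lambda>x\<in>carrier M. s x j) x \<odot>\<^bsub>M\<^esub> p (\<delta> j))" .
  qed (use J in auto)
  then show ?thesis by blast
qed

end

section \<open>Sweedler calculus\<close>

text \<open>The target \<open>P\<close> is arbitrary: an equation between tensors is expressed by
  applying every bilinear map into every module, and nested sums stand for iterated
  coproducts.\<close>

definition sweedler ::
    "('a, 'h, 's) hopf_scheme \<Rightarrow> ('a, 'p, 'u) module_scheme \<Rightarrow> ('h \<Rightarrow> 'h \<Rightarrow> 'p) \<Rightarrow> 'h \<Rightarrow> 'p"
  where "sweedler H P \<beta> h = tensor_lift P \<beta> (comult H h)"

context hopf_algebra
begin

abbreviation "sw P \<equiv> sweedler H P"

abbreviation "S \<equiv> antipode H"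

abbreviation "\<epsilon> \<equiv> counit H"

lemma S_closed [simp]: "x \<in> carrier H \<Longrightarrow> S x \<in> carrier H"
  by (rule mod_homD(1)[OF antipode_linear])

lemma counit_closed [simp]: "x \<in> carrier H \<Longrightarrow> \<epsilon> x \<in> carrier R"
  using mod_homD(1)[OF counit_linear] by simp

lemma counit_simps [simp]:
  "\<lbrakk>x \<in> carrier H; y \<in> carrier H\<rbrakk> \<Longrightarrow> \<epsilon> (x \<otimes>\<^bsub>H\<^esub> y) = \<epsilon> x \<otimes> \<epsilon> y"
  "\<epsilon> \<one>\<^bsub>H\<^esub> = \<one>"
  using counit_ring_hom by (auto simp: ring_hom_def)

lemma mult_mod_hom [lin]:
  "\<lbrakk>f \<in> mod_hom R M H; y \<in> carrier H\<rbrakk> \<Longrightarrow> (\<lambda>x. f x \<otimes>\<^bsub>H\<^esub> y) \<in> mod_hom R M H"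
  "\<lbrakk>y \<in> carrier H; f \<in> mod_hom R M H\<rbrakk> \<Longrightarrow> (\<lambda>x. y \<otimes>\<^bsub>H\<^esub> f x) \<in> mod_hom R M H"
  using mod_homD[of f R M H] by (auto intro!: mod_homI simp: H.l_distr H.r_distr smult_mult_left smult_mult_right)

lemmas S_mod_hom [lin] = mod_hom_compose[OF antipode_linear]

lemmas counit_mod_hom [lin] = mod_hom_compose[OF counit_linear]

lemma comult_rep: "h \<in> carrier H \<Longrightarrow> tensor_rep (comult H h) \<in> lists (carrier H \<times> carrier H)"
proof -
  assume h: "h \<in> carrier H"
  interpret HH: module_pair R H H ..
  have "comult H h \<in> carrier (tensor R H H)" using mod_homD(1)[OF comult_linear h] .
  then obtain xs where "xs \<in> formal_sums H H" "comult H h = tensor_class R H H xs"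
    unfolding HH.tensor_carrier by blast
  then show ?thesis
    using HH.tensor_eq_words[OF HH.tensor_eq_rep[of xs]] by (simp add: formal_sums_def)
qed

text \<open>As a congruence rule it lets the simplifier assume, inside a Sweedler sum, that both
  legs lie in the carrier; the laws of \<open>H\<close> become available there.\<close>

lemma sw_cong [cong]:
  assumes "P = P'" "h = h'" "h' \<in> carrier H"
    "\<And>a b. a \<in> carrier H \<Longrightarrow> b \<in> carrier H \<Longrightarrow> \<beta> a b = \<beta>' a b"
  shows "sw P \<beta> h = sw P' \<beta>' h'"
  using sum_pairs_cong[OF comult_rep[of h'], of \<beta> \<beta>'] assms
  by (simp add: sweedler_def tensor_lift_def)

lemma sw_eqI:
  assumes "h \<in> carrier H"
    "\<And>a b. \<lbrakk>a \<in> carrier H; b \<in> carrier H\<rbrakk> \<Longrightarrow> \<beta> a b = \<beta>' a b"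
  shows "sw P \<beta> h = sw P \<beta>' h"
  using sum_pairs_cong[OF comult_rep[of h], of \<beta> \<beta>'] assms
  by (simp add: sweedler_def tensor_lift_def)

lemma hopf_mult_one_in_tensor:
  "comult H \<one>\<^bsub>H\<^esub> = tensor_class R H H [(\<one>\<^bsub>H\<^esub>, \<one>\<^bsub>H\<^esub>)]"
  "\<lbrakk>x \<in> carrier H; y \<in> carrier H\<rbrakk> \<Longrightarrow> comult H (x \<otimes>\<^bsub>H\<^esub> y) = tensor_class R H H
    [(a \<otimes>\<^bsub>H\<^esub> c, b \<otimes>\<^bsub>H\<^esub> d). (a, b) \<leftarrow> tensor_rep (comult H x), (c, d) \<leftarrow> tensor_rep (comult H y)]"
  using comult_ring_hom by (auto simp: ring_hom_def tensor_def)

context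
  fixes P :: "('a, 'p, 'u) module_scheme"
  assumes P [simp]: "module R P"
begin

interpretation P: module R P by (rule P)

lemma sw_closed [simp]:
  assumes "\<And>a b. \<lbrakk>a \<in> carrier H; b \<in> carrier H\<rbrakk> \<Longrightarrow> \<beta> a b \<in> carrier P" "h \<in> carrier H"
  shows "sw P \<beta> h \<in> carrier P"
  using P.sum_pairs_closed[OF comult_rep[OF assms(2)], of \<beta>] assms(1)
  by (simp add: sweedler_def tensor_lift_def)

lemma sw_hom:
  assumes "module R Q" "g \<in> mod_hom R P Q" "h \<in> carrier H"
    "\<And>a b. \<lbrakk>a \<in> carrier H; b \<in> carrier H\<rbrakk> \<Longrightarrow> \<beta> a b \<in> carrier P"
  shows "g (sw P \<beta> h) = sw Q (\<lambda>a b. g (\<beta> a b)) h"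
  using P.sum_pairs_hom[OF assms(1,2) comult_rep[OF assms(3)], of \<beta>] assms(4)
  by (simp add: sweedler_def tensor_lift_def)

lemma sw_commute:
  assumes "x \<in> carrier H" "y \<in> carrier H"
    "\<And>a b c d. \<lbrakk>a \<in> carrier H; b \<in> carrier H; c \<in> carrier H; d \<in> carrier H\<rbrakk> \<Longrightarrow> \<delta> a b c d \<in> carrier P"
  shows "sw P (\<lambda>a b. sw P (\<delta> a b) y) x = sw P (\<lambda>c d. sw P (\<lambda>a b. \<delta> a b c d) x) y"
  using P.sum_pairs_commute[OF comult_rep[OF assms(1)] comult_rep[OF assms(2)], of \<delta>] assms(3)
  by (simp add: sweedler_def tensor_lift_def)

lemma sw_add:
  assumes "h \<in> carrier H"
    "\<And>a b. \<lbrakk>a \<in> carrier H; b \<in> carrier H\<rbrakk> \<Longrightarrow> \<beta> a b \<in> carrier P"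
    "\<And>a b. \<lbrakk>a \<in> carrier H; b \<in> carrier H\<rbrakk> \<Longrightarrow> \<gamma> a b \<in> carrier P"
  shows "sw P (\<lambda>a b. \<beta> a b \<oplus>\<^bsub>P\<^esub> \<gamma> a b) h = sw P \<beta> h \<oplus>\<^bsub>P\<^esub> sw P \<gamma> h"
  using P.sum_pairs_add[OF comult_rep[OF assms(1)], of \<beta> \<gamma>] assms(2,3)
  by (simp add: sweedler_def tensor_lift_def)

lemma sw_body_mod_hom [lin]:
  assumes \<beta>: "\<And>a b. \<lbrakk>a \<in> carrier H; b \<in> carrier H\<rbrakk> \<Longrightarrow> (\<lambda>x. \<beta> x a b) \<in> mod_hom R M P"
    and h: "h \<in> carrier H"
  shows "(\<lambda>x. sw P (\<beta> x) h) \<in> mod_hom R M P"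
  unfolding sweedler_def tensor_lift_def by (rule P.sum_pairs_mod_hom[OF comult_rep[OF h] \<beta>])

text \<open>Linearity in the comultiplied element, in contrast to \<open>sw_body_mod_hom\<close>,
  where that element is fixed and a parameter of the summand varies. The representative of the
  coproduct now changes with the element, and bilinearity makes the sum independent of it.\<close>

lemma sw_mod_hom:
  assumes "bilinear R H H P \<beta>"
  shows "sw P \<beta> \<in> mod_hom R H P"
proof -
  interpret module_bilinear R H H P \<beta> by unfold_locales (rule assms)
  show ?thesis
    using mod_hom_compose[OF tensor_lift_mod_hom comult_linear] by (simp add: sweedler_def[abs_def])
qed

lemma sw_arg_mod_hom [lin]:
  "\<lbrakk>bilinear R H H P \<beta>; g \<in> mod_hom R M H\<rbrakk> \<Longrightarrow> (\<lambda>x. sw P \<beta> (g x)) \<in> mod_hom R M P"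
  by (rule mod_hom_compose[OF sw_mod_hom])

lemma sw_one:
  assumes "bilinear R H H P \<beta>"
  shows "sw P \<beta> \<one>\<^bsub>H\<^esub> = \<beta> \<one>\<^bsub>H\<^esub> \<one>\<^bsub>H\<^esub>"
proof -
  interpret module_bilinear R H H P \<beta> by unfold_locales (rule assms)
  show ?thesis
    by (simp add: sweedler_def hopf_mult_one_in_tensor tensor_lift_class)
qed

text \<open>The comultiplication is multiplicative, and the product of two formal tensors is the
  list of all pairwise products, so the sum over it splits into a double sum.\<close>

lemma sw_mult:
  assumes "bilinear R H H P \<beta>" and xy: "x \<in> carrier H" "y \<in> carrier H"
  shows "sw P \<beta> (x \<otimes>\<^bsub>H\<^esub> y) = sw P (\<lambda>a b. sw P (\<lambda>c d. \<beta> (a \<otimes>\<^bsub>H\<^esub> c) (b \<otimes>\<^bsub>H\<^esub> d)) y) x"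
proof -
  interpret module_bilinear R H H P \<beta> by unfold_locales (rule assms)
  let ?f = "\<lambda>xs ys. [(a \<otimes>\<^bsub>H\<^esub> c, b \<otimes>\<^bsub>H\<^esub> d). (a, b) \<leftarrow> xs, (c, d) \<leftarrow> ys]"
  have row: "map (\<lambda>(c, d). (a \<otimes>\<^bsub>H\<^esub> c, b \<otimes>\<^bsub>H\<^esub> d)) ys \<in> words \<and>
      sum_pairs P \<beta> (map (\<lambda>(c, d). (a \<otimes>\<^bsub>H\<^esub> c, b \<otimes>\<^bsub>H\<^esub> d)) ys)
      = sum_pairs P (\<lambda>c d. \<beta> (a \<otimes>\<^bsub>H\<^esub> c) (b \<otimes>\<^bsub>H\<^esub> d)) ys"
    if "ys \<in> words" "a \<in> carrier H" "b \<in> carrier H" for a b ys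
    using that by (induction ys rule: list.induct) auto
  have "?f xs ys \<in> words \<and> sum_pairs P \<beta> (?f xs ys)
      = sum_pairs P (\<lambda>a b. sum_pairs P (\<lambda>c d. \<beta> (a \<otimes>\<^bsub>H\<^esub> c) (b \<otimes>\<^bsub>H\<^esub> d)) ys) xs"
    if "xs \<in> words" "ys \<in> words" for xs ys
    using that
  proof (induction xs rule: list.induct)
    case (Cons x xs)
    obtain a b where x: "x = (a, b)" by fastforce
    then have "a \<in> carrier H" "b \<in> carrier H" "xs \<in> words" using Cons by auto
    with row[OF \<open>ys \<in> words\<close>, of a b] Cons show ?case
      by (auto simp: x sum_pairs_append)
  qed simp
  from this[of "tensor_rep (comult H x)" "tensor_rep (comult H y)"] show ?thesis
    using comult_rep[OF xy(1)] comult_rep[OF xy(2)]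
    by (simp add: sweedler_def hopf_mult_one_in_tensor(2)[OF xy] tensor_lift_class formal_sums_def)
      (simp add: tensor_lift_def)
qed

lemma sw_counit_left:
  assumes f: "f \<in> mod_hom R H P" and h: "h \<in> carrier H"
  shows "sw P (\<lambda>a b. \<epsilon> a \<odot>\<^bsub>P\<^esub> f b) h = f h"
proof -
  have "f (sw H (\<lambda>a b. \<epsilon> a \<odot>\<^bsub>H\<^esub> b) h) = sw P (\<lambda>a b. f (\<epsilon> a \<odot>\<^bsub>H\<^esub> b)) h"
    by (rule hopf_algebra.sw_hom[OF hopf_algebra_axioms module_axiom P f h]) simp
  also have "\<dots> = sw P (\<lambda>a b. \<epsilon> a \<odot>\<^bsub>P\<^esub> f b) h"
    by (rule sw_eqI[OF h]) (simp add: mod_homD(3)[OF f])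
  finally show ?thesis using counit_left[OF h] by (simp add: sweedler_def)
qed

lemma sw_counit_right:
  assumes f: "f \<in> mod_hom R H P" and h: "h \<in> carrier H"
  shows "sw P (\<lambda>a b. \<epsilon> b \<odot>\<^bsub>P\<^esub> f a) h = f h"
proof -
  have "f (sw H (\<lambda>a b. \<epsilon> b \<odot>\<^bsub>H\<^esub> a) h) = sw P (\<lambda>a b. f (\<epsilon> b \<odot>\<^bsub>H\<^esub> a)) h"
    by (rule hopf_algebra.sw_hom[OF hopf_algebra_axioms module_axiom P f h]) simp
  also have "\<dots> = sw P (\<lambda>a b. \<epsilon> b \<odot>\<^bsub>P\<^esub> f a) h"
    by (rule sw_eqI[OF h]) (simp add: mod_homD(3)[OF f])
  finally show ?thesis using counit_right[OF h] by (simp add: sweedler_def)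
qed

lemma sw_antipode_left:
  assumes f: "f \<in> mod_hom R H P" and h: "h \<in> carrier H"
  shows "sw P (\<lambda>a b. f (S a \<otimes>\<^bsub>H\<^esub> b)) h = \<epsilon> h \<odot>\<^bsub>P\<^esub> f \<one>\<^bsub>H\<^esub>"
proof -
  have "f (sw H (\<lambda>a b. S a \<otimes>\<^bsub>H\<^esub> b) h) = sw P (\<lambda>a b. f (S a \<otimes>\<^bsub>H\<^esub> b)) h"
    by (rule hopf_algebra.sw_hom[OF hopf_algebra_axioms module_axiom P f h]) simp
  then show ?thesis using antipode_left[OF h] mod_homD(3)[OF f] h by (simp add: sweedler_def)
qed

lemma sw_antipode_right:
  assumes f: "f \<in> mod_hom R H P" and h: "h \<in> carrier H"
  shows "sw P (\<lambda>a b. f (a \<otimes>\<^bsub>H\<^esub> S b)) h = \<epsilon> h \<odot>\<^bsub>P\<^esub> f \<one>\<^bsub>H\<^esub>"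
proof -
  have "f (sw H (\<lambda>a b. a \<otimes>\<^bsub>H\<^esub> S b) h) = sw P (\<lambda>a b. f (a \<otimes>\<^bsub>H\<^esub> S b)) h"
    by (rule hopf_algebra.sw_hom[OF hopf_algebra_axioms module_axiom P f h]) simp
  then show ?thesis using antipode_right[OF h] mod_homD(3)[OF f] h by (simp add: sweedler_def)
qed

text \<open>Coassociativity is an equation in H \<otimes> (H \<otimes> H). The first two hypotheses
  together say that \<open>\<gamma>\<close> is trilinear, so it induces a linear map
  \<open>?\<Lambda>\<close> on that module; applied to both sides of the axiom, this map gives the
  two iterated sums.\<close>

lemma sw_coassoc:
  assumes 1: "\<And>c. c \<in> carrier H \<Longrightarrow> bilinear R H H P (\<lambda>a b. \<gamma> a b c)"
    and 2: "\<And>a. a \<in> carrier H \<Longrightarrow> bilinear R H H P (\<gamma> a)"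
    and h: "h \<in> carrier H"
  shows "sw P (\<lambda>a b. sw P (\<lambda>c d. \<gamma> c d b) a) h = sw P (\<lambda>a b. sw P (\<gamma> a) b) h"
proof -
  let ?HH = "tensor R H H"
  let ?T = "tensor R H ?HH"
  let ?pure = "\<lambda>m n p. pure_tensor R H ?HH m (pure_tensor R H H n p)"
  let ?\<alpha> = "\<lambda>X p. tensor_lift ?T (\<lambda>m n. ?pure m n p) X"
  let ?\<Lambda> = "tensor_lift P (\<lambda>a. tensor_lift P (\<gamma> a))"
  let ?\<mu> = "\<lambda>a b. pure_tensor R ?HH H (comult H a) b"
  let ?\<nu> = "\<lambda>a b. pure_tensor R H ?HH a (comult H b)"
  interpret HH: module_pair R H H ..
  interpret T2: module R ?HH by (rule HH.tensor_module)
  interpret T: module_pair R H ?HH ..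
  interpret TH: module_pair R ?HH H ..
  interpret T3: module R ?T by (rule T.tensor_module)
  interpret T4: module R "tensor R ?HH H" by (rule TH.tensor_module)
  note [simp] = mod_homD(1)[OF comult_linear] HH.pure_tensor_closed T.pure_tensor_closed TH.pure_tensor_closed
  have \<gamma> [simp]: "\<gamma> a b c \<in> carrier P" if "a \<in> carrier H" "b \<in> carrier H" "c \<in> carrier H" for a b c
    using bilinearD(3)[OF 2] that .
  have \<Lambda>0: "bilinear R H ?HH P (\<lambda>a. tensor_lift P (\<gamma> a))"
  proof (rule bilinearI)
    show "tensor_lift P (\<gamma> a) \<in> mod_hom R ?HH P" if "a \<in> carrier H" for a
      using 2[OF that] by (intro module_bilinear.tensor_lift_mod_hom module_bilinearI) simp_all
    show "(\<lambda>a. tensor_lift P (\<gamma> a) X) \<in> mod_hom R H P" if "X \<in> carrier ?HH" for X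
      using that bilinearD(2)[OF 1] by (intro HH.tensor_lift_body_mod_hom) simp_all
  qed
  have \<Lambda>: "?\<Lambda> \<in> mod_hom R ?T P"
    using \<Lambda>0 by (intro module_bilinear.tensor_lift_mod_hom module_bilinearI) simp_all
  have \<Lambda>_pure: "?\<Lambda> (pure_tensor R H ?HH a X) = tensor_lift P (\<gamma> a) X"
    if "a \<in> carrier H" "X \<in> carrier ?HH" for a X
    using that \<Lambda>0 by (intro module_bilinear.tensor_lift_pure module_bilinearI) simp_all
  have \<Lambda>_pure3: "?\<Lambda> (?pure a b c) = \<gamma> a b c"
    if "a \<in> carrier H" "b \<in> carrier H" "c \<in> carrier H" for a b c
    using module_bilinear.tensor_lift_pure[OF module_bilinearI[OF _ _ _ 2]] that by (simp add: \<Lambda>_pure)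
  have \<alpha>: "bilinear R ?HH H ?T ?\<alpha>"
  proof (rule bilinearI)
    show "?\<alpha> X \<in> mod_hom R H ?T" if "X \<in> carrier ?HH" for X
      using that
      by (intro HH.tensor_lift_body_mod_hom bilinear_compose[OF T.pure_tensor_bilinear]
          bilinear_compose[OF HH.pure_tensor_bilinear] mod_hom_id) simp_all
    show "(\<lambda>X. ?\<alpha> X p) \<in> mod_hom R ?HH ?T" if "p \<in> carrier H" for p
      using that
      by (intro module_bilinear.tensor_lift_mod_hom module_bilinearI bilinearI
          bilinear_compose[OF T.pure_tensor_bilinear]
          bilinear_compose[OF HH.pure_tensor_bilinear] mod_hom_id) simp_all
  qed
  \<comment> \<open>Reassociation followed by \<open>?\<Lambda>\<close> is linear on (H \<otimes> H)
    \<otimes> H, so its value on the left side of the axiom is a Sweedler sum of values on pure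
    tensors.\<close>
  have G: "(\<lambda>Y. ?\<Lambda> (tensor_assoc R H H H Y)) \<in> mod_hom R (tensor R ?HH H) P"
    unfolding tensor_assoc_def
    using \<alpha> by (intro mod_hom_compose[OF \<Lambda>] module_bilinear.tensor_lift_mod_hom module_bilinearI) simp_all
  have G_pure: "?\<Lambda> (tensor_assoc R H H H (pure_tensor R ?HH H X c)) = tensor_lift P (\<lambda>a b. \<gamma> a b c) X"
    if "X \<in> carrier ?HH" "c \<in> carrier H" for X c
  proof -
    have "tensor_assoc R H H H (pure_tensor R ?HH H X c) = ?\<alpha> X c"
      unfolding tensor_assoc_def
      using that \<alpha> by (intro module_bilinear.tensor_lift_pure module_bilinearI) simp_all
    also have "?\<Lambda> \<dots> = tensor_lift P (\<lambda>a b. ?\<Lambda> (?pure a b c)) X"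
      using that by (intro HH.tensor_lift_hom[OF _ _ \<Lambda>]) simp_all
    also have "\<dots> = tensor_lift P (\<lambda>a b. \<gamma> a b c) X"
      using that \<Lambda>_pure3 by (intro HH.tensor_lift_cong) simp_all
    finally show ?thesis .
  qed
  have "sw P (\<lambda>a b. sw P (\<lambda>c d. \<gamma> c d b) a) h
      = tensor_lift P (\<lambda>a b. ?\<Lambda> (tensor_assoc R H H H (?\<mu> a b))) (comult H h)"
    unfolding sweedler_def using h by (intro HH.tensor_lift_cong) (simp_all add: G_pure)
  also have "\<dots> = ?\<Lambda> (tensor_assoc R H H H (tensor_map R ?HH H (comult H) id (comult H h)))"
    unfolding tensor_map_def
    using h by (subst HH.tensor_lift_hom[OF _ _ G]) simp_all
  also have "\<dots> = ?\<Lambda> (tensor_map R H ?HH id (comult H) (comult H h))"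
    using coassoc[OF h] by simp
  also have "\<dots> = tensor_lift P (\<lambda>a b. ?\<Lambda> (?\<nu> a b)) (comult H h)"
    unfolding tensor_map_def
    using h by (subst HH.tensor_lift_hom[OF _ _ \<Lambda>]) simp_all
  also have "\<dots> = sw P (\<lambda>a b. sw P (\<gamma> a) b) h"
    unfolding sweedler_def using h by (intro HH.tensor_lift_cong) (simp_all add: \<Lambda>_pure)
  finally show ?thesis .
qed

end

end

section \<open>The antipode reverses products and coproducts\<close>

context hopf_algebra
begin

lemma smult_left_commute:
  "\<lbrakk>r \<in> carrier R; s \<in> carrier R; x \<in> carrier H\<rbrakk> \<Longrightarrow> r \<odot>\<^bsub>H\<^esub> (s \<odot>\<^bsub>H\<^esub> x) = s \<odot>\<^bsub>H\<^esub> (r \<odot>\<^bsub>H\<^esub> x)"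
  by (metis R.m_comm smult_assoc1)

lemma S_one [simp]: "S \<one>\<^bsub>H\<^esub> = \<one>\<^bsub>H\<^esub>"
proof -
  have "sw H (\<lambda>a b. S a \<otimes>\<^bsub>H\<^esub> b) \<one>\<^bsub>H\<^esub> = S \<one>\<^bsub>H\<^esub> \<otimes>\<^bsub>H\<^esub> \<one>\<^bsub>H\<^esub>"
    by (rule sw_one) (rule lin | simp)+
  then show ?thesis using antipode_left[of "\<one>\<^bsub>H\<^esub>"] by (simp add: sweedler_def)
qed

text \<open>Apply the counit to S(x_1) x_2 = \<epsilon>(x) 1 and absorb \<epsilon>(x_2) into the
  other leg.\<close>

lemma counit_S [simp]:
  assumes x: "x \<in> carrier H"
  shows "\<epsilon> (S x) = \<epsilon> x"
proof -
  let ?k = "regular_module R"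
  have "sw ?k (\<lambda>a b. \<epsilon> (S a \<otimes>\<^bsub>H\<^esub> b)) x = \<epsilon> x \<odot>\<^bsub>?k\<^esub> \<epsilon> \<one>\<^bsub>H\<^esub>"
    by (rule sw_antipode_left) (use x in \<open>auto intro: counit_linear\<close>)
  moreover have "sw ?k (\<lambda>a b. \<epsilon> (S a \<otimes>\<^bsub>H\<^esub> b)) x = sw ?k (\<lambda>a b. \<epsilon> b \<odot>\<^bsub>?k\<^esub> \<epsilon> (S a)) x"
    by (rule sw_eqI) (use x in \<open>auto simp: R.m_comm\<close>)
  moreover have "\<dots> = \<epsilon> (S x)"
    by (rule sw_counit_right) (use x in \<open>auto intro!: lin\<close>)
  ultimately show ?thesis using x by simp
qed

text \<open>Both sides are convolution inverses of the multiplication in \<open>Hom(H \<otimes> H, H)\<close>.\<close>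

lemma S_mult:
  assumes x: "x \<in> carrier H" and y: "y \<in> carrier H"
  shows "S (x \<otimes>\<^bsub>H\<^esub> y) = S y \<otimes>\<^bsub>H\<^esub> S x"
proof -
  note [simp] = x y
  \<comment> \<open>Summed over the threefold coproducts, \<open>?F\<close> is S(x_1 y_1) x_2 y_2
    S(y_3) S(x_3). Cancelling the first two pairs of legs leaves S(y) S(x); cancelling the last two,
    first for y and then for x, leaves S(x y).\<close>
  let ?F = "\<lambda>c d x2 p q y2. S (c \<otimes>\<^bsub>H\<^esub> p) \<otimes>\<^bsub>H\<^esub> ((d \<otimes>\<^bsub>H\<^esub> q) \<otimes>\<^bsub>H\<^esub> (S y2 \<otimes>\<^bsub>H\<^esub> S x2))"
  let ?G = "\<lambda>c d x2. sw H (\<lambda>p y'. sw H (\<lambda>q y2. ?F c d x2 p q y2) y') y"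
  have y1: "sw H (\<lambda>p q. sw H (\<lambda>c d. ?F c d x2 p q y2) x1) y1
      = \<epsilon> y1 \<odot>\<^bsub>H\<^esub> (\<epsilon> x1 \<odot>\<^bsub>H\<^esub> (S y2 \<otimes>\<^bsub>H\<^esub> S x2))"
    if [simp]: "x1 \<in> carrier H" "x2 \<in> carrier H" "y1 \<in> carrier H" "y2 \<in> carrier H" for x1 x2 y1 y2
  proof -
    let ?w = "S y2 \<otimes>\<^bsub>H\<^esub> S x2"
    have "sw H (\<lambda>p q. sw H (\<lambda>c d. ?F c d x2 p q y2) x1) y1
        = sw H (\<lambda>c d. sw H (\<lambda>p q. ?F c d x2 p q y2) y1) x1"
      by (rule sw_commute) simp_all
    also have "\<dots> = sw H (\<lambda>u v. S u \<otimes>\<^bsub>H\<^esub> (v \<otimes>\<^bsub>H\<^esub> ?w)) (x1 \<otimes>\<^bsub>H\<^esub> y1)"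
      by (rule sw_mult[symmetric]) (rule lin | simp)+
    also have "\<dots> = sw H (\<lambda>u v. (S u \<otimes>\<^bsub>H\<^esub> v) \<otimes>\<^bsub>H\<^esub> ?w) (x1 \<otimes>\<^bsub>H\<^esub> y1)"
      by (rule sw_eqI) (simp_all add: H.m_assoc)
    also have "\<dots> = \<epsilon> (x1 \<otimes>\<^bsub>H\<^esub> y1) \<odot>\<^bsub>H\<^esub> (\<one>\<^bsub>H\<^esub> \<otimes>\<^bsub>H\<^esub> ?w)"
      by (rule sw_antipode_left) (rule lin | simp)+
    finally show ?thesis by (simp add: smult_assoc1 smult_left_commute[of "\<epsilon> x1"])
  qed
  have "sw H (\<lambda>x1 x2. sw H (\<lambda>c d. ?G c d x2) x1) x = sw H (\<lambda>x1 x2. S y \<otimes>\<^bsub>H\<^esub> (\<epsilon> x1 \<odot>\<^bsub>H\<^esub> S x2)) x"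
  proof (rule sw_eqI[OF x])
    fix x1 x2 assume [simp]: "x1 \<in> carrier H" "x2 \<in> carrier H"
    have "sw H (\<lambda>c d. ?G c d x2) x1 = sw H (\<lambda>c d. sw H (\<lambda>y1 y2. sw H (\<lambda>p q. ?F c d x2 p q y2) y1) y) x1"
      by (rule sw_eqI, simp, rule sw_coassoc[symmetric]) (rule lin | simp)+
    also have "\<dots> = sw H (\<lambda>y1 y2. sw H (\<lambda>c d. sw H (\<lambda>p q. ?F c d x2 p q y2) y1) x1) y"
      using y by (intro sw_commute) simp_all
    also have "\<dots> = sw H (\<lambda>y1 y2. \<epsilon> y1 \<odot>\<^bsub>H\<^esub> (\<epsilon> x1 \<odot>\<^bsub>H\<^esub> (S y2 \<otimes>\<^bsub>H\<^esub> S x2))) y"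
      by (intro sw_eqI[OF y], subst sw_commute) (simp_all add: y1)
    also have "\<dots> = \<epsilon> x1 \<odot>\<^bsub>H\<^esub> (S y \<otimes>\<^bsub>H\<^esub> S x2)"
      by (rule sw_counit_left) (rule lin | simp)+
    finally show "sw H (\<lambda>c d. ?G c d x2) x1 = S y \<otimes>\<^bsub>H\<^esub> (\<epsilon> x1 \<odot>\<^bsub>H\<^esub> S x2)"
      using y by (simp add: smult_mult_right)
  qed
  also have "\<dots> = sw H (\<lambda>x1 x2. \<epsilon> x1 \<odot>\<^bsub>H\<^esub> (S y \<otimes>\<^bsub>H\<^esub> S x2)) x"
    by (rule sw_eqI) (use x y in \<open>simp_all add: smult_mult_right\<close>)
  also have "\<dots> = S y \<otimes>\<^bsub>H\<^esub> S x"
    by (rule sw_counit_left) (rule lin | simp)+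
  finally have 1: "sw H (\<lambda>x1 x2. sw H (\<lambda>c d. ?G c d x2) x1) x = S y \<otimes>\<^bsub>H\<^esub> S x" .
  have G: "?G c d x2 = S (c \<otimes>\<^bsub>H\<^esub> y) \<otimes>\<^bsub>H\<^esub> (d \<otimes>\<^bsub>H\<^esub> S x2)"
    if [simp]: "c \<in> carrier H" "d \<in> carrier H" "x2 \<in> carrier H" for c d x2
  proof -
    have "?G c d x2 = sw H (\<lambda>p y'. \<epsilon> y' \<odot>\<^bsub>H\<^esub> (S (c \<otimes>\<^bsub>H\<^esub> p) \<otimes>\<^bsub>H\<^esub> (d \<otimes>\<^bsub>H\<^esub> S x2))) y"
    proof (rule sw_eqI[OF y])
      fix p y' assume [simp]: "p \<in> carrier H" "y' \<in> carrier H"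
      have "sw H (\<lambda>q y2. ?F c d x2 p q y2) y'
          = sw H (\<lambda>q y2. S (c \<otimes>\<^bsub>H\<^esub> p) \<otimes>\<^bsub>H\<^esub> (d \<otimes>\<^bsub>H\<^esub> ((q \<otimes>\<^bsub>H\<^esub> S y2) \<otimes>\<^bsub>H\<^esub> S x2))) y'"
        by (rule sw_eqI) (simp_all add: H.m_assoc)
      also have "\<dots> = \<epsilon> y' \<odot>\<^bsub>H\<^esub> (S (c \<otimes>\<^bsub>H\<^esub> p) \<otimes>\<^bsub>H\<^esub> (d \<otimes>\<^bsub>H\<^esub> (\<one>\<^bsub>H\<^esub> \<otimes>\<^bsub>H\<^esub> S x2)))"
        by (rule sw_antipode_right) (rule lin | simp)+
      finally show "sw H (\<lambda>q y2. ?F c d x2 p q y2) y'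
          = \<epsilon> y' \<odot>\<^bsub>H\<^esub> (S (c \<otimes>\<^bsub>H\<^esub> p) \<otimes>\<^bsub>H\<^esub> (d \<otimes>\<^bsub>H\<^esub> S x2))" by simp
    qed
    also have "\<dots> = S (c \<otimes>\<^bsub>H\<^esub> y) \<otimes>\<^bsub>H\<^esub> (d \<otimes>\<^bsub>H\<^esub> S x2)"
      by (rule sw_counit_right) (rule lin | simp)+
    finally show ?thesis .
  qed
  have "sw H (\<lambda>x1 x2. sw H (\<lambda>c d. ?G c d x2) x1) x = sw H (\<lambda>c x'. sw H (\<lambda>d x2. ?G c d x2) x') x"
    by (rule sw_coassoc) (rule lin | simp)+
  also have "\<dots> = sw H (\<lambda>c x'. \<epsilon> x' \<odot>\<^bsub>H\<^esub> S (c \<otimes>\<^bsub>H\<^esub> y)) x"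
  proof (rule sw_eqI[OF x])
    fix c x' assume [simp]: "c \<in> carrier H" "x' \<in> carrier H"
    have "sw H (\<lambda>d x2. ?G c d x2) x' = sw H (\<lambda>d x2. S (c \<otimes>\<^bsub>H\<^esub> y) \<otimes>\<^bsub>H\<^esub> (d \<otimes>\<^bsub>H\<^esub> S x2)) x'"
      by (rule sw_eqI) (simp_all only: G \<open>c \<in> carrier H\<close> \<open>x' \<in> carrier H\<close>)
    also have "\<dots> = \<epsilon> x' \<odot>\<^bsub>H\<^esub> (S (c \<otimes>\<^bsub>H\<^esub> y) \<otimes>\<^bsub>H\<^esub> \<one>\<^bsub>H\<^esub>)"
      by (rule sw_antipode_right) (rule lin | simp)+
    finally show "sw H (\<lambda>d x2. ?G c d x2) x' = \<epsilon> x' \<odot>\<^bsub>H\<^esub> S (c \<otimes>\<^bsub>H\<^esub> y)" using y by simp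
  qed
  also have "\<dots> = S (x \<otimes>\<^bsub>H\<^esub> y)"
    by (rule sw_counit_right) (rule lin | simp)+
  finally show ?thesis using 1 by simp
qed

context
  fixes P :: "('a, 'p, 'u) module_scheme"
  assumes P [simp]: "module R P"
begin

text \<open>In Sweedler notation: $S(e_1)_1 e_2 \otimes S(e_1)_2 = 1 \otimes S(e)$.\<close>

lemma sw_S_cancel_left:
  assumes \<beta>: "bilinear R H H P \<beta>" and e: "e \<in> carrier H"
  shows "sw P (\<lambda>a b. sw P (\<lambda>p q. \<beta> (p \<otimes>\<^bsub>H\<^esub> b) q) (S a)) e = \<beta> \<one>\<^bsub>H\<^esub> (S e)"
proof -
  note [lin] = bilinear_compose[OF \<beta>]
  note [simp] = bilinearD(3)[OF \<beta>] e
  \<comment> \<open>The sum of \<open>?\<gamma>\<close> is the coproduct of S(e_1) e_2 with S(e_3)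
    multiplied onto its second leg. Read this way it collapses to 1 \<otimes> S(e). Expanded it is
    S(e_1)_1 e_2 \<otimes> S(e_1)_2 e_3 S(e_4), where e_3 S(e_4) cancels.\<close>
  let ?\<gamma> = "\<lambda>a c d. sw P (\<lambda>u v. \<beta> u (v \<otimes>\<^bsub>H\<^esub> S d)) (S a \<otimes>\<^bsub>H\<^esub> c)"
  have "sw P (\<lambda>a b. sw P (\<lambda>c d. ?\<gamma> a c d) b) e = sw P (\<lambda>a b. sw P (\<lambda>p q. \<beta> (p \<otimes>\<^bsub>H\<^esub> b) q) (S a)) e"
  proof (rule sw_eqI[OF e])
    fix a b assume [simp]: "a \<in> carrier H" "b \<in> carrier H"
    let ?G = "\<lambda>p q r s d. \<beta> (p \<otimes>\<^bsub>H\<^esub> r) (q \<otimes>\<^bsub>H\<^esub> (s \<otimes>\<^bsub>H\<^esub> S d))"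
    have "sw P (\<lambda>c d. ?\<gamma> a c d) b = sw P (\<lambda>c d. sw P (\<lambda>p q. sw P (\<lambda>r s. ?G p q r s d) c) (S a)) b"
    proof (rule sw_eqI)
      fix c d assume [simp]: "c \<in> carrier H" "d \<in> carrier H"
      have "?\<gamma> a c d = sw P (\<lambda>p q. sw P (\<lambda>r s. \<beta> (p \<otimes>\<^bsub>H\<^esub> r) ((q \<otimes>\<^bsub>H\<^esub> s) \<otimes>\<^bsub>H\<^esub> S d)) c) (S a)"
        by (rule sw_mult) (rule lin | simp)+
      then show "?\<gamma> a c d = sw P (\<lambda>p q. sw P (\<lambda>r s. ?G p q r s d) c) (S a)"
        by (simp add: H.m_assoc)
    qed simp
    also have "\<dots> = sw P (\<lambda>p q. sw P (\<lambda>c d. sw P (\<lambda>r s. ?G p q r s d) c) b) (S a)"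
      by (rule sw_commute) simp_all
    also have "\<dots> = sw P (\<lambda>p q. sw P (\<lambda>r z. sw P (\<lambda>s d. ?G p q r s d) z) b) (S a)"
      by (intro sw_eqI sw_coassoc) (rule lin | simp)+
    also have "\<dots> = sw P (\<lambda>p q. sw P (\<lambda>r z. \<epsilon> z \<odot>\<^bsub>P\<^esub> \<beta> (p \<otimes>\<^bsub>H\<^esub> r) (q \<otimes>\<^bsub>H\<^esub> \<one>\<^bsub>H\<^esub>)) b) (S a)"
      by (intro sw_eqI sw_antipode_right) (rule lin | simp)+
    also have "\<dots> = sw P (\<lambda>p q. \<beta> (p \<otimes>\<^bsub>H\<^esub> b) (q \<otimes>\<^bsub>H\<^esub> \<one>\<^bsub>H\<^esub>)) (S a)"
      by (intro sw_eqI sw_counit_right) (rule lin | simp)+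
    finally show "sw P (\<lambda>c d. ?\<gamma> a c d) b = sw P (\<lambda>p q. \<beta> (p \<otimes>\<^bsub>H\<^esub> b) q) (S a)" by simp
  qed
  moreover have "sw P (\<lambda>a b. sw P (\<lambda>c d. ?\<gamma> a c d) b) e = sw P (\<lambda>a b. sw P (\<lambda>c d. ?\<gamma> c d b) a) e"
    by (rule sw_coassoc[symmetric]) (rule lin | simp)+
  moreover have "\<dots> = sw P (\<lambda>a b. \<epsilon> a \<odot>\<^bsub>P\<^esub> sw P (\<lambda>u v. \<beta> u (v \<otimes>\<^bsub>H\<^esub> S b)) \<one>\<^bsub>H\<^esub>) e"
    by (intro sw_eqI sw_antipode_left e) (rule lin | simp)+
  moreover have "\<dots> = sw P (\<lambda>u v. \<beta> u (v \<otimes>\<^bsub>H\<^esub> S e)) \<one>\<^bsub>H\<^esub>"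
    by (rule sw_counit_left) (rule lin | simp)+
  moreover have "\<dots> = \<beta> \<one>\<^bsub>H\<^esub> (\<one>\<^bsub>H\<^esub> \<otimes>\<^bsub>H\<^esub> S e)"
    by (rule sw_one) (rule lin | simp)+
  ultimately show ?thesis using e by simp
qed

text \<open>Evaluate S(e_1)_1 e_2 S(e_3) \<otimes> S(e_1)_2 in two ways. Grouping e_1 with e_2,
  \<open>sw_S_cancel_left\<close> gives S(e_2) \<otimes> S(e_1); cancelling e_2 S(e_3) gives the
  coproduct of S(e).\<close>

lemma sw_S:
  assumes \<beta>: "bilinear R H H P \<beta>" and e: "e \<in> carrier H"
  shows "sw P \<beta> (S e) = sw P (\<lambda>a b. \<beta> (S b) (S a)) e"
proof -
  note [lin] = bilinear_compose[OF \<beta>]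
  note [simp] = bilinearD(3)[OF \<beta>] e
  let ?\<gamma> = "\<lambda>c d b. sw P (\<lambda>p q. \<beta> (p \<otimes>\<^bsub>H\<^esub> (d \<otimes>\<^bsub>H\<^esub> S b)) q) (S c)"
  have "sw P (\<lambda>a b. \<beta> (S b) (S a)) e = sw P (\<lambda>a b. sw P (\<lambda>c d. ?\<gamma> c d b) a) e"
  proof (rule sw_eqI[OF e])
    fix a b assume [simp]: "a \<in> carrier H" "b \<in> carrier H"
    have "sw P (\<lambda>c d. ?\<gamma> c d b) a = sw P (\<lambda>c d. sw P (\<lambda>p q. \<beta> ((p \<otimes>\<^bsub>H\<^esub> d) \<otimes>\<^bsub>H\<^esub> S b) q) (S c)) a"
      by (simp add: H.m_assoc)
    also have "\<dots> = \<beta> (\<one>\<^bsub>H\<^esub> \<otimes>\<^bsub>H\<^esub> S b) (S a)"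
      by (rule sw_S_cancel_left) (rule lin | simp)+
    finally show "\<beta> (S b) (S a) = sw P (\<lambda>c d. ?\<gamma> c d b) a" by simp
  qed
  also have "\<dots> = sw P (\<lambda>a b. sw P (\<lambda>c d. ?\<gamma> a c d) b) e"
    by (rule sw_coassoc) (rule lin | simp)+
  also have "\<dots> = sw P (\<lambda>a b. \<epsilon> b \<odot>\<^bsub>P\<^esub> sw P (\<lambda>p q. \<beta> (p \<otimes>\<^bsub>H\<^esub> \<one>\<^bsub>H\<^esub>) q) (S a)) e"
    by (intro sw_eqI sw_antipode_right e) (rule lin | simp)+
  also have "\<dots> = sw P (\<lambda>p q. \<beta> (p \<otimes>\<^bsub>H\<^esub> \<one>\<^bsub>H\<^esub>) q) (S e)"
    by (rule sw_counit_right) (rule lin | simp)+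
  finally show ?thesis using e by simp
qed

text \<open>In Sweedler notation: $a_1 S(a_2)_2 \otimes S(a_2)_1 = 1 \otimes S(a)$.\<close>

lemma sw_S_cancel_right:
  assumes \<beta>: "bilinear R H H P \<beta>" and e: "e \<in> carrier H"
  shows "sw P (\<lambda>a b. sw P (\<lambda>p q. \<beta> (a \<otimes>\<^bsub>H\<^esub> q) p) (S b)) e = \<beta> \<one>\<^bsub>H\<^esub> (S e)"
proof -
  note [lin] = bilinear_compose[OF \<beta>]
  note [simp] = bilinearD(3)[OF \<beta>] e
  \<comment> \<open>Once the inner coproduct is reversed by \<open>sw_S\<close>, the expression is
    e_1 S(e_2) \<otimes> S(e_3).\<close>
  have "sw P (\<lambda>a b. sw P (\<lambda>p q. \<beta> (a \<otimes>\<^bsub>H\<^esub> q) p) (S b)) e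
      = sw P (\<lambda>a b. sw P (\<lambda>c d. \<beta> (a \<otimes>\<^bsub>H\<^esub> S c) (S d)) b) e"
    by (intro sw_eqI sw_S e) (rule lin | simp)+
  also have "\<dots> = sw P (\<lambda>z d. sw P (\<lambda>a c. \<beta> (a \<otimes>\<^bsub>H\<^esub> S c) (S d)) z) e"
    by (rule sw_coassoc[symmetric]) (rule lin | simp)+
  also have "\<dots> = sw P (\<lambda>z d. \<epsilon> z \<odot>\<^bsub>P\<^esub> \<beta> \<one>\<^bsub>H\<^esub> (S d)) e"
    by (intro sw_eqI sw_antipode_right e) (rule lin | simp)+
  also have "\<dots> = \<beta> \<one>\<^bsub>H\<^esub> (S e)"
    by (rule sw_counit_left) (rule lin | simp)+
  finally show ?thesis .
qed

end

end

section \<open>The projection onto integrals\<close>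

context hopf_algebra
begin

lemma convolution_eq:
  "h \<in> carrier H \<Longrightarrow> convolution R H f g h = sw (regular_module R) (\<lambda>a b. f a \<otimes> g b) h"
  by (simp add: convolution_def sweedler_def tensor_lift_def sum_pairs_def)

lemma convolution_closed [simp]:
  assumes "f \<in> carrier (dual R H)" "g \<in> carrier (dual R H)"
  shows "convolution R H f g \<in> carrier (dual R H)"
proof -
  note fg = mod_hom_compose[OF dual_mod_hom[OF assms(1)]] mod_hom_compose[OF dual_mod_hom[OF assms(2)]]
  have "bilinear R H H (regular_module R) (\<lambda>a b. f a \<odot>\<^bsub>regular_module R\<^esub> g b)"
    using fg assms
    by (intro bilinearI module.mod_hom_smult[OF module_regular] module.mod_hom_smult_left[OF module_regular]
      fg mod_hom_id) simp_all
  then have "sw (regular_module R) (\<lambda>a b. f a \<odot>\<^bsub>regular_module R\<^esub> g b) \<in> mod_hom R H (regular_module R)"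
    by (rule sw_mod_hom[OF module_regular])
  moreover have "convolution R H f g = (\<lambda>h\<in>carrier H. sw (regular_module R) (\<lambda>a b. f a \<odot>\<^bsub>regular_module R\<^esub> g b) h)"
    by (simp add: convolution_def sweedler_def tensor_lift_def sum_pairs_def)
  ultimately show ?thesis by (simp only: dual_restrict)
qed

lemma sw_finsum:
  assumes P: "module R P" and "finite J" and h: "h \<in> carrier H"
    and "\<And>j a b. \<lbrakk>j \<in> J; a \<in> carrier H; b \<in> carrier H\<rbrakk> \<Longrightarrow> F j a b \<in> carrier P"
  shows "sw P (\<lambda>a b. \<Oplus>\<^bsub>P\<^esub>j\<in>J. F j a b) h = (\<Oplus>\<^bsub>P\<^esub>j\<in>J. sw P (F j) h)"
  using assms(2,4)
proof (induction J rule: finite_induct)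
  interpret P: module R P by fact
  case empty
  show ?case using sw_hom[OF P P P.mod_hom_zero_map h, of "\<lambda>a b. \<zero>\<^bsub>P\<^esub>"] h by simp
next
  interpret P: module R P by fact
  case (insert k J)
  have "sw P (\<lambda>a b. \<Oplus>\<^bsub>P\<^esub>j\<in>insert k J. F j a b) h = sw P (\<lambda>a b. F k a b \<oplus>\<^bsub>P\<^esub> (\<Oplus>\<^bsub>P\<^esub>j\<in>J. F j a b)) h"
    using insert by (intro sw_eqI h P.finsum_insert) auto
  also have "\<dots> = sw P (F k) h \<oplus>\<^bsub>P\<^esub> (\<Oplus>\<^bsub>P\<^esub>j\<in>J. sw P (F j) h)"
    using insert h by (subst sw_add[OF P]) (auto intro!: P.finsum_in_carrier)
  also have "\<dots> = (\<Oplus>\<^bsub>P\<^esub>j\<in>insert k J. sw P (F j) h)"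
    using insert h by (subst P.finsum_insert) (auto intro!: sw_closed[OF P])
  finally show ?case .
qed

end

section \<open>Contraction of convolution products\<close>

locale fgp_hopf_algebra = hopf_algebra R H + dual_basis R H I e E
  for R (structure) and H (structure) and I e E
begin

text \<open>In the convolution, \<open>E j\<close> sees only the second leg of \<open>w\<close>;
  summing against \<open>e j\<close> rebuilds that leg.\<close>

lemma convolution_expansion:
  assumes P [simp]: "module R P" and f: "f \<in> carrier (dual R H)" and G: "G \<in> mod_hom R H P"
    and w: "w \<in> carrier H"
  shows "(\<Oplus>\<^bsub>P\<^esub>j\<in>I. convolution R H f (E j) w \<odot>\<^bsub>P\<^esub> G (e j)) = sw P (\<lambda>p q. f p \<odot>\<^bsub>P\<^esub> G q) w"
proof -
  interpret P: module R P by fact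
  note [simp] = mod_homD(1)[OF G] f w
  have "(\<Oplus>\<^bsub>P\<^esub>j\<in>I. convolution R H f (E j) w \<odot>\<^bsub>P\<^esub> G (e j))
      = (\<Oplus>\<^bsub>P\<^esub>j\<in>I. sw P (\<lambda>p q. f p \<odot>\<^bsub>P\<^esub> (E j q \<odot>\<^bsub>P\<^esub> G (e j))) w)"
  proof (rule P.finsum_eqI)
    fix j assume [simp]: "j \<in> I"
    have "convolution R H f (E j) w \<odot>\<^bsub>P\<^esub> G (e j) = sw P (\<lambda>p q. (f p \<otimes> E j q) \<odot>\<^bsub>P\<^esub> G (e j)) w"
      by (simp only: convolution_eq w, rule sw_hom, simp_all)
        (intro P.mod_hom_smult_left mod_hom_id, simp)
    then show "convolution R H f (E j) w \<odot>\<^bsub>P\<^esub> G (e j) = sw P (\<lambda>p q. f p \<odot>\<^bsub>P\<^esub> (E j q \<odot>\<^bsub>P\<^esub> G (e j))) w"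
      by (simp add: P.smult_assoc1)
  qed simp
  also have "\<dots> = sw P (\<lambda>p q. \<Oplus>\<^bsub>P\<^esub>j\<in>I. f p \<odot>\<^bsub>P\<^esub> (E j q \<odot>\<^bsub>P\<^esub> G (e j))) w"
    by (rule sw_finsum[symmetric]) (simp_all add: finite_I)
  also have "\<dots> = sw P (\<lambda>p q. f p \<odot>\<^bsub>P\<^esub> G q) w"
  proof (rule sw_eqI)
    fix p q assume [simp]: "p \<in> carrier H" "q \<in> carrier H"
    have "(\<Oplus>\<^bsub>P\<^esub>j\<in>I. f p \<odot>\<^bsub>P\<^esub> (E j q \<odot>\<^bsub>P\<^esub> G (e j))) = f p \<odot>\<^bsub>P\<^esub> (\<Oplus>\<^bsub>P\<^esub>j\<in>I. E j q \<odot>\<^bsub>P\<^esub> G (e j))"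
      by (rule P.finsum_smult_ldistr[symmetric]) (auto simp: finite_I)
    then show "(\<Oplus>\<^bsub>P\<^esub>j\<in>I. f p \<odot>\<^bsub>P\<^esub> (E j q \<odot>\<^bsub>P\<^esub> G (e j))) = f p \<odot>\<^bsub>P\<^esub> G q"
      by (simp add: hom_expansion[OF P G])
  qed simp
  finally show ?thesis .
qed

text \<open>Comultiplication on \<open>H\<close> is dual to convolution on the dual of \<open>H\<close>.\<close>

lemma contraction_comult:
  assumes P [simp]: "module R P"
    and \<Psi>1: "\<And>i. i \<in> I \<Longrightarrow> bilinear R H H P (\<lambda>c d. \<Psi> c d (E i))"
    and \<Psi>2: "\<And>c d. \<lbrakk>c \<in> carrier H; d \<in> carrier H\<rbrakk> \<Longrightarrow> \<Psi> c d \<in> mod_hom R (dual R H) P"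
  shows "(\<Oplus>\<^bsub>P\<^esub>i\<in>I. sw P (\<lambda>c d. \<Psi> c d (E i)) (e i))
    = (\<Oplus>\<^bsub>P\<^esub>i\<in>I. \<Oplus>\<^bsub>P\<^esub>j\<in>I. \<Psi> (e i) (e j) (convolution R H (E i) (E j)))"
proof -
  interpret P: module R P by fact
  note [simp] = mod_homD(1)[OF \<Psi>2]
  \<comment> \<open>Expand E_i * E_j in the dual basis, with its values at e_l as coefficients. With
    l outermost, summing over j and then over i rebuilds the second and the first leg of the
    coproduct of e_l.\<close>
  have "(\<Oplus>\<^bsub>P\<^esub>i\<in>I. \<Oplus>\<^bsub>P\<^esub>j\<in>I. \<Psi> (e i) (e j) (convolution R H (E i) (E j)))
      = (\<Oplus>\<^bsub>P\<^esub>i\<in>I. \<Oplus>\<^bsub>P\<^esub>j\<in>I. \<Oplus>\<^bsub>P\<^esub>l\<in>I. convolution R H (E i) (E j) (e l) \<odot>\<^bsub>P\<^esub> \<Psi> (e i) (e j) (E l))"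
    by (intro P.finsum_eqI dual_hom_expansion[symmetric] \<Psi>2)
      (auto intro!: P.finsum_in_carrier)
  also have "\<dots> = (\<Oplus>\<^bsub>P\<^esub>i\<in>I. \<Oplus>\<^bsub>P\<^esub>l\<in>I. \<Oplus>\<^bsub>P\<^esub>j\<in>I. convolution R H (E i) (E j) (e l) \<odot>\<^bsub>P\<^esub> \<Psi> (e i) (e j) (E l))"
    by (intro P.finsum_eqI P.finsum_swap finite_I P.finsum_in_carrier) simp_all
  also have "\<dots> = (\<Oplus>\<^bsub>P\<^esub>l\<in>I. \<Oplus>\<^bsub>P\<^esub>i\<in>I. \<Oplus>\<^bsub>P\<^esub>j\<in>I. convolution R H (E i) (E j) (e l) \<odot>\<^bsub>P\<^esub> \<Psi> (e i) (e j) (E l))"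
    by (intro P.finsum_swap finite_I P.finsum_in_carrier) simp_all
  also have "\<dots> = (\<Oplus>\<^bsub>P\<^esub>l\<in>I. sw P (\<lambda>c d. \<Psi> c d (E l)) (e l))"
  proof (rule P.finsum_eqI)
    fix l assume [simp]: "l \<in> I"
    have "(\<Oplus>\<^bsub>P\<^esub>i\<in>I. \<Oplus>\<^bsub>P\<^esub>j\<in>I. convolution R H (E i) (E j) (e l) \<odot>\<^bsub>P\<^esub> \<Psi> (e i) (e j) (E l))
        = (\<Oplus>\<^bsub>P\<^esub>i\<in>I. sw P (\<lambda>c d. E i c \<odot>\<^bsub>P\<^esub> \<Psi> (e i) d (E l)) (e l))"
      by (intro P.finsum_eqI convolution_expansion bilinearD(1)[OF \<Psi>1]) simp_all
    also have "\<dots> = sw P (\<lambda>c d. \<Oplus>\<^bsub>P\<^esub>i\<in>I. E i c \<odot>\<^bsub>P\<^esub> \<Psi> (e i) d (E l)) (e l)"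
      by (rule sw_finsum[symmetric]) (simp_all add: finite_I)
    also have "\<dots> = sw P (\<lambda>c d. \<Psi> c d (E l)) (e l)"
      by (intro sw_eqI hom_expansion bilinearD(2)[OF \<Psi>1]) simp_all
    finally show "(\<Oplus>\<^bsub>P\<^esub>i\<in>I. \<Oplus>\<^bsub>P\<^esub>j\<in>I. convolution R H (E i) (E j) (e l) \<odot>\<^bsub>P\<^esub> \<Psi> (e i) (e j) (E l))
        = sw P (\<lambda>c d. \<Psi> c d (E l)) (e l)" .
  qed simp
  finally show ?thesis ..
qed

end

section \<open>Construction and invariance of \<open>T\<close>\<close>

context hopf_algebra
begin

lemmas dual_compose = mod_hom_compose[OF dual_mod_hom]

text \<open>The common shape f(S(z_1)) z_2 of the summands of \<open>T\<close>. Keeping functional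
  and element as separate arguments lets cyclicity move operators between them.\<close>

definition slice where "slice z f = sw H (\<lambda>a b. f (S a) \<odot>\<^bsub>H\<^esub> b) z"

lemma slice_closed [simp]: "\<lbrakk>z \<in> carrier H; f \<in> carrier (dual R H)\<rbrakk> \<Longrightarrow> slice z f \<in> carrier H"
  by (simp add: slice_def)

lemma slice_mod_hom1:
  assumes f: "f \<in> carrier (dual R H)" and g: "g \<in> mod_hom R L H"
  shows "(\<lambda>x. slice (g x) f) \<in> mod_hom R L H"
proof -
  note [lin] = dual_compose[OF f] g
  note [simp] = f
  show ?thesis unfolding slice_def by (rule lin | simp)+
qed

lemma slice_mod_hom2 [lin]: "z \<in> carrier H \<Longrightarrow> slice z \<in> mod_hom R (dual R H) H"
  unfolding slice_def[abs_def] by (rule lin | simp)+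

lemma slice_hom:
  assumes "module R P" and \<gamma>: "\<gamma> \<in> mod_hom R H P" and "z \<in> carrier H" "f \<in> carrier (dual R H)"
  shows "\<gamma> (slice z f) = sw P (\<lambda>a b. f (S a) \<odot>\<^bsub>P\<^esub> \<gamma> b) z"
  unfolding slice_def using assms mod_homD(3)[OF \<gamma>] by (subst sw_hom[OF _ _ \<gamma>]) simp_all

text \<open>Since S reverses products, the right side is f(y_1 S(y_2) S(z_1)) z_2 y_3, and y_1
  S(y_2) cancels.\<close>

lemma slice_mult:
  assumes z: "z \<in> carrier H" and f: "f \<in> carrier (dual R H)" and y: "y \<in> carrier H"
  shows "slice z f \<otimes>\<^bsub>H\<^esub> y = sw H (\<lambda>y1 y2. slice (z \<otimes>\<^bsub>H\<^esub> y2) (\<lambda>w\<in>carrier H. f (y1 \<otimes>\<^bsub>H\<^esub> w))) y"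
proof -
  note [simp] = z f y
  note [lin] = dual_compose[OF f]
  let ?G = "\<lambda>a b c d y1. f ((y1 \<otimes>\<^bsub>H\<^esub> S c) \<otimes>\<^bsub>H\<^esub> S a) \<odot>\<^bsub>H\<^esub> (b \<otimes>\<^bsub>H\<^esub> d)"
  have "sw H (\<lambda>y1 y2. slice (z \<otimes>\<^bsub>H\<^esub> y2) (\<lambda>w\<in>carrier H. f (y1 \<otimes>\<^bsub>H\<^esub> w))) y
      = sw H (\<lambda>y1 y2. sw H (\<lambda>a b. sw H (\<lambda>c d. ?G a b c d y1) y2) z) y"
  proof (rule sw_eqI)
    fix y1 y2 assume [simp]: "y1 \<in> carrier H" "y2 \<in> carrier H"
    have "slice (z \<otimes>\<^bsub>H\<^esub> y2) (\<lambda>w\<in>carrier H. f (y1 \<otimes>\<^bsub>H\<^esub> w)) = sw H (\<lambda>a b. f (y1 \<otimes>\<^bsub>H\<^esub> S a) \<odot>\<^bsub>H\<^esub> b) (z \<otimes>\<^bsub>H\<^esub> y2)"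
      unfolding slice_def by (rule sw_eqI) simp_all
    also have "\<dots> = sw H (\<lambda>a b. sw H (\<lambda>c d. f (y1 \<otimes>\<^bsub>H\<^esub> S (a \<otimes>\<^bsub>H\<^esub> c)) \<odot>\<^bsub>H\<^esub> (b \<otimes>\<^bsub>H\<^esub> d)) y2) z"
      by (rule sw_mult) (rule lin | simp)+
    also have "\<dots> = sw H (\<lambda>a b. sw H (\<lambda>c d. ?G a b c d y1) y2) z"
      by (intro sw_eqI) (simp_all add: S_mult H.m_assoc)
    finally show "slice (z \<otimes>\<^bsub>H\<^esub> y2) (\<lambda>w\<in>carrier H. f (y1 \<otimes>\<^bsub>H\<^esub> w)) = sw H (\<lambda>a b. sw H (\<lambda>c d. ?G a b c d y1) y2) z" .
  qed simp
  also have "\<dots> = sw H (\<lambda>a b. sw H (\<lambda>y1 y2. sw H (\<lambda>c d. ?G a b c d y1) y2) y) z"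
    by (rule sw_commute) simp_all
  also have "\<dots> = sw H (\<lambda>a b. f (S a) \<odot>\<^bsub>H\<^esub> (b \<otimes>\<^bsub>H\<^esub> y)) z"
  proof (rule sw_eqI)
    fix a b assume [simp]: "a \<in> carrier H" "b \<in> carrier H"
    have "sw H (\<lambda>y1 y2. sw H (\<lambda>c d. ?G a b c d y1) y2) y = sw H (\<lambda>y' d. sw H (\<lambda>y1 c. ?G a b c d y1) y') y"
      by (rule sw_coassoc[symmetric]) (rule lin | simp)+
    also have "\<dots> = sw H (\<lambda>y' d. \<epsilon> y' \<odot>\<^bsub>H\<^esub> (f (\<one>\<^bsub>H\<^esub> \<otimes>\<^bsub>H\<^esub> S a) \<odot>\<^bsub>H\<^esub> (b \<otimes>\<^bsub>H\<^esub> d))) y"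
      by (intro sw_eqI sw_antipode_right y) (rule lin | simp)+
    also have "\<dots> = f (\<one>\<^bsub>H\<^esub> \<otimes>\<^bsub>H\<^esub> S a) \<odot>\<^bsub>H\<^esub> (b \<otimes>\<^bsub>H\<^esub> y)"
      by (rule sw_counit_left) (rule lin | simp)+
    finally show "sw H (\<lambda>y1 y2. sw H (\<lambda>c d. ?G a b c d y1) y2) y = f (S a) \<odot>\<^bsub>H\<^esub> (b \<otimes>\<^bsub>H\<^esub> y)" by simp
  qed simp
  also have "\<dots> = slice z f \<otimes>\<^bsub>H\<^esub> y"
    by (subst slice_hom[of H "\<lambda>w. w \<otimes>\<^bsub>H\<^esub> y"]) (rule lin | simp)+
  finally show ?thesis ..
qed

end

context fgp_hopf_algebra
begin

definition T where "T x = (\<Oplus>\<^bsub>H\<^esub>i\<in>I. slice (x \<otimes>\<^bsub>H\<^esub> S (e i)) (E i))"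

lemmas slice_E_mod_hom [lin] = slice_mod_hom1[OF E_dual]

lemma T_closed [simp]: "x \<in> carrier H \<Longrightarrow> T x \<in> carrier H"
  unfolding T_def by (rule finsum_in_carrier) simp

lemma T_mod_hom: "T \<in> mod_hom R H H"
  unfolding T_def[abs_def] by (intro mod_hom_finsum_body finite_I) (rule lin | simp)+

lemma hom_T:
  assumes P: "module R P" and \<gamma>: "\<gamma> \<in> mod_hom R H P" and x: "x \<in> carrier H"
  shows "\<gamma> (T x) = (\<Oplus>\<^bsub>P\<^esub>i\<in>I. sw P (\<lambda>a b. E i (S a) \<odot>\<^bsub>P\<^esub> \<gamma> b) (x \<otimes>\<^bsub>H\<^esub> S (e i)))"
proof -
  interpret P: module R P by fact
  have "\<gamma> (T x) = (\<Oplus>\<^bsub>P\<^esub>i\<in>I. \<gamma> (slice (x \<otimes>\<^bsub>H\<^esub> S (e i)) (E i)))"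
    unfolding T_def using x by (intro mod_hom_finsum[OF _ _ \<gamma>] finite_I) auto
  also have "\<dots> = (\<Oplus>\<^bsub>P\<^esub>i\<in>I. sw P (\<lambda>a b. E i (S a) \<odot>\<^bsub>P\<^esub> \<gamma> b) (x \<otimes>\<^bsub>H\<^esub> S (e i)))"
    using x mod_homD(1)[OF \<gamma>] by (intro P.finsum_eqI slice_hom[OF P \<gamma>]) (auto intro!: sw_closed[OF P])
  finally show ?thesis .
qed

text \<open>Use \<open>slice_mult\<close> to bring \<open>y\<close> inside: y_1 then acts on the
  functional E_i and y_2 on the element. Cyclicity turns e_i into y_1 e_i, so the element becomes x
  S(e_i) S(y_1) y_2, and the antipode law removes \<open>y\<close>.\<close>

lemma T_mult:
  assumes x: "x \<in> carrier H" and y: "y \<in> carrier H"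
  shows "T x \<otimes>\<^bsub>H\<^esub> y = \<epsilon> y \<odot>\<^bsub>H\<^esub> T x"
proof -
  note [simp] = x y
  have m [simp]: "(\<lambda>w\<in>carrier H. E i (y1 \<otimes>\<^bsub>H\<^esub> w)) \<in> carrier (dual R H)"
    if "i \<in> I" "y1 \<in> carrier H" for i y1
    using that by (intro dual_compose_closed E_dual) (rule lin | simp)+
  have "T x \<otimes>\<^bsub>H\<^esub> y = (\<Oplus>\<^bsub>H\<^esub>i\<in>I. slice (x \<otimes>\<^bsub>H\<^esub> S (e i)) (E i) \<otimes>\<^bsub>H\<^esub> y)"
    unfolding T_def by (rule mod_hom_finsum[where R=R and f="\<lambda>w. w \<otimes>\<^bsub>H\<^esub> y"]) (rule lin | simp add: finite_I)+
  also have "\<dots> = (\<Oplus>\<^bsub>H\<^esub>i\<in>I. sw H (\<lambda>y1 y2.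
      slice ((x \<otimes>\<^bsub>H\<^esub> S (e i)) \<otimes>\<^bsub>H\<^esub> y2) (\<lambda>w\<in>carrier H. E i (y1 \<otimes>\<^bsub>H\<^esub> w))) y)"
    by (intro finsum_eqI slice_mult) simp_all
  also have "\<dots> = sw H (\<lambda>y1 y2. \<Oplus>\<^bsub>H\<^esub>i\<in>I.
      slice ((x \<otimes>\<^bsub>H\<^esub> S (e i)) \<otimes>\<^bsub>H\<^esub> y2) (\<lambda>w\<in>carrier H. E i (y1 \<otimes>\<^bsub>H\<^esub> w))) y"
    by (rule sw_finsum[symmetric]) (simp_all add: finite_I)
  \<comment> \<open>The operator moved by cyclicity is left multiplication by
    \<open>y1\<close>.\<close>
  also have "\<dots> = sw H (\<lambda>y1 y2. \<Oplus>\<^bsub>H\<^esub>i\<in>I. slice ((x \<otimes>\<^bsub>H\<^esub> S (y1 \<otimes>\<^bsub>H\<^esub> e i)) \<otimes>\<^bsub>H\<^esub> y2) (E i)) y"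
    by (intro sw_eqI contraction_cyclic[symmetric, where L="\<lambda>w. _ \<otimes>\<^bsub>H\<^esub> w"]) (rule lin | simp)+
  also have "\<dots> = sw H (\<lambda>y1 y2. \<Oplus>\<^bsub>H\<^esub>i\<in>I. slice ((x \<otimes>\<^bsub>H\<^esub> S (e i)) \<otimes>\<^bsub>H\<^esub> (S y1 \<otimes>\<^bsub>H\<^esub> y2)) (E i)) y"
    by (intro sw_eqI finsum_eqI) (simp_all add: S_mult H.m_assoc)
  also have "\<dots> = (\<Oplus>\<^bsub>H\<^esub>i\<in>I. sw H (\<lambda>y1 y2. slice ((x \<otimes>\<^bsub>H\<^esub> S (e i)) \<otimes>\<^bsub>H\<^esub> (S y1 \<otimes>\<^bsub>H\<^esub> y2)) (E i)) y)"
    by (rule sw_finsum) (simp_all add: finite_I)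
  also have "\<dots> = (\<Oplus>\<^bsub>H\<^esub>i\<in>I. \<epsilon> y \<odot>\<^bsub>H\<^esub> slice ((x \<otimes>\<^bsub>H\<^esub> S (e i)) \<otimes>\<^bsub>H\<^esub> \<one>\<^bsub>H\<^esub>) (E i))"
    by (intro finsum_eqI sw_antipode_left) (rule lin | simp)+
  also have "\<dots> = \<epsilon> y \<odot>\<^bsub>H\<^esub> T x"
    unfolding T_def by (subst finsum_smult_ldistr) (auto simp: finite_I intro!: finsum_eqI)
  finally show ?thesis .
qed

text \<open>Here x_1 is to be removed from the left factor. The factor 1 \<otimes> S(e_i) is
  inflated until x_1 becomes the first leg of z = x S(e_i) again, followed by a factor that
  contraction identifies as S(z_2)_2; then z_1 S(z_2)_2 cancels.\<close>

lemma comult_T: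
  assumes P [simp]: "module R P" and \<beta>: "bilinear R H H P \<beta>" and x: "x \<in> carrier H"
  shows "sw P (\<lambda>a b. \<beta> a (T b)) x = \<beta> \<one>\<^bsub>H\<^esub> (T x)"
proof -
  interpret P: module R P by fact
  note [simp] = x bilinearD(3)[OF \<beta>]
  note [lin] = bilinear_compose[OF \<beta>]
  \<comment> \<open>\<open>m\<close> and \<open>n\<close> are slots for a tensor multiplied onto the
    coproduct of x. It starts as 1 \<otimes> S(e_i), which \<open>sw_S_cancel_left\<close> rewrites
    as S(c)_1 d \<otimes> S(c)_2, with c and d the legs of e_i. In \<open>?\<Psi>\<close> the
    factors x and S(c) are merged into one coproduct, and d stays outside.\<close>
  let ?\<delta> = "\<lambda>i x1 x2 m n. sw P (\<lambda>a b. E i (S a) \<odot>\<^bsub>P\<^esub> \<beta> (x1 \<otimes>\<^bsub>H\<^esub> m) b) (x2 \<otimes>\<^bsub>H\<^esub> n)"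
  let ?\<Psi> = "\<lambda>c d f. sw P (\<lambda>u v. sw P (\<lambda>a b. f (S a) \<odot>\<^bsub>P\<^esub> \<beta> (u \<otimes>\<^bsub>H\<^esub> d) b) v) (x \<otimes>\<^bsub>H\<^esub> S c)"
  have "sw P (\<lambda>a b. \<beta> a (T b)) x = sw P (\<lambda>x1 x2. \<Oplus>\<^bsub>P\<^esub>i\<in>I. ?\<delta> i x1 x2 \<one>\<^bsub>H\<^esub> (S (e i))) x"
  proof (rule sw_eqI)
    fix x1 x2 assume [simp]: "x1 \<in> carrier H" "x2 \<in> carrier H"
    have "\<beta> x1 (T x2) = (\<Oplus>\<^bsub>P\<^esub>i\<in>I. sw P (\<lambda>a b. E i (S a) \<odot>\<^bsub>P\<^esub> \<beta> x1 b) (x2 \<otimes>\<^bsub>H\<^esub> S (e i)))"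
      by (rule hom_T[OF P bilinearD(1)[OF \<beta>]]) simp_all
    also have "\<dots> = (\<Oplus>\<^bsub>P\<^esub>i\<in>I. ?\<delta> i x1 x2 \<one>\<^bsub>H\<^esub> (S (e i)))"
      by (rule P.finsum_eqI) simp_all
    finally show "\<beta> x1 (T x2) = (\<Oplus>\<^bsub>P\<^esub>i\<in>I. ?\<delta> i x1 x2 \<one>\<^bsub>H\<^esub> (S (e i)))" .
  qed simp
  also have "\<dots> = (\<Oplus>\<^bsub>P\<^esub>i\<in>I. sw P (\<lambda>x1 x2. ?\<delta> i x1 x2 \<one>\<^bsub>H\<^esub> (S (e i))) x)"
    by (rule sw_finsum) (simp_all add: finite_I)
  also have "\<dots> = (\<Oplus>\<^bsub>P\<^esub>i\<in>I. sw P (\<lambda>c d. ?\<Psi> c d (E i)) (e i))"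
  proof (rule P.finsum_eqI)
    fix i assume [simp]: "i \<in> I"
    have "sw P (\<lambda>x1 x2. ?\<delta> i x1 x2 \<one>\<^bsub>H\<^esub> (S (e i))) x
        = sw P (\<lambda>x1 x2. sw P (\<lambda>c d. sw P (\<lambda>p q. ?\<delta> i x1 x2 (p \<otimes>\<^bsub>H\<^esub> d) q) (S c)) (e i)) x"
      by (intro sw_eqI sw_S_cancel_left[symmetric] x) (rule lin | simp)+
    also have "\<dots> = sw P (\<lambda>c d. sw P (\<lambda>x1 x2. sw P (\<lambda>p q. ?\<delta> i x1 x2 (p \<otimes>\<^bsub>H\<^esub> d) q) (S c)) x) (e i)"
      by (rule sw_commute) simp_all
    also have "\<dots> = sw P (\<lambda>c d. ?\<Psi> c d (E i)) (e i)"
    proof (rule sw_eqI)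
      fix c d assume [simp]: "c \<in> carrier H" "d \<in> carrier H"
      have "?\<Psi> c d (E i) = sw P (\<lambda>x1 x2. sw P (\<lambda>p q.
          sw P (\<lambda>a b. E i (S a) \<odot>\<^bsub>P\<^esub> \<beta> ((x1 \<otimes>\<^bsub>H\<^esub> p) \<otimes>\<^bsub>H\<^esub> d) b) (x2 \<otimes>\<^bsub>H\<^esub> q)) (S c)) x"
        by (rule sw_mult) (rule lin | simp)+
      then show "sw P (\<lambda>x1 x2. sw P (\<lambda>p q. ?\<delta> i x1 x2 (p \<otimes>\<^bsub>H\<^esub> d) q) (S c)) x = ?\<Psi> c d (E i)"
        by (simp add: H.m_assoc)
    qed simp
    finally show "sw P (\<lambda>x1 x2. ?\<delta> i x1 x2 \<one>\<^bsub>H\<^esub> (S (e i))) x = sw P (\<lambda>c d. ?\<Psi> c d (E i)) (e i)" .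
  qed simp
  \<comment> \<open>The legs of e_i are traded for two independent basis vectors e_i, e_j and the
    functional E_i * E_j, so that e_j can be contracted separately.\<close>
  also have "\<dots> = (\<Oplus>\<^bsub>P\<^esub>i\<in>I. \<Oplus>\<^bsub>P\<^esub>j\<in>I. ?\<Psi> (e i) (e j) (convolution R H (E i) (E j)))"
    by (rule contraction_comult) (rule lin | simp)+
  also have "\<dots> = (\<Oplus>\<^bsub>P\<^esub>i\<in>I. sw P (\<lambda>m b. E i (S m) \<odot>\<^bsub>P\<^esub> \<beta> \<one>\<^bsub>H\<^esub> b) (x \<otimes>\<^bsub>H\<^esub> S (e i)))"
  proof (rule P.finsum_eqI)
    fix i assume [simp]: "i \<in> I"
    let ?z = "x \<otimes>\<^bsub>H\<^esub> S (e i)"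
    let ?A = "\<lambda>j u a b. convolution R H (E i) (E j) (S a) \<odot>\<^bsub>P\<^esub> \<beta> (u \<otimes>\<^bsub>H\<^esub> e j) b"
    let ?B = "\<lambda>u a b. sw P (\<lambda>p q. E i p \<odot>\<^bsub>P\<^esub> \<beta> (u \<otimes>\<^bsub>H\<^esub> q) b) (S a)"
    have "(\<Oplus>\<^bsub>P\<^esub>j\<in>I. ?\<Psi> (e i) (e j) (convolution R H (E i) (E j)))
        = sw P (\<lambda>u v. \<Oplus>\<^bsub>P\<^esub>j\<in>I. sw P (\<lambda>a b. ?A j u a b) v) ?z"
      by (rule sw_finsum[symmetric]) (simp_all add: finite_I)
    also have "\<dots> = sw P (\<lambda>u v. sw P (\<lambda>a b. \<Oplus>\<^bsub>P\<^esub>j\<in>I. ?A j u a b) v) ?z"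
      by (intro sw_eqI sw_finsum[symmetric]) (simp_all add: finite_I)
    \<comment> \<open>Summing over j replaces e_j by the second leg of S(v_1), while E_i keeps the
      first. Coassociativity then regroups u with v_1 as the two legs of one element, as
      \<open>sw_S_cancel_right\<close> requires.\<close>
    also have "\<dots> = sw P (\<lambda>u v. sw P (\<lambda>a b. ?B u a b) v) ?z"
      by (rule sw_eqI, simp, rule sw_eqI, simp, rule convolution_expansion) (rule lin | simp)+
    also have "\<dots> = sw P (\<lambda>m b. sw P (\<lambda>u a. ?B u a b) m) ?z"
      by (rule sw_coassoc[symmetric]) (rule lin | simp)+
    also have "\<dots> = sw P (\<lambda>m b. E i (S m) \<odot>\<^bsub>P\<^esub> \<beta> \<one>\<^bsub>H\<^esub> b) ?z"
      by (rule sw_eqI, simp, rule sw_S_cancel_right[where \<beta>="\<lambda>u p. E i p \<odot>\<^bsub>P\<^esub> \<beta> u _"]) (rule lin | simp)+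
    finally show "(\<Oplus>\<^bsub>P\<^esub>j\<in>I. ?\<Psi> (e i) (e j) (convolution R H (E i) (E j)))
        = sw P (\<lambda>m b. E i (S m) \<odot>\<^bsub>P\<^esub> \<beta> \<one>\<^bsub>H\<^esub> b) ?z" .
  qed simp
  also have "\<dots> = \<beta> \<one>\<^bsub>H\<^esub> (T x)"
    by (rule hom_T[symmetric, OF P bilinearD(1)[OF \<beta>]]) simp_all
  finally show ?thesis .
qed

end

section \<open>Integrals\<close>

lemma left_integrals_simps [simp]:
  "add (left_integrals H) = add H" "zero (left_integrals H) = zero H" "smult (left_integrals H) = smult H"
  "t \<in> carrier (left_integrals H) \<longleftrightarrow>
    t \<in> carrier H \<and> (\<forall>h\<in>carrier H. h \<otimes>\<^bsub>H\<^esub> t = counit H h \<odot>\<^bsub>H\<^esub> t)"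
  by (simp_all add: left_integrals_def)

lemma right_integrals_simps [simp]:
  "add (right_integrals H) = add H" "zero (right_integrals H) = zero H" "smult (right_integrals H) = smult H"
  "t \<in> carrier (right_integrals H) \<longleftrightarrow>
    t \<in> carrier H \<and> (\<forall>h\<in>carrier H. t \<otimes>\<^bsub>H\<^esub> h = counit H h \<odot>\<^bsub>H\<^esub> t)"
  by (simp_all add: right_integrals_def)

lemma dual_integrals_simps [simp]:
  "add (left_dual_integrals R H) = add (dual R H)" "smult (left_dual_integrals R H) = smult (dual R H)"
  "add (right_dual_integrals R H) = add (dual R H)" "smult (right_dual_integrals R H) = smult (dual R H)"
  by (simp_all add: left_dual_integrals_def right_dual_integrals_def)

section \<open>Integrals in terms of Sweedler sums\<close>

context hopf_algebra
begin

lemma sw_regular_closed [simp]: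
  assumes "\<And>a b. \<lbrakk>a \<in> carrier H; b \<in> carrier H\<rbrakk> \<Longrightarrow> \<beta> a b \<in> carrier R" "h \<in> carrier H"
  shows "sw (regular_module R) \<beta> h \<in> carrier R"
  using sw_closed[OF module_regular _ assms(2), of \<beta>] assms(1) by simp

text \<open>Comultiply the defining equation t y = \<epsilon>(y) t.\<close>

lemma right_integral_comult:
  assumes t: "t \<in> carrier (right_integrals H)" and P: "module R P" and \<beta>: "bilinear R H H P \<beta>"
    and y: "y \<in> carrier H"
  shows "sw P (\<lambda>a b. sw P (\<lambda>c d. \<beta> (a \<otimes>\<^bsub>H\<^esub> c) (b \<otimes>\<^bsub>H\<^esub> d)) y) t = \<epsilon> y \<odot>\<^bsub>P\<^esub> sw P \<beta> t"
proof -
  have "sw P (\<lambda>a b. sw P (\<lambda>c d. \<beta> (a \<otimes>\<^bsub>H\<^esub> c) (b \<otimes>\<^bsub>H\<^esub> d)) y) t = sw P \<beta> (t \<otimes>\<^bsub>H\<^esub> y)"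
    by (rule sw_mult[OF P \<beta>, symmetric]) (use t y in simp_all)
  also have "\<dots> = \<epsilon> y \<odot>\<^bsub>P\<^esub> sw P \<beta> t"
    using t y mod_homD(3)[OF sw_mod_hom[OF P \<beta>]] by simp
  finally show ?thesis .
qed

end

context fgp_hopf_algebra
begin

text \<open>The coordinates of an element are values of functionals, and they determine it.\<close>

lemma separating:
  assumes "u \<in> carrier H" "v \<in> carrier H" "\<And>f. f \<in> carrier (dual R H) \<Longrightarrow> f u = f v"
  shows "u = v"
proof -
  have "(\<Oplus>\<^bsub>H\<^esub>i\<in>I. E i u \<odot>\<^bsub>H\<^esub> e i) = (\<Oplus>\<^bsub>H\<^esub>i\<in>I. E i v \<odot>\<^bsub>H\<^esub> e i)"
    using assms(1,2) by (intro finsum_eqI) (simp_all add: assms(3)[OF E_dual])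
  then show ?thesis using expansion[OF assms(1)] expansion[OF assms(2)] by simp
qed

text \<open>Functionals separate points, so the condition over all \<open>f\<close> can be stripped
  of \<open>f\<close>. The resulting identity lives in \<open>H\<close> and can be pushed through
  any linear map, as in \<open>left_dual_integral_sw\<close>.\<close>

lemma left_dual_integral_iff:
  "\<phi> \<in> carrier (left_dual_integrals R H) \<longleftrightarrow>
    \<phi> \<in> carrier (dual R H) \<and> (\<forall>x\<in>carrier H. sw H (\<lambda>a b. \<phi> b \<odot>\<^bsub>H\<^esub> a) x = \<phi> x \<odot>\<^bsub>H\<^esub> \<one>\<^bsub>H\<^esub>)"
proof (cases "\<phi> \<in> carrier (dual R H)")
  case [simp]: True
  have conv: "convolution R H f \<phi> x = f (sw H (\<lambda>a b. \<phi> b \<odot>\<^bsub>H\<^esub> a) x)"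
    if "f \<in> carrier (dual R H)" "x \<in> carrier H" for f x
  proof -
    have "f (sw H (\<lambda>a b. \<phi> b \<odot>\<^bsub>H\<^esub> a) x) = sw (regular_module R) (\<lambda>a b. f (\<phi> b \<odot>\<^bsub>H\<^esub> a)) x"
      using that by (intro sw_hom[OF _ _ dual_mod_hom]) simp_all
    also have "\<dots> = convolution R H f \<phi> x"
      using that mod_homD(3)[OF dual_mod_hom[OF that(1)]] by (simp add: convolution_eq R.m_comm)
    finally show ?thesis ..
  qed
  have one: "f (\<phi> x \<odot>\<^bsub>H\<^esub> \<one>\<^bsub>H\<^esub>) = (f \<one>\<^bsub>H\<^esub> \<odot>\<^bsub>dual R H\<^esub> \<phi>) x"
    if "f \<in> carrier (dual R H)" "x \<in> carrier H" for f x
    using that mod_homD(3)[OF dual_mod_hom[OF that(1)]] by (simp add: dual_simps R.m_comm)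
  have "(\<forall>f\<in>carrier (dual R H). convolution R H f \<phi> = f \<one>\<^bsub>H\<^esub> \<odot>\<^bsub>dual R H\<^esub> \<phi>) \<longleftrightarrow>
      (\<forall>x\<in>carrier H. sw H (\<lambda>a b. \<phi> b \<odot>\<^bsub>H\<^esub> a) x = \<phi> x \<odot>\<^bsub>H\<^esub> \<one>\<^bsub>H\<^esub>)"
  proof safe
    fix x assume x: "x \<in> carrier H"
      and *: "\<forall>f\<in>carrier (dual R H). convolution R H f \<phi> = f \<one>\<^bsub>H\<^esub> \<odot>\<^bsub>dual R H\<^esub> \<phi>"
    show "sw H (\<lambda>a b. \<phi> b \<odot>\<^bsub>H\<^esub> a) x = \<phi> x \<odot>\<^bsub>H\<^esub> \<one>\<^bsub>H\<^esub>"
      by (rule separating) (use x * in \<open>simp_all add: conv[symmetric] one\<close>)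
  next
    fix f assume f: "f \<in> carrier (dual R H)"
      and *: "\<forall>x\<in>carrier H. sw H (\<lambda>a b. \<phi> b \<odot>\<^bsub>H\<^esub> a) x = \<phi> x \<odot>\<^bsub>H\<^esub> \<one>\<^bsub>H\<^esub>"
    interpret D: module R "dual R H" by simp
    show "convolution R H f \<phi> = f \<one>\<^bsub>H\<^esub> \<odot>\<^bsub>dual R H\<^esub> \<phi>"
      by (rule dual_eqI) (use f * in \<open>simp_all add: conv one\<close>)
  qed
  then show ?thesis by (simp add: left_dual_integrals_def)
qed (simp add: left_dual_integrals_def)

lemma right_dual_integral_iff:
  "\<phi> \<in> carrier (right_dual_integrals R H) \<longleftrightarrow>
    \<phi> \<in> carrier (dual R H) \<and> (\<forall>x\<in>carrier H. sw H (\<lambda>a b. \<phi> a \<odot>\<^bsub>H\<^esub> b) x = \<phi> x \<odot>\<^bsub>H\<^esub> \<one>\<^bsub>H\<^esub>)"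
proof (cases "\<phi> \<in> carrier (dual R H)")
  case [simp]: True
  have conv: "convolution R H \<phi> f x = f (sw H (\<lambda>a b. \<phi> a \<odot>\<^bsub>H\<^esub> b) x)"
    if "f \<in> carrier (dual R H)" "x \<in> carrier H" for f x
  proof -
    have "f (sw H (\<lambda>a b. \<phi> a \<odot>\<^bsub>H\<^esub> b) x) = sw (regular_module R) (\<lambda>a b. f (\<phi> a \<odot>\<^bsub>H\<^esub> b)) x"
      using that by (intro sw_hom[OF _ _ dual_mod_hom]) simp_all
    also have "\<dots> = convolution R H \<phi> f x"
      using that mod_homD(3)[OF dual_mod_hom[OF that(1)]] by (simp add: convolution_eq)
    finally show ?thesis ..
  qed
  have one: "f (\<phi> x \<odot>\<^bsub>H\<^esub> \<one>\<^bsub>H\<^esub>) = (f \<one>\<^bsub>H\<^esub> \<odot>\<^bsub>dual R H\<^esub> \<phi>) x"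
    if "f \<in> carrier (dual R H)" "x \<in> carrier H" for f x
    using that mod_homD(3)[OF dual_mod_hom[OF that(1)]] by (simp add: dual_simps R.m_comm)
  have "(\<forall>f\<in>carrier (dual R H). convolution R H \<phi> f = f \<one>\<^bsub>H\<^esub> \<odot>\<^bsub>dual R H\<^esub> \<phi>) \<longleftrightarrow>
      (\<forall>x\<in>carrier H. sw H (\<lambda>a b. \<phi> a \<odot>\<^bsub>H\<^esub> b) x = \<phi> x \<odot>\<^bsub>H\<^esub> \<one>\<^bsub>H\<^esub>)"
  proof safe
    fix x assume x: "x \<in> carrier H"
      and *: "\<forall>f\<in>carrier (dual R H). convolution R H \<phi> f = f \<one>\<^bsub>H\<^esub> \<odot>\<^bsub>dual R H\<^esub> \<phi>"
    show "sw H (\<lambda>a b. \<phi> a \<odot>\<^bsub>H\<^esub> b) x = \<phi> x \<odot>\<^bsub>H\<^esub> \<one>\<^bsub>H\<^esub>"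
      by (rule separating) (use x * in \<open>simp_all add: conv[symmetric] one\<close>)
  next
    fix f assume f: "f \<in> carrier (dual R H)"
      and *: "\<forall>x\<in>carrier H. sw H (\<lambda>a b. \<phi> a \<odot>\<^bsub>H\<^esub> b) x = \<phi> x \<odot>\<^bsub>H\<^esub> \<one>\<^bsub>H\<^esub>"
    interpret D: module R "dual R H" by simp
    show "convolution R H \<phi> f = f \<one>\<^bsub>H\<^esub> \<odot>\<^bsub>dual R H\<^esub> \<phi>"
      by (rule dual_eqI) (use f * in \<open>simp_all add: conv one\<close>)
  qed
  then show ?thesis by (simp add: right_dual_integrals_def)
qed (simp add: right_dual_integrals_def)

section \<open>Integrals produced and fixed by \<open>T\<close>\<close>

lemma T_right_integral: "x \<in> carrier H \<Longrightarrow> T x \<in> carrier (right_integrals H)"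
  by (simp add: T_mult)

lemma comp_T_left_dual_integral:
  assumes f: "f \<in> carrier (dual R H)"
  shows "(\<lambda>x\<in>carrier H. f (T x)) \<in> carrier (left_dual_integrals R H)"
proof -
  note [simp] = f
  note [lin] = dual_compose[OF f]
  have "sw H (\<lambda>a b. (\<lambda>x\<in>carrier H. f (T x)) b \<odot>\<^bsub>H\<^esub> a) x = (\<lambda>x\<in>carrier H. f (T x)) x \<odot>\<^bsub>H\<^esub> \<one>\<^bsub>H\<^esub>"
    if [simp]: "x \<in> carrier H" for x
    \<comment> \<open>Invariance of f \<circ> T is \<open>comult_T\<close> for the bilinear map
      sending a and w to f(w) a.\<close>
    using comult_T[of H "\<lambda>a w. f w \<odot>\<^bsub>H\<^esub> a" x, OF module_axiom bilinearI]
    by (simp add: mod_hom_smult mod_hom_smult_left mod_hom_id dual_compose[OF f])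
  then show ?thesis
    using dual_compose_closed[OF f T_mod_hom] by (simp add: left_dual_integral_iff)
qed

text \<open>Because t S(e_i) = \<epsilon>(e_i) t, the sum over i assembles the functional \<Sum>
  \<epsilon>(e_i) E_i = \<epsilon>. What remains is \<epsilon>(S(t_1)) t_2 = t.\<close>

lemma T_right_integral_eq:
  assumes t: "t \<in> carrier (right_integrals H)"
  shows "T t = t"
proof -
  have [simp]: "t \<in> carrier H" and tS: "t \<otimes>\<^bsub>H\<^esub> S (e i) = \<epsilon> (e i) \<odot>\<^bsub>H\<^esub> t" if "i \<in> I" for i
    using t that by simp_all
  have tc [simp]: "t \<in> carrier H" using t by simp
  have \<epsilon>: "restrict \<epsilon> (carrier H) \<in> carrier (dual R H)" by (rule dual_restrict[OF counit_linear])
  have "T t = (\<Oplus>\<^bsub>H\<^esub>i\<in>I. restrict \<epsilon> (carrier H) (e i) \<odot>\<^bsub>H\<^esub> slice t (E i))"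
    unfolding T_def using tS mod_homD(3)[OF slice_mod_hom1[OF E_dual mod_hom_id]]
    by (intro finsum_eqI) simp_all
  also have "\<dots> = slice t (restrict \<epsilon> (carrier H))"
    by (rule dual_hom_expansion[OF _ slice_mod_hom2 \<epsilon>]) simp_all
  also have "\<dots> = sw H (\<lambda>a b. \<epsilon> a \<odot>\<^bsub>H\<^esub> b) t"
    unfolding slice_def by (rule sw_eqI) simp_all
  also have "\<dots> = t" using counit_left[OF tc] by (simp add: sweedler_def)
  finally show ?thesis .
qed

lemma left_dual_integral_sw:
  assumes \<phi>: "\<phi> \<in> carrier (left_dual_integrals R H)" and P: "module R P" and \<gamma>: "\<gamma> \<in> mod_hom R H P"
    and x: "x \<in> carrier H"
  shows "sw P (\<lambda>a b. \<phi> b \<odot>\<^bsub>P\<^esub> \<gamma> a) x = \<phi> x \<odot>\<^bsub>P\<^esub> \<gamma> \<one>\<^bsub>H\<^esub>"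
proof -
  have [simp]: "\<phi> \<in> carrier (dual R H)" and *: "sw H (\<lambda>a b. \<phi> b \<odot>\<^bsub>H\<^esub> a) x = \<phi> x \<odot>\<^bsub>H\<^esub> \<one>\<^bsub>H\<^esub>"
    using \<phi> x by (simp_all add: left_dual_integral_iff)
  have "sw P (\<lambda>a b. \<phi> b \<odot>\<^bsub>P\<^esub> \<gamma> a) x = sw P (\<lambda>a b. \<gamma> (\<phi> b \<odot>\<^bsub>H\<^esub> a)) x"
    by (rule sw_eqI[OF x]) (simp add: mod_homD(3)[OF \<gamma>])
  also have "\<dots> = \<gamma> (sw H (\<lambda>a b. \<phi> b \<odot>\<^bsub>H\<^esub> a) x)"
    by (rule sw_hom[OF module_axiom P \<gamma> x, symmetric]) simp
  finally show ?thesis using x by (simp add: * mod_homD(3)[OF \<gamma>])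
qed

text \<open>Invariance of \<phi> replaces E_i(S(a_1)) \<phi>(a_2) by E_i(1) \<phi>(a), where a = x
  S(e_i). Summing over i then evaluates \<phi>(x S(w)) at w = 1.\<close>

lemma left_dual_integral_T:
  assumes \<phi>: "\<phi> \<in> carrier (left_dual_integrals R H)" and x: "x \<in> carrier H"
  shows "\<phi> (T x) = \<phi> x"
proof -
  let ?k = "regular_module R"
  interpret k: module R ?k by simp
  have [simp]: "\<phi> \<in> carrier (dual R H)" using \<phi> by (simp add: left_dual_integral_iff)
  note [simp] = x
  note [lin] = dual_compose[of \<phi>]
  have "\<phi> (T x) = (\<Oplus>\<^bsub>?k\<^esub>i\<in>I. sw ?k (\<lambda>a b. E i (S a) \<odot>\<^bsub>?k\<^esub> \<phi> b) (x \<otimes>\<^bsub>H\<^esub> S (e i)))"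
    by (rule hom_T[OF _ dual_mod_hom]) simp_all
  also have "\<dots> = (\<Oplus>\<^bsub>?k\<^esub>i\<in>I. E i \<one>\<^bsub>H\<^esub> \<odot>\<^bsub>?k\<^esub> \<phi> (x \<otimes>\<^bsub>H\<^esub> S (e i)))"
  proof (rule k.finsum_eqI)
    fix i assume [simp]: "i \<in> I"
    have "sw ?k (\<lambda>a b. \<phi> b \<odot>\<^bsub>?k\<^esub> E i (S a)) (x \<otimes>\<^bsub>H\<^esub> S (e i))
        = \<phi> (x \<otimes>\<^bsub>H\<^esub> S (e i)) \<odot>\<^bsub>?k\<^esub> E i (S \<one>\<^bsub>H\<^esub>)"
      by (rule left_dual_integral_sw[OF \<phi>]) (rule lin | simp)+
    then show "sw ?k (\<lambda>a b. E i (S a) \<odot>\<^bsub>?k\<^esub> \<phi> b) (x \<otimes>\<^bsub>H\<^esub> S (e i))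
        = E i \<one>\<^bsub>H\<^esub> \<odot>\<^bsub>?k\<^esub> \<phi> (x \<otimes>\<^bsub>H\<^esub> S (e i))"
      by (simp add: R.m_comm)
  qed simp
  also have "\<dots> = \<phi> (x \<otimes>\<^bsub>H\<^esub> S \<one>\<^bsub>H\<^esub>)"
    by (rule hom_expansion[where f="\<lambda>w. \<phi> (x \<otimes>\<^bsub>H\<^esub> S w)"]) (rule lin | simp)+
  finally show ?thesis by simp
qed

text \<open>As S(e_i) S(e_j) = S(e_j e_i), cyclicity in j turns the double sum into \<Sum> (E_j *
  E_i)(S(S(e_j) e_i)). Undoing the convolution gives E_j(S(S(c) d)) with c, d the legs of e_j, and
  S(c) d cancels. The extra S matters: for \<open>T\<close> alone the same computation ends in d
  S(S(c)), to which the antipode law does not apply.\<close>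

lemma trace_T_S: "(\<Oplus>\<^bsub>regular_module R\<^esub>i\<in>I. E i (T (S (e i)))) = \<one>"
proof -
  let ?k = "regular_module R"
  interpret k: module R ?k by simp
  let ?A = "\<lambda>i x f. sw ?k (\<lambda>a b. f a \<odot>\<^bsub>?k\<^esub> E i b) (S (x \<otimes>\<^bsub>H\<^esub> e i))"
  have "(\<Oplus>\<^bsub>?k\<^esub>i\<in>I. E i (T (S (e i)))) = (\<Oplus>\<^bsub>?k\<^esub>i\<in>I. \<Oplus>\<^bsub>?k\<^esub>j\<in>I. ?A i (e j) (\<lambda>w\<in>carrier H. E j (S w)))"
  proof (rule k.finsum_eqI)
    fix i assume [simp]: "i \<in> I"
    have "E i (T (S (e i))) = (\<Oplus>\<^bsub>?k\<^esub>j\<in>I. sw ?k (\<lambda>a b. E j (S a) \<odot>\<^bsub>?k\<^esub> E i b) (S (e i) \<otimes>\<^bsub>H\<^esub> S (e j)))"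
      by (rule hom_T[OF _ dual_mod_hom]) simp_all
    also have "\<dots> = (\<Oplus>\<^bsub>?k\<^esub>j\<in>I. ?A i (e j) (\<lambda>w\<in>carrier H. E j (S w)))"
      by (rule k.finsum_eqI) (simp_all add: S_mult)
    finally show "E i (T (S (e i))) = (\<Oplus>\<^bsub>?k\<^esub>j\<in>I. ?A i (e j) (\<lambda>w\<in>carrier H. E j (S w)))" .
  qed (auto intro!: k.finsum_in_carrier[simplified])
  also have "\<dots> = (\<Oplus>\<^bsub>?k\<^esub>i\<in>I. \<Oplus>\<^bsub>?k\<^esub>j\<in>I. ?A i (S (e j)) (E j))"
  proof (rule k.finsum_eqI)
    fix i assume [simp]: "i \<in> I"
    show "(\<Oplus>\<^bsub>?k\<^esub>j\<in>I. ?A i (e j) (\<lambda>w\<in>carrier H. E j (S w))) = (\<Oplus>\<^bsub>?k\<^esub>j\<in>I. ?A i (S (e j)) (E j))"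
      by (rule contraction_cyclic[symmetric, OF _ antipode_linear]) (rule lin | simp)+
  qed (auto intro!: k.finsum_in_carrier[simplified])
  also have "\<dots> = (\<Oplus>\<^bsub>?k\<^esub>j\<in>I. \<Oplus>\<^bsub>?k\<^esub>i\<in>I. ?A i (S (e j)) (E j))"
    by (rule k.finsum_swap[OF finite_I finite_I]) simp
  also have "\<dots> = (\<Oplus>\<^bsub>?k\<^esub>j\<in>I. \<Oplus>\<^bsub>?k\<^esub>i\<in>I. convolution R H (E j) (E i) (S (S (e j) \<otimes>\<^bsub>H\<^esub> e i)))"
    by (intro k.finsum_eqI) (simp_all add: convolution_eq k.finsum_in_carrier[simplified])
  also have "\<dots> = (\<Oplus>\<^bsub>?k\<^esub>j\<in>I. sw ?k (\<lambda>c d. E j (S (S c \<otimes>\<^bsub>H\<^esub> d))) (e j))"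
    by (rule contraction_comult[symmetric, where \<Psi>="\<lambda>c d f. f (S (S c \<otimes>\<^bsub>H\<^esub> d))"]) (rule lin | simp)+
  also have "\<dots> = (\<Oplus>\<^bsub>?k\<^esub>j\<in>I. \<epsilon> (e j) \<odot>\<^bsub>?k\<^esub> E j (S \<one>\<^bsub>H\<^esub>))"
    by (intro k.finsum_eqI sw_antipode_left) (rule lin | simp)+
  also have "\<dots> = (\<Oplus>\<^bsub>?k\<^esub>j\<in>I. E j \<one>\<^bsub>H\<^esub> \<odot>\<^bsub>?k\<^esub> \<epsilon> (e j))"
    by (rule k.finsum_eqI) (simp_all add: R.m_comm)
  also have "\<dots> = \<epsilon> \<one>\<^bsub>H\<^esub>"
    by (rule hom_expansion[OF _ counit_linear]) simp_all
  finally show ?thesis by simp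
qed

text \<open>Insert \<epsilon>(h_1) and absorb it into the right integral, so that t_1 \<otimes> t_2
  becomes t_1 h_1 \<otimes> t_2 h_2. Then h_2 S(h_3) cancels, and invariance of \<phi> finishes. The
  left side depends on \<open>h\<close> only through S(h), which is what injectivity of S
  needs.\<close>

lemma integral_pairing_left:
  assumes \<phi>: "\<phi> \<in> carrier (left_dual_integrals R H)" and t: "t \<in> carrier (right_integrals H)"
    and h: "h \<in> carrier H"
  shows "sw H (\<lambda>a b. \<phi> (b \<otimes>\<^bsub>H\<^esub> S h) \<odot>\<^bsub>H\<^esub> a) t = \<phi> t \<odot>\<^bsub>H\<^esub> h"
proof -
  have [simp]: "\<phi> \<in> carrier (dual R H)" "t \<in> carrier H"
    using \<phi> t by (simp_all add: left_dual_integral_iff)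
  note [simp] = h
  note [lin] = dual_compose[of \<phi>]
  let ?G = "\<lambda>a b c d y. \<phi> (b \<otimes>\<^bsub>H\<^esub> (d \<otimes>\<^bsub>H\<^esub> S y)) \<odot>\<^bsub>H\<^esub> (a \<otimes>\<^bsub>H\<^esub> c)"
  have "sw H (\<lambda>a b. \<phi> (b \<otimes>\<^bsub>H\<^esub> S h) \<odot>\<^bsub>H\<^esub> a) t
      = sw H (\<lambda>x y. \<epsilon> x \<odot>\<^bsub>H\<^esub> sw H (\<lambda>a b. \<phi> (b \<otimes>\<^bsub>H\<^esub> S y) \<odot>\<^bsub>H\<^esub> a) t) h"
    by (rule sw_counit_left[symmetric]) (rule lin | simp)+
  also have "\<dots> = sw H (\<lambda>x y. sw H (\<lambda>a b. sw H (\<lambda>c d. ?G a b c d y) x) t) h"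
  proof (rule sw_eqI)
    fix x y assume [simp]: "x \<in> carrier H" "y \<in> carrier H"
    have "sw H (\<lambda>a b. sw H (\<lambda>c d. \<phi> ((b \<otimes>\<^bsub>H\<^esub> d) \<otimes>\<^bsub>H\<^esub> S y) \<odot>\<^bsub>H\<^esub> (a \<otimes>\<^bsub>H\<^esub> c)) x) t
        = \<epsilon> x \<odot>\<^bsub>H\<^esub> sw H (\<lambda>a b. \<phi> (b \<otimes>\<^bsub>H\<^esub> S y) \<odot>\<^bsub>H\<^esub> a) t"
      by (rule right_integral_comult[OF t]) (rule lin | simp)+
    then show "\<epsilon> x \<odot>\<^bsub>H\<^esub> sw H (\<lambda>a b. \<phi> (b \<otimes>\<^bsub>H\<^esub> S y) \<odot>\<^bsub>H\<^esub> a) t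
        = sw H (\<lambda>a b. sw H (\<lambda>c d. ?G a b c d y) x) t"
      by (simp add: H.m_assoc)
  qed simp
  also have "\<dots> = sw H (\<lambda>a b. sw H (\<lambda>x y. sw H (\<lambda>c d. ?G a b c d y) x) h) t"
    by (rule sw_commute) simp_all
  also have "\<dots> = sw H (\<lambda>a b. sw H (\<lambda>c x. sw H (\<lambda>d y. ?G a b c d y) x) h) t"
    by (rule sw_eqI, simp, rule sw_coassoc) (rule lin | simp)+
  also have "\<dots> = sw H (\<lambda>a b. sw H (\<lambda>c x. \<epsilon> x \<odot>\<^bsub>H\<^esub> (\<phi> (b \<otimes>\<^bsub>H\<^esub> \<one>\<^bsub>H\<^esub>) \<odot>\<^bsub>H\<^esub> (a \<otimes>\<^bsub>H\<^esub> c))) h) t"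
    by (rule sw_eqI, simp, rule sw_eqI, simp, rule sw_antipode_right) (rule lin | simp)+
  also have "\<dots> = sw H (\<lambda>a b. \<phi> (b \<otimes>\<^bsub>H\<^esub> \<one>\<^bsub>H\<^esub>) \<odot>\<^bsub>H\<^esub> (a \<otimes>\<^bsub>H\<^esub> h)) t"
    by (rule sw_eqI, simp, rule sw_counit_right) (rule lin | simp)+
  also have "\<dots> = sw H (\<lambda>a b. \<phi> b \<odot>\<^bsub>H\<^esub> (a \<otimes>\<^bsub>H\<^esub> h)) t" by simp
  also have "\<dots> = \<phi> t \<odot>\<^bsub>H\<^esub> (\<one>\<^bsub>H\<^esub> \<otimes>\<^bsub>H\<^esub> h)"
    by (rule left_dual_integral_sw[OF \<phi>]) (rule lin | simp)+
  finally show ?thesis by simp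
qed

text \<open>Invariance of \<phi> at t_2 y writes \<phi>(t_2 y) S(t_1) as \<phi>(t_3 y_2) S(t_1) t_2
  y_1. Here S(t_1) t_2 cancels, and t y_2 = \<epsilon>(y_2) t. The left side lies in the image of S,
  which is what surjectivity needs.\<close>

lemma integral_pairing_right:
  assumes \<phi>: "\<phi> \<in> carrier (left_dual_integrals R H)" and t: "t \<in> carrier (right_integrals H)"
    and y: "y \<in> carrier H"
  shows "sw H (\<lambda>a b. \<phi> (b \<otimes>\<^bsub>H\<^esub> y) \<odot>\<^bsub>H\<^esub> S a) t = \<phi> t \<odot>\<^bsub>H\<^esub> y"
proof -
  have [simp]: "\<phi> \<in> carrier (dual R H)" "t \<in> carrier H"
    using \<phi> t by (simp_all add: left_dual_integral_iff)
  note [simp] = y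
  note [lin] = dual_compose[of \<phi>]
  let ?G = "\<lambda>s a b c d. \<phi> (b \<otimes>\<^bsub>H\<^esub> d) \<odot>\<^bsub>H\<^esub> ((S s \<otimes>\<^bsub>H\<^esub> a) \<otimes>\<^bsub>H\<^esub> c)"
  have "sw H (\<lambda>s t'. sw H (\<lambda>a b. sw H (\<lambda>c d. ?G s a b c d) y) t') t
      = sw H (\<lambda>s t'. \<phi> (t' \<otimes>\<^bsub>H\<^esub> y) \<odot>\<^bsub>H\<^esub> S s) t"
  proof (rule sw_eqI)
    fix s t' assume [simp]: "s \<in> carrier H" "t' \<in> carrier H"
    have "sw H (\<lambda>a b. sw H (\<lambda>c d. \<phi> (b \<otimes>\<^bsub>H\<^esub> d) \<odot>\<^bsub>H\<^esub> (S s \<otimes>\<^bsub>H\<^esub> (a \<otimes>\<^bsub>H\<^esub> c))) y) t'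
        = sw H (\<lambda>a b. \<phi> b \<odot>\<^bsub>H\<^esub> (S s \<otimes>\<^bsub>H\<^esub> a)) (t' \<otimes>\<^bsub>H\<^esub> y)"
      by (rule sw_mult[symmetric]) (rule lin | simp)+
    also have "\<dots> = \<phi> (t' \<otimes>\<^bsub>H\<^esub> y) \<odot>\<^bsub>H\<^esub> (S s \<otimes>\<^bsub>H\<^esub> \<one>\<^bsub>H\<^esub>)"
      by (rule left_dual_integral_sw[OF \<phi>]) (rule lin | simp)+
    finally show "sw H (\<lambda>a b. sw H (\<lambda>c d. ?G s a b c d) y) t' = \<phi> (t' \<otimes>\<^bsub>H\<^esub> y) \<odot>\<^bsub>H\<^esub> S s"
      by (simp add: H.m_assoc)
  qed simp
  moreover have "sw H (\<lambda>s t'. sw H (\<lambda>a b. sw H (\<lambda>c d. ?G s a b c d) y) t') t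
      = sw H (\<lambda>t' b. sw H (\<lambda>s a. sw H (\<lambda>c d. ?G s a b c d) y) t') t"
    by (rule sw_coassoc[symmetric]) (rule lin | simp)+
  moreover have "\<dots> = sw H (\<lambda>t' b. \<epsilon> t' \<odot>\<^bsub>H\<^esub> sw H (\<lambda>c d. \<phi> (b \<otimes>\<^bsub>H\<^esub> d) \<odot>\<^bsub>H\<^esub> (\<one>\<^bsub>H\<^esub> \<otimes>\<^bsub>H\<^esub> c)) y) t"
    by (rule sw_eqI, simp, rule sw_antipode_left) (rule lin | simp)+
  moreover have "\<dots> = sw H (\<lambda>c d. \<phi> (t \<otimes>\<^bsub>H\<^esub> d) \<odot>\<^bsub>H\<^esub> (\<one>\<^bsub>H\<^esub> \<otimes>\<^bsub>H\<^esub> c)) y"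
    by (rule sw_counit_left) (rule lin | simp)+
  moreover have "\<dots> = sw H (\<lambda>c d. \<epsilon> d \<odot>\<^bsub>H\<^esub> (\<phi> t \<odot>\<^bsub>H\<^esub> c)) y"
    using t mod_homD(3)[OF dual_mod_hom[of \<phi>]] by (intro sw_eqI) (simp_all add: smult_assoc1)
  moreover have "\<dots> = \<phi> t \<odot>\<^bsub>H\<^esub> y"
    by (rule sw_counit_right) (rule lin | simp)+
  ultimately show ?thesis by simp
qed

text \<open>The integrals are E_i \<circ> T and T(S(e_i)). Since \<open>T\<close> fixes right
  integrals, their pairing is E_i(T(S(e_i))), the i-th summand of the trace in
  \<open>trace_T_S\<close>.\<close>

lemma integral_pairing_unit:
  obtains \<phi> t where "\<And>i. i \<in> I \<Longrightarrow> \<phi> i \<in> carrier (left_dual_integrals R H)"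
    "\<And>i. i \<in> I \<Longrightarrow> t i \<in> carrier (right_integrals H)"
    "\<And>i. i \<in> I \<Longrightarrow> \<phi> i (t i) \<in> carrier R"
    "\<And>x. x \<in> carrier H \<Longrightarrow> (\<Oplus>\<^bsub>H\<^esub>i\<in>I. \<phi> i (t i) \<odot>\<^bsub>H\<^esub> x) = x"
proof
  let ?k = "regular_module R"
  let ?\<phi> = "\<lambda>i. \<lambda>x\<in>carrier H. E i (T x)" and ?t = "\<lambda>i. T (S (e i))"
  show t: "?t i \<in> carrier (right_integrals H)" if "i \<in> I" for i
    using that by (intro T_right_integral) simp
  have \<phi>t: "?\<phi> i (?t i) = E i (T (S (e i)))" if "i \<in> I" for i
    using that T_right_integral_eq[OF t[OF that]] by simp
  show "?\<phi> i (?t i) \<in> carrier R" if "i \<in> I" for i using that by simp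
  show "?\<phi> i \<in> carrier (left_dual_integrals R H)" if "i \<in> I" for i
    using that by (intro comp_T_left_dual_integral) simp
  fix x assume x: "x \<in> carrier H"
  have "(\<Oplus>\<^bsub>H\<^esub>i\<in>I. ?\<phi> i (?t i) \<odot>\<^bsub>H\<^esub> x) = (\<Oplus>\<^bsub>H\<^esub>i\<in>I. E i (T (S (e i))) \<odot>\<^bsub>H\<^esub> x)"
    using x \<phi>t by (intro finsum_eqI) simp_all
  also have "\<dots> = (\<Oplus>\<^bsub>?k\<^esub>i\<in>I. E i (T (S (e i)))) \<odot>\<^bsub>H\<^esub> x"
    using x by (intro mod_hom_finsum[symmetric, OF _ _ mod_hom_smult_left[OF mod_hom_id]]) (auto simp: finite_I)
  finally show "(\<Oplus>\<^bsub>H\<^esub>i\<in>I. ?\<phi> i (?t i) \<odot>\<^bsub>H\<^esub> x) = x"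
    using x by (simp add: trace_T_S)
qed

lemma S_bij: "bij_betw S (carrier H) (carrier H)"
proof -
  obtain \<phi> t where \<phi>: "\<And>i. i \<in> I \<Longrightarrow> \<phi> i \<in> carrier (left_dual_integrals R H)"
    and t: "\<And>i. i \<in> I \<Longrightarrow> t i \<in> carrier (right_integrals H)"
    and r [simp]: "\<And>i. i \<in> I \<Longrightarrow> \<phi> i (t i) \<in> carrier R"
    and unit: "\<And>x. x \<in> carrier H \<Longrightarrow> (\<Oplus>\<^bsub>H\<^esub>i\<in>I. \<phi> i (t i) \<odot>\<^bsub>H\<^esub> x) = x"
    using integral_pairing_unit by blast
  have [simp]: "\<phi> i \<in> carrier (dual R H)" if "i \<in> I" for i
    using \<phi>[OF that] by (simp add: left_dual_integral_iff)
  have [simp]: "t i \<in> carrier H" if "i \<in> I" for i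
    using t[OF that] by simp
  have "inj_on S (carrier H)"
  proof (rule inj_onI)
    fix x y assume xy: "x \<in> carrier H" "y \<in> carrier H" "S x = S y"
    \<comment> \<open>A single pair only shows equality after scaling by \<phi>_i(t_i); summing over
      i removes the scalars.\<close>
    have "\<phi> i (t i) \<odot>\<^bsub>H\<^esub> x = \<phi> i (t i) \<odot>\<^bsub>H\<^esub> y" if "i \<in> I" for i
    proof -
      note * = integral_pairing_left[OF \<phi>[OF that] t[OF that]]
      show ?thesis using *[OF xy(1)] *[OF xy(2)] by (simp only: xy(3))
    qed
    then have "(\<Oplus>\<^bsub>H\<^esub>i\<in>I. \<phi> i (t i) \<odot>\<^bsub>H\<^esub> x) = (\<Oplus>\<^bsub>H\<^esub>i\<in>I. \<phi> i (t i) \<odot>\<^bsub>H\<^esub> y)"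
      using xy by (intro finsum_eqI) simp_all
    then show "x = y" using unit xy by simp
  qed
  moreover have "y \<in> S ` carrier H" if y: "y \<in> carrier H" for y
  proof -
    \<comment> \<open>By \<open>integral_pairing_right\<close>, \<open>?u i\<close> is a preimage of
      \<phi>_i(t_i) y under S; the sum of these is a preimage of y.\<close>
    let ?u = "\<lambda>i. sw H (\<lambda>a b. \<phi> i (b \<otimes>\<^bsub>H\<^esub> y) \<odot>\<^bsub>H\<^esub> a) (t i)"
    have "S (?u i) = \<phi> i (t i) \<odot>\<^bsub>H\<^esub> y" if [simp]: "i \<in> I" for i
    proof -
      have "S (?u i) = sw H (\<lambda>a b. S (\<phi> i (b \<otimes>\<^bsub>H\<^esub> y) \<odot>\<^bsub>H\<^esub> a)) (t i)"
        using y by (intro sw_hom[OF _ _ antipode_linear]) simp_all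
      also have "\<dots> = sw H (\<lambda>a b. \<phi> i (b \<otimes>\<^bsub>H\<^esub> y) \<odot>\<^bsub>H\<^esub> S a) (t i)"
        using y by (intro sw_eqI) (simp_all add: mod_homD(3)[OF antipode_linear])
      finally show ?thesis using integral_pairing_right[OF \<phi> t y] by simp
    qed
    then have 1: "(\<Oplus>\<^bsub>H\<^esub>i\<in>I. S (?u i)) = y"
      using unit[OF y] y by (subst finsum_eqI[of _ "\<lambda>i. \<phi> i (t i) \<odot>\<^bsub>H\<^esub> y"]) simp_all
    have 2: "S (\<Oplus>\<^bsub>H\<^esub>i\<in>I. ?u i) = (\<Oplus>\<^bsub>H\<^esub>i\<in>I. S (?u i))"
      using y by (intro mod_hom_finsum[OF _ _ antipode_linear] finite_I) auto
    have "(\<Oplus>\<^bsub>H\<^esub>i\<in>I. ?u i) \<in> carrier H"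
      using y by (intro finsum_in_carrier) simp
    then show ?thesis by (rule image_eqI[rotated]) (simp only: 1 2)
  qed
  ultimately show ?thesis by (auto simp: bij_betw_def)
qed

end

section \<open>Modules of integrals and the exchange of sides\<close>

context hopf_algebra
begin

lemma module_left_integrals: "module R (left_integrals H)"
  using module_equalizer[OF module_axiom, of "carrier H" "\<lambda>h t. h \<otimes>\<^bsub>H\<^esub> t" "\<lambda>h t. \<epsilon> h \<odot>\<^bsub>H\<^esub> t"]
  by (simp add: left_integrals_def mult_mod_hom mod_hom_smult mod_hom_id)

lemma module_right_integrals: "module R (right_integrals H)"
  using module_equalizer[OF module_axiom, of "carrier H" "\<lambda>h t. t \<otimes>\<^bsub>H\<^esub> h" "\<lambda>h t. \<epsilon> h \<odot>\<^bsub>H\<^esub> t"]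
  by (simp add: right_integrals_def mult_mod_hom mod_hom_smult mod_hom_id)

end

context fgp_hopf_algebra
begin

text \<open>The Sweedler form of the condition, unlike the one with convolutions, is directly an
  equality of linear maps into \<open>H\<close> for each x.\<close>

lemma module_left_dual_integrals: "module R (left_dual_integrals R H)"
proof -
  interpret D: module R "dual R H" by simp
  let ?F = "\<lambda>x \<phi>. sw H (\<lambda>a b. \<phi> b \<odot>\<^bsub>H\<^esub> a) x" and ?G = "\<lambda>x \<phi>. \<phi> x \<odot>\<^bsub>H\<^esub> \<one>\<^bsub>H\<^esub>"
  have "?F x \<in> mod_hom R (dual R H) H" "?G x \<in> mod_hom R (dual R H) H" if "x \<in> carrier H" for x
    using that by - (rule lin | simp)+
  then have "module R ((dual R H)\<lparr>carrier := {\<phi> \<in> carrier (dual R H). \<forall>x\<in>carrier H. ?F x \<phi> = ?G x \<phi>}\<rparr>)"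
    by (rule D.module_equalizer[OF module_axiom])
  also have "{\<phi> \<in> carrier (dual R H). \<forall>x\<in>carrier H. ?F x \<phi> = ?G x \<phi>} = carrier (left_dual_integrals R H)"
    by (auto simp: left_dual_integral_iff)
  finally show ?thesis by (simp add: left_dual_integrals_def)
qed

lemma S_inv:
  assumes "x \<in> carrier H"
  obtains y where "y \<in> carrier H" "x = S y"
  using S_bij assms by (auto simp: bij_betw_def)

lemma ball_S: "(\<forall>y\<in>carrier H. Q y) \<longleftrightarrow> (\<forall>x\<in>carrier H. Q (S x))"
proof -
  have "(\<forall>y\<in>S ` carrier H. Q y) \<longleftrightarrow> (\<forall>x\<in>carrier H. Q (S x))" by simp
  then show ?thesis by (simp only: bij_betw_imp_surj_on[OF S_bij])
qed

lemma S_inj: "\<lbrakk>S x = S y; x \<in> carrier H; y \<in> carrier H\<rbrakk> \<Longrightarrow> x = y"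
  using S_bij by (auto simp: bij_betw_def inj_on_def)

text \<open>S reverses products and preserves the counit. Surjectivity lets an arbitrary left factor
  be written S(g), and injectivity reflects the integral condition back along S.\<close>

lemma right_integrals_isomorphic: "mod_isomorphic R (right_integrals H) (left_integrals H)"
proof -
  have "S \<in> mod_hom R (right_integrals H) (left_integrals H)"
  proof (rule mod_homI)
    fix t assume t: "t \<in> carrier (right_integrals H)"
    have "h \<otimes>\<^bsub>H\<^esub> S t = \<epsilon> h \<odot>\<^bsub>H\<^esub> S t" if h: "h \<in> carrier H" for h
    proof -
      obtain g where g: "g \<in> carrier H" "h = S g" using S_inv[OF h] .
      have "S g \<otimes>\<^bsub>H\<^esub> S t = S (t \<otimes>\<^bsub>H\<^esub> g)" using t g by (intro S_mult[symmetric]) simp_all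
      also have "\<dots> = \<epsilon> g \<odot>\<^bsub>H\<^esub> S t" using t g by (simp add: mod_homD(3)[OF antipode_linear])
      finally show ?thesis using g by simp
    qed
    then show "S t \<in> carrier (left_integrals H)" using t by simp
  qed (use mod_homD[OF antipode_linear] in simp_all)
  moreover have "bij_betw S (carrier (right_integrals H)) (carrier (left_integrals H))"
  proof (rule bij_betw_imageI)
    show "inj_on S (carrier (right_integrals H))"
      by (rule inj_onI) (simp add: S_inj)
    show "S ` carrier (right_integrals H) = carrier (left_integrals H)"
    proof
      show "S ` carrier (right_integrals H) \<subseteq> carrier (left_integrals H)"
        using mod_homD(1)[OF \<open>S \<in> mod_hom R (right_integrals H) (left_integrals H)\<close>] by blast
      show "carrier (left_integrals H) \<subseteq> S ` carrier (right_integrals H)"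
      proof
        fix l assume l: "l \<in> carrier (left_integrals H)"
        then have "l \<in> carrier H" by simp
        then obtain t where t: "t \<in> carrier H" "l = S t" by (rule S_inv)
        have "t \<otimes>\<^bsub>H\<^esub> h = \<epsilon> h \<odot>\<^bsub>H\<^esub> t" if "h \<in> carrier H" for h
          by (rule S_inj) (use l t that in \<open>simp_all add: S_mult mod_homD(3)[OF antipode_linear]\<close>)
        then show "l \<in> S ` carrier (right_integrals H)" using t by auto
      qed
    qed
  qed
  ultimately show ?thesis unfolding mod_isomorphic_def by blast
qed

text \<open>The dual counterpart: composing functionals with S exchanges the legs of the coproduct,
  by \<open>sw_S\<close>.\<close>

lemma dual_integrals_isomorphic: "mod_isomorphic R (left_dual_integrals R H) (right_dual_integrals R H)"
proof -
  let ?F = "\<lambda>\<phi>. \<lambda>x\<in>carrier H. \<phi> (S x)"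
  have dual: "\<phi> \<in> carrier (dual R H)" if "\<phi> \<in> carrier (left_dual_integrals R H)" for \<phi>
    using that by (simp add: left_dual_integral_iff)
  have closed: "?F \<phi> \<in> carrier (dual R H)" if "\<phi> \<in> carrier (dual R H)" for \<phi>
    by (rule dual_compose_closed[OF that antipode_linear])
  have S_sw: "S (sw H (\<lambda>a b. \<phi> (S a) \<odot>\<^bsub>H\<^esub> b) x) = sw H (\<lambda>a b. \<phi> b \<odot>\<^bsub>H\<^esub> a) (S x)"
    if [simp]: "\<phi> \<in> carrier (dual R H)" "x \<in> carrier H" for \<phi> x
  proof -
    note [lin] = dual_compose[of \<phi>]
    have "S (sw H (\<lambda>a b. \<phi> (S a) \<odot>\<^bsub>H\<^esub> b) x) = sw H (\<lambda>a b. S (\<phi> (S a) \<odot>\<^bsub>H\<^esub> b)) x"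
      by (rule sw_hom[OF _ _ antipode_linear]) simp_all
    also have "\<dots> = sw H (\<lambda>a b. \<phi> (S a) \<odot>\<^bsub>H\<^esub> S b) x"
      by (simp add: mod_homD(3)[OF antipode_linear])
    also have "\<dots> = sw H (\<lambda>a b. \<phi> b \<odot>\<^bsub>H\<^esub> a) (S x)"
      by (rule sw_S[symmetric, where \<beta>="\<lambda>a b. \<phi> b \<odot>\<^bsub>H\<^esub> a"]) (rule lin | simp)+
    finally show ?thesis .
  qed
  \<comment> \<open>Applying S to the right-hand condition for \<phi> \<circ> S at x yields the
    left-hand condition for \<phi> at S(x). Injectivity of S makes this an equivalence.\<close>
  have iff: "?F \<phi> \<in> carrier (right_dual_integrals R H) \<longleftrightarrow> \<phi> \<in> carrier (left_dual_integrals R H)"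
    if [simp]: "\<phi> \<in> carrier (dual R H)" for \<phi>
  proof -
    have "sw H (\<lambda>a b. ?F \<phi> a \<odot>\<^bsub>H\<^esub> b) x = ?F \<phi> x \<odot>\<^bsub>H\<^esub> \<one>\<^bsub>H\<^esub> \<longleftrightarrow>
        sw H (\<lambda>a b. \<phi> b \<odot>\<^bsub>H\<^esub> a) (S x) = \<phi> (S x) \<odot>\<^bsub>H\<^esub> \<one>\<^bsub>H\<^esub>" if [simp]: "x \<in> carrier H" for x
    proof -
      have "S (\<phi> (S x) \<odot>\<^bsub>H\<^esub> \<one>\<^bsub>H\<^esub>) = \<phi> (S x) \<odot>\<^bsub>H\<^esub> \<one>\<^bsub>H\<^esub>"
        by (simp add: mod_homD(3)[OF antipode_linear])
      moreover have "sw H (\<lambda>a b. ?F \<phi> a \<odot>\<^bsub>H\<^esub> b) x = sw H (\<lambda>a b. \<phi> (S a) \<odot>\<^bsub>H\<^esub> b) x" by simp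
      ultimately show ?thesis
        using S_sw[of \<phi> x] S_inj[of "sw H (\<lambda>a b. \<phi> (S a) \<odot>\<^bsub>H\<^esub> b) x" "\<phi> (S x) \<odot>\<^bsub>H\<^esub> \<one>\<^bsub>H\<^esub>"] by auto
    qed
    \<comment> \<open>Surjectivity of S: a condition at all S(x) is a condition at all
      elements.\<close>
    then have "(\<forall>x\<in>carrier H. sw H (\<lambda>a b. ?F \<phi> a \<odot>\<^bsub>H\<^esub> b) x = ?F \<phi> x \<odot>\<^bsub>H\<^esub> \<one>\<^bsub>H\<^esub>) \<longleftrightarrow>
        (\<forall>x\<in>carrier H. sw H (\<lambda>a b. \<phi> b \<odot>\<^bsub>H\<^esub> a) x = \<phi> x \<odot>\<^bsub>H\<^esub> \<one>\<^bsub>H\<^esub>)"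
      unfolding ball_S[of "\<lambda>x. sw H (\<lambda>a b. \<phi> b \<odot>\<^bsub>H\<^esub> a) x = \<phi> x \<odot>\<^bsub>H\<^esub> \<one>\<^bsub>H\<^esub>"] by (rule ball_cong[OF HOL.refl])
    then show ?thesis
      unfolding right_dual_integral_iff left_dual_integral_iff using closed[OF that] that by blast
  qed
  have "?F \<in> mod_hom R (left_dual_integrals R H) (right_dual_integrals R H)"
    by (rule mod_homI) (use dual iff in \<open>auto simp: dual_simps\<close>)
  moreover have "bij_betw ?F (carrier (left_dual_integrals R H)) (carrier (right_dual_integrals R H))"
  proof (rule bij_betw_imageI)
    show "inj_on ?F (carrier (left_dual_integrals R H))"
    proof (rule inj_onI)
      fix \<phi> \<psi> assume *: "\<phi> \<in> carrier (left_dual_integrals R H)" "\<psi> \<in> carrier (left_dual_integrals R H)"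
        and eq: "?F \<phi> = ?F \<psi>"
      have "\<forall>x\<in>carrier H. \<phi> (S x) = \<psi> (S x)"
        using fun_cong[OF eq] by (metis restrict_apply')
      then show "\<phi> = \<psi>"
        using * dual unfolding ball_S[of "\<lambda>x. \<phi> x = \<psi> x", symmetric] by (intro dual_eqI) auto
    qed
    show "?F ` carrier (left_dual_integrals R H) = carrier (right_dual_integrals R H)"
    proof
      show "?F ` carrier (left_dual_integrals R H) \<subseteq> carrier (right_dual_integrals R H)"
        using dual iff by blast
      show "carrier (right_dual_integrals R H) \<subseteq> ?F ` carrier (left_dual_integrals R H)"
      proof
        fix \<psi> assume \<psi>: "\<psi> \<in> carrier (right_dual_integrals R H)"
        let ?\<phi> = "\<lambda>x\<in>carrier H. \<psi> (inv_into (carrier H) S x)"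
        have d: "\<psi> \<in> carrier (dual R H)" using \<psi> by (simp add: right_dual_integral_iff)
        have \<phi>: "?\<phi> \<in> carrier (dual R H)"
          by (rule dual_compose_closed[OF d mod_hom_inv[OF module_axiom antipode_linear S_bij]])
        have eq: "?F ?\<phi> = \<psi>"
          by (rule dual_eqI[OF closed[OF \<phi>] d]) (simp add: bij_betw_inv_into_left[OF S_bij])
        have "?\<phi> \<in> carrier (left_dual_integrals R H)"
          using iff[OF \<phi>, unfolded eq] \<psi> by blast
        then show "\<psi> \<in> ?F ` carrier (left_dual_integrals R H)"
          unfolding image_iff by (rule bexI[rotated]) (rule eq[symmetric])
      qed
    qed
  qed
  ultimately show ?thesis unfolding mod_isomorphic_def by blast
qed

lemma left_dual_integrals_isomorphic:
  "mod_isomorphic R (left_dual_integrals R H) (dual R (right_integrals H))"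
proof -
  let ?J = "carrier (right_integrals H)"
  let ?F = "\<lambda>\<phi>. restrict \<phi> ?J"
  interpret J: module R "right_integrals H" by (rule module_right_integrals)
  have dual: "\<phi> \<in> carrier (dual R H)" if "\<phi> \<in> carrier (left_dual_integrals R H)" for \<phi>
    using that by (simp add: left_dual_integral_iff)
  have closed: "?F \<phi> \<in> carrier (dual R (right_integrals H))" if "\<phi> \<in> carrier (dual R H)" for \<phi>
    by (rule J.dual_restrict) (use mod_homD[OF dual_mod_hom[OF that]] in \<open>auto intro!: mod_homI\<close>)
  have G: "(\<lambda>x\<in>carrier H. g (T x)) \<in> carrier (left_dual_integrals R H)"
    if g: "g \<in> carrier (dual R (right_integrals H))" for g
  proof -
    have "T \<in> mod_hom R H (right_integrals H)"
      by (rule mod_homI) (use T_right_integral mod_homD[OF T_mod_hom] in simp_all)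
    then have g': "(\<lambda>x\<in>carrier H. g (T x)) \<in> carrier (dual R H)"
      by (intro dual_restrict mod_hom_compose[OF J.dual_mod_hom[OF g]])
    \<comment> \<open>The functional \<open>g\<close> lives only on integrals. Its pullback along
      \<open>T\<close> is defined on \<open>H\<close>, and pulling back once more changes nothing
      because \<open>T\<close> is idempotent; so \<open>comp_T_left_dual_integral\<close> applies to
      it.\<close>
    have "(\<lambda>x\<in>carrier H. (\<lambda>x\<in>carrier H. g (T x)) (T x)) = (\<lambda>x\<in>carrier H. g (T x))"
      using T_right_integral_eq[OF T_right_integral] by (intro restrict_ext) simp
    then show ?thesis using comp_T_left_dual_integral[OF g'] by simp
  qed
  have "?F \<in> mod_hom R (left_dual_integrals R H) (dual R (right_integrals H))"
    by (rule mod_homI) (use dual closed in \<open>auto simp: dual_record_simps\<close>)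
  moreover have "bij_betw ?F (carrier (left_dual_integrals R H)) (carrier (dual R (right_integrals H)))"
  proof (rule bij_betw_byWitness[where f'="\<lambda>g. \<lambda>x\<in>carrier H. g (T x)"])
    show "\<forall>\<phi>\<in>carrier (left_dual_integrals R H). (\<lambda>x\<in>carrier H. ?F \<phi> (T x)) = \<phi>"
    proof
      fix \<phi> assume \<phi>: "\<phi> \<in> carrier (left_dual_integrals R H)"
      have eq: "(\<lambda>x\<in>carrier H. ?F \<phi> (T x)) x = \<phi> x" if "x \<in> carrier H" for x
        using that T_right_integral[OF that] left_dual_integral_T[OF \<phi> that] by simp
      show "(\<lambda>x\<in>carrier H. ?F \<phi> (T x)) = \<phi>"
        by (rule dual_eqI[OF dual[OF G[OF closed[OF dual[OF \<phi>]]]] dual[OF \<phi>] eq])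
    qed
    show "\<forall>g\<in>carrier (dual R (right_integrals H)). ?F (\<lambda>x\<in>carrier H. g (T x)) = g"
    proof
      fix g assume g: "g \<in> carrier (dual R (right_integrals H))"
      have eq: "?F (\<lambda>x\<in>carrier H. g (T x)) t = g t" if t: "t \<in> ?J" for t
        using t T_right_integral_eq[OF t] by simp
      show "?F (\<lambda>x\<in>carrier H. g (T x)) = g"
        by (rule J.dual_eqI[OF closed[OF dual[OF G[OF g]]] g eq])
    qed
  qed (use G closed dual in auto)
  ultimately show ?thesis unfolding mod_isomorphic_def by blast
qed

end

theorem corollary3p5:
  fixes k :: "('a, 'r) ring_scheme" and H :: "('a, 'h, 's) hopf_scheme"
  assumes "hopf_algebra k H"
    and "finitely_generated_module k H"
    and "projective_module k H"
  shows "mod_isomorphic k (left_dual_integrals k H) (right_dual_integrals k H) \<and>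
    mod_isomorphic k (right_dual_integrals k H) (dual k (left_integrals H)) \<and>
    mod_isomorphic k (dual k (left_integrals H)) (dual k (right_integrals H))"
proof -
  interpret hopf_algebra k H by fact
  obtain I :: "'h set" and e E where "dual_basis k H I e E"
    using dual_basis_exists[OF assms(2,3)] by blast
  then interpret fgp_hopf_algebra k H I e E
    using assms(1) by (simp add: fgp_hopf_algebra_def)
  \<comment> \<open>S goes from right to left integrals, so its transpose goes from the dual of the
    left ones to the dual of the right ones.\<close>
  have lr: "mod_isomorphic k (dual k (left_integrals H)) (dual k (right_integrals H))"
    by (intro mod_isomorphic_dual module_left_integrals module_right_integrals right_integrals_isomorphic)
  have "mod_isomorphic k (dual k (right_integrals H)) (dual k (left_integrals H))"
    by (rule mod_isomorphic_sym[OF module.module_dual[OF module_left_integrals] lr])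
  then have "mod_isomorphic k (left_dual_integrals k H) (dual k (left_integrals H))"
    by (rule mod_isomorphic_trans[OF left_dual_integrals_isomorphic])
  then have "mod_isomorphic k (right_dual_integrals k H) (dual k (left_integrals H))"
    by (rule mod_isomorphic_trans[OF
          mod_isomorphic_sym[OF module_left_dual_integrals dual_integrals_isomorphic]])
  then show ?thesis using lr dual_integrals_isomorphic by blast
qed

end
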